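(* Let $0\le\alpha<1$. Then $$P\big(\Lambda(\omega)\text{ is a zero set for }\mathcal{D}_\alpha\big)=1\quad\text{if and only if}\quad \sum_{n}2^{-(1-\alpha)n}N_n<\infty,$$ and $$P\big(\Lambda(\omega)\text{ is a zero set for }\mathcal{D}_\alpha\big)=0\quad\text{if and only if}\quad \sum_{n}2^{-(1-\alpha)n}N_n=\infty.$$
   Context: $\mathbb{D}$ is the open unit disk. Random sequence: $(\rho_n)\subset[0,1)$ is a fixed (deterministic) sequence of radii, $(\theta_n(\omega))$ is a sequence of independent random variables, all uniformly distributed on $[0,2\pi]$, and $\Lambda(\omega)=\{\lambda_n\}$ is the set of points $\lambda_n=\rho_n e^{i\theta_n(\omega)}$. For $n=0,1,2,\ldots$, $N_n=\#\{\lambda\in\Lambda(\omega): 1-2^{-n}\le|\lambda|<1-2^{-n-1}\}$; almost surely this depends only on the radii. Sums over $n$ run over $n\ge0$. The weighted Dirichlet space $\mathcal{D}_\alpha$, $0\le\alpha\le1$, is the space of analytic functions $f$ on $\mathbb{D}$ with $\|f\|_\alpha^2=|f(0)|^2+\int_{\mathbb{D}}|f'(z)|^2(1-|z|^2)^{1-\alpha}\,dA(z)<\infty$, where $dA=dx\,dy/\pi$; $\mathcal{D}_0=H^2$ is the Hardy space. A set $\Lambda\subset\mathbb{D}$ is a zero set (zero sequence) for $\mathcal{D}_\alpha$ if there is a function $f\in\mathcal{D}_\alpha$, not identically zero, vanishing at every point of $\Lambda$. *)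

theory Defs
  imports "HOL-Probability.Probability" "HOL-Complex_Analysis.Complex_Analysis"
begin

abbreviation unit_disc :: "complex set" where
  "unit_disc \<equiv> ball 0 1"

definition area :: "complex measure" where
  "area = scale_measure (ennreal (1 / pi)) lborel"

definition dirichlet_norm_sq :: "real \<Rightarrow> (complex \<Rightarrow> complex) \<Rightarrow> ennreal" where
  "dirichlet_norm_sq \<alpha> f =
     ennreal ((cmod (f 0))\<^sup>2) +
     (\<integral>\<^sup>+ z \<in> unit_disc. ennreal ((cmod (deriv f z))\<^sup>2 * (1 - (cmod z)\<^sup>2) powr (1 - \<alpha>)) \<partial>area)"

text \<open>Functions are total on the complex plane; only their values on the unit disc matter.\<close>

definition dirichlet_space :: "real \<Rightarrow> (complex \<Rightarrow> complex) set" where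
  "dirichlet_space \<alpha> = {f. f holomorphic_on unit_disc \<and> dirichlet_norm_sq \<alpha> f < \<infinity>}"

definition is_zero_set :: "real \<Rightarrow> complex set \<Rightarrow> bool" where
  "is_zero_set \<alpha> L \<longleftrightarrow> L \<subseteq> unit_disc \<and>
     (\<exists>f \<in> dirichlet_space \<alpha>. (\<exists>z \<in> unit_disc. f z \<noteq> 0) \<and> (\<forall>z \<in> L. f z = 0))"

definition random_points :: "(nat \<Rightarrow> real) \<Rightarrow> (nat \<Rightarrow> 'w \<Rightarrow> real) \<Rightarrow> 'w \<Rightarrow> complex set" where
  "random_points \<rho> \<theta> \<omega> = range (\<lambda>n. rcis (\<rho> n) (\<theta> n \<omega>))"

text \<open>The number of points of a set in a dyadic annulus; its value is \<open>\<infinity>\<close> if there are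
  infinitely many (which \<^const>\<open>card\<close> would report as \<open>0\<close>).\<close>

definition annulus_count :: "complex set \<Rightarrow> nat \<Rightarrow> ennreal" where
  "annulus_count L n =
     emeasure (count_space UNIV) {z \<in> L. 1 - 1 / 2 ^ n \<le> cmod z \<and> cmod z < 1 - 1 / 2 ^ (n + 1)}"

text \<open>Evaluated at the random set of a given outcome. For \<open>random_points\<close> the counts are almost surely
  determined by the radii; counting points rather than indices matters when \<open>\<rho> n = 0\<close> for
  several \<open>n\<close>.\<close>

definition weighted_count_sum :: "real \<Rightarrow> complex set \<Rightarrow> ennreal" where
  "weighted_count_sum \<alpha> L = (\<Sum>n. ennreal (2 powr (- (1 - \<alpha>) * real n)) * annulus_count L n)"

end

theory Submission
  imports Defs
begin

text \<open>Write \<open>\<rho>\<^sub>n\<close> for the radii and \<open>S = (\<Sum>\<rho>\<^sub>n > 0. (1 - \<rho>\<^sub>n) powr (1 - \<alpha>))\<close>.  Almost surely the points with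
positive radius are distinct, and grouping them by dyadic annuli shows that the weighted count is
finite exactly when \<open>S\<close> is.  So the theorem is the dichotomy: if \<open>S < \<infinity>\<close> the points always form a zero
set, and if \<open>S = \<infinity>\<close> they almost surely do not.

A function \<open>f z = (\<Sum>k. a\<^sub>k * z ^ k)\<close> has squared norm \<open>(\<Sum>k. d\<^sub>k * \<bar>a\<^sub>k\<bar>\<^sup>2)\<close>, where \<open>d\<^sub>k\<close> is comparable to
the reciprocal of the \<open>k\<close>-th coefficient of the kernel \<open>(1 - z) powr (\<alpha> - 1)\<close>.  This follows from
rotation invariance of area and Parseval's identity (\<open>disc_parseval\<close>, \<open>dirichlet_norm_sq_eq_suminf\<close>,
\<open>dir_weight_Suc\<close>) and yields pointwise bounds, hence normal families: functions of bounded norm that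
stay away from \<open>0\<close> at a fixed point have nonzero limits, and zeros pass to the limit
(\<open>dirichlet_zero_limit\<close>).  This compactness replaces infinite products and also shows that the
zero-set event is Borel: it is a countable union of closed conditions on the angles.

If \<open>S < \<infinity>\<close>, take finite Blaschke products over more and more of the points.  For \<open>\<alpha> > 0\<close>,
\<open>\<bar>B'\<bar>\<^sup>2 * (1 - \<bar>z\<bar>\<^sup>2) powr (1 - \<alpha>)\<close> is at most \<open>\<bar>B'\<bar> * (1 - \<bar>z\<bar>\<^sup>2) powr (- \<alpha>)\<close> by Schwarz-Pick, and
\<open>\<bar>B'\<bar>\<close> is at most the sum of the moduli of the derivatives of the single factors; integrating gives
a bound in terms of \<open>S\<close>.  For \<open>\<alpha> = 0\<close> the norm is at most the supremum.  A limit along the compactness lemma is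
the function sought (\<open>is_zero_set_if_summable\<close>).

If \<open>S = \<infinity>\<close> and \<open>\<alpha> = 0\<close>, dividing \<open>f\<close> by finite Blaschke products does not increase its Hardy norm, so the
zeros of a nonzero \<open>f\<close> satisfy the Blaschke condition (\<open>hardy_zeros_summable\<close>), a contradiction.

If \<open>S = \<infinity>\<close> and \<open>\<alpha> > 0\<close>, attach to each point the arc of radius \<open>(1 - \<rho>\<^sub>n) powr (1 - \<alpha>)\<close> about its angle.
Divergence, independence and Fubini show that almost surely almost every point of the circle lies in
infinitely many of these arcs (\<open>AE_arcs_cover\<close>).  The key estimate is that for disjoint arcs the
points form a Carleson family, uniformly:
\<open>(\<Sum>n. \<bar>I\<^sub>n\<bar> * \<bar>g \<lambda>\<^sub>n\<bar>\<^sup>2) \<le> C * \<parallel>g\<parallel>\<^sup>2\<close> (\<open>arcs_carleson\<close>).  By duality this is a Schur test for the kernel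
at pairs of points, where disjointness of the arcs lets each row be compared with the integral of
\<open>\<bar>s\<bar> powr (\<alpha> - 1)\<close>.  Now let \<open>P\<^sub>N\<close> be a Taylor polynomial of a function \<open>f\<close> vanishing at all the points, and
select by Vitali's theorem disjoint arcs, as small as desired, that cover almost all of a third of the
circle.  As \<open>f - P\<^sub>N = - P\<^sub>N\<close> at the points, the estimate bounds the integral of \<open>\<bar>P\<^sub>N\<bar>\<^sup>2\<close> there by a
multiple of \<open>\<parallel>f - P\<^sub>N\<parallel>\<^sup>2\<close>, which tends to \<open>0\<close>.  Hence \<open>f = 0\<close> (\<open>dirichlet_vanishes_if_arcs_cover\<close>).\<close>

section \<open>Area measure: rotations and radial functions\<close>

(* Frees the dollar sign for the components of a vector. *)
unbundle no fps_syntax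

definition of_plane :: "real^2 \<Rightarrow> complex" where
  "of_plane v = Complex (v $ 1) (v $ 2)"

lemma of_plane_measurable [measurable]: "of_plane \<in> borel_measurable borel"
proof -
  have "continuous_on UNIV of_plane"
    unfolding of_plane_def[abs_def] Complex_eq by (intro continuous_intros)
  then show ?thesis by (rule borel_measurable_continuous_onI)
qed

lemma of_plane_vimage_box:
  "of_plane -` box l u = box (vector [Re l, Im l]) (vector [Re u, Im u])"
  by (auto simp: of_plane_def in_box_complex_iff mem_box_cart forall_2)

lemma distr_of_plane: "distr lborel borel of_plane = (lborel :: complex measure)"
proof (rule lborel_eqI[symmetric])
  fix l u :: complex
  assume le: "\<And>b. b \<in> Basis \<Longrightarrow> l \<bullet> b \<le> u \<bullet> b"
  have "Re l \<le> Re u" "Im l \<le> Im u"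
    using le[of 1] le[of \<i>] by (auto simp: Basis_complex_def inner_complex_def)
  then have "\<forall>b\<in>Basis. (vector [Re l, Im l] :: real^2) \<bullet> b \<le> vector [Re u, Im u] \<bullet> b"
    by (auto simp: Basis_vec_def inner_axis UNIV_2)
  then have "emeasure lborel (box (vector [Re l, Im l]) (vector [Re u, Im u]) :: (real^2) set)
     = (\<Prod>b\<in>Basis. (vector [Re u, Im u] - vector [Re l, Im l] :: real^2) \<bullet> b)"
    by (simp add: emeasure_lborel_box)
  also have "(\<Prod>b\<in>Basis. (vector [Re u, Im u] - vector [Re l, Im l] :: real^2) \<bullet> b)
     = (\<Prod>i\<in>UNIV. (vector [Re u, Im u] - vector [Re l, Im l] :: real^2) $ i)"
    unfolding Basis_vec_def
    by (subst prod.UNION_disjoint) (auto simp: inner_axis axis_eq_axis)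
  also have "\<dots> = (Re u - Re l) * (Im u - Im l)"
    by (simp add: UNIV_2)
  also have "\<dots> = (\<Prod>b\<in>Basis. (u - l) \<bullet> b)"
    by (simp add: Basis_complex_def inner_complex_def)
  finally show "emeasure (distr lborel borel of_plane) (box l u) = (\<Prod>b\<in>Basis. (u - l) \<bullet> b)"
    by (simp add: emeasure_distr of_plane_vimage_box)
qed simp

text \<open>The map \<open>of_plane\<close> carries Lebesgue measure of the Euclidean plane to that of the complex numbers, and
there a rotation is an orthogonal map.\<close>

lemma distr_lborel_rotation:
  assumes "cmod c = 1"
  shows "distr lborel borel ((*) c) = (lborel :: complex measure)"
proof (rule lborel_eqI[symmetric])
  fix l u :: complex
  assume le: "\<And>b. b \<in> Basis \<Longrightarrow> l \<bullet> b \<le> u \<bullet> b"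
  define T :: "real^2 \<Rightarrow> real^2" where
    "T v = vector [Re c * v $ 1 + Im c * v $ 2, Re c * v $ 2 - Im c * v $ 1]" for v
  have c1: "(Re c)\<^sup>2 + (Im c)\<^sup>2 = 1"
    using assms by (metis cmod_power2 one_power2)
  have "linear T"
    by (rule linearI) (auto simp: T_def vec_eq_iff forall_2 algebra_simps)
  moreover have "T v \<bullet> T w = v \<bullet> w" for v w
  proof -
    have "T v \<bullet> T w = ((Re c)\<^sup>2 + (Im c)\<^sup>2) * (v \<bullet> w)"
      by (simp add: T_def inner_vec_def UNIV_2 power2_eq_square algebra_simps)
    with c1 show ?thesis by simp
  qed
  ultimately have T: "orthogonal_transformation T"
    by (simp add: orthogonal_transformation_def)
  have cT: "c * of_plane (T v) = of_plane v" for v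
  proof -
    have "c * of_plane (T v) = complex_of_real ((Re c)\<^sup>2 + (Im c)\<^sup>2) * of_plane v"
      by (simp add: complex_eq_iff T_def of_plane_def power2_eq_square algebra_simps)
    with c1 show ?thesis by simp
  qed
  let ?B = "of_plane -` box l u"
  have eq: "of_plane -` ((*) c -` box l u) = T ` ?B"
  proof (intro equalityI subsetI)
    fix w assume w: "w \<in> of_plane -` ((*) c -` box l u)"
    obtain v where "w = T v"
      using orthogonal_transformation_surj[OF T] by (metis surjD)
    with w show "w \<in> T ` ?B" using cT by auto
  qed (auto simp: cT)
  have lm: "?B \<in> lmeasurable" by (simp add: of_plane_vimage_box)
  have "emeasure (distr lborel borel ((*) c)) (box l u)
      = emeasure (lborel :: complex measure) ((*) c -` box l u)"
    by (subst emeasure_distr) auto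
  also have "\<dots> = emeasure (distr lborel borel of_plane) ((*) c -` box l u)"
    by (simp add: distr_of_plane)
  also have "\<dots> = emeasure lborel (T ` ?B)"
  proof -
    have "(*) c -` box l u \<in> sets borel"
      using measurable_sets_borel[of "(*) c" borel "box l u"] by simp
    then show ?thesis
      unfolding eq[symmetric] by (subst emeasure_distr) simp_all
  qed
  also have "\<dots> = emeasure lebesgue (T ` ?B)"
  proof -
    have "T ` ?B \<in> sets borel"
      using measurable_sets_borel[of "of_plane" borel "(*) c -` box l u"]
        measurable_sets_borel[of "(*) c" borel "box l u"]
      unfolding eq[symmetric] by simp
    then show ?thesis by simp
  qed
  also have "\<dots> = emeasure lebesgue ?B"
    using measure_orthogonal_image[OF T lm] measurable_orthogonal_image[OF T lm] lm
    by (simp add: emeasure_eq_measure2)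
  also have "\<dots> = emeasure lborel ?B"
    by (simp add: of_plane_vimage_box)
  also have "\<dots> = emeasure (distr lborel borel of_plane) (box l u)"
    by (subst emeasure_distr) auto
  also have "\<dots> = (\<Prod>b\<in>Basis. (u - l) \<bullet> b)"
    using le by (simp add: distr_of_plane emeasure_lborel_box)
  finally show "emeasure (distr lborel borel ((*) c)) (box l u) = (\<Prod>b\<in>Basis. (u - l) \<bullet> b)" .
qed simp

lemma nn_integral_area:
  assumes "f \<in> borel_measurable borel"
  shows "(\<integral>\<^sup>+ z. f z \<partial>area) = ennreal (1 / pi) * (\<integral>\<^sup>+ z. f z \<partial>lborel)"
  using assms by (simp add: area_def nn_integral_scale_measure)

lemma nn_integral_area_rotation:
  assumes [measurable]: "f \<in> borel_measurable borel" and "cmod c = 1"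
  shows "(\<integral>\<^sup>+ z. f (c * z) \<partial>area) = (\<integral>\<^sup>+ z. f z \<partial>area)"
proof -
  have "(\<integral>\<^sup>+ z. f z \<partial>lborel) = (\<integral>\<^sup>+ z. f z \<partial>distr lborel borel ((*) c))"
    by (simp add: distr_lborel_rotation assms)
  also have "\<dots> = (\<integral>\<^sup>+ z. f (c * z) \<partial>lborel)"
    by (subst nn_integral_distr) auto
  finally show ?thesis by (simp add: nn_integral_area)
qed

lemma sets_area [simp, measurable_cong]: "sets area = sets borel"
  by (simp add: area_def)

lemma space_area [simp]: "space area = UNIV"
  by (simp add: area_def space_scale_measure)

text \<open>Under normalised area on the disc, \<open>\<bar>z\<bar>\<^sup>2\<close> is uniformly distributed on the unit interval, because a
disc of radius \<open>r\<close> has normalised area \<open>r\<^sup>2\<close>.\<close>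

lemma nn_integral_disc_radial:
  assumes [measurable]: "W \<in> borel_measurable borel"
  shows "(\<integral>\<^sup>+ z \<in> unit_disc. W ((cmod z)\<^sup>2) \<partial>area) = (\<integral>\<^sup>+ t \<in> {0..<1::real}. W t \<partial>lborel)"
proof -
  let ?D = "density area (indicator unit_disc)"
  let ?M = "distr ?D borel (\<lambda>z. (cmod z)\<^sup>2)"
  let ?N = "density lborel (indicator {0..<1::real})"
  have em: "emeasure area A = ennreal (1 / pi) * emeasure lborel A" if "A \<in> sets borel" for A
    using that by (simp add: area_def emeasure_scale_measure)
  have ball1: "emeasure area (ball 0 1) = 1"
    by (simp add: em emeasure_ball unit_ball_vol_2 flip: ennreal_mult)
  have M: "emeasure ?M {x<..} = emeasure area {z \<in> unit_disc. x < (cmod z)\<^sup>2}" for x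
  proof -
    have A: "(\<lambda>z. (cmod z)\<^sup>2) -` {x<..} \<in> sets borel"
      using measurable_sets_borel[of "\<lambda>z::complex. (cmod z)\<^sup>2" borel "{x<..}"] by simp
    have "emeasure ?M {x<..} = emeasure ?D ((\<lambda>z. (cmod z)\<^sup>2) -` {x<..})"
      by (subst emeasure_distr) auto
    also have "\<dots> = (\<integral>\<^sup>+ z. indicator (unit_disc \<inter> (\<lambda>z. (cmod z)\<^sup>2) -` {x<..}) z \<partial>area)"
      using A by (subst emeasure_density) (auto simp: borel_measurable_indicator simp flip: indicator_inter_arith)
    also have "\<dots> = emeasure area (unit_disc \<inter> (\<lambda>z. (cmod z)\<^sup>2) -` {x<..})"
      using A by (intro nn_integral_indicator) auto
    finally show ?thesis by (simp add: vimage_def Int_def)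
  qed
  have N: "emeasure ?N {x<..} = emeasure lborel ({0..<1} \<inter> {x<..})" for x
    by (subst emeasure_density) (auto simp flip: nn_integral_indicator indicator_inter_arith)
  have "?M = ?N"
  proof (rule measure_eqI_lessThan)
    fix x :: real
    show eq: "emeasure ?M {x<..} = emeasure ?N {x<..}"
    proof (cases "x < 0")
      case True
      then have "{z \<in> unit_disc. x < (cmod z)\<^sup>2} = unit_disc"
        by (auto intro: less_le_trans)
      moreover from True have "{0..<1} \<inter> {x<..} = {0..<1}" by auto
      ultimately show ?thesis unfolding M N by (simp add: ball1)
    next
      case False
      then have x: "0 \<le> x" by simp
      show ?thesis
      proof (cases "x < 1")
        case True
        have "{z \<in> unit_disc. x < (cmod z)\<^sup>2} = ball 0 1 - cball 0 (sqrt x)"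
          using x by (auto simp: not_le real_sqrt_less_iff real_less_lsqrt real_le_lsqrt
             dest: real_less_rsqrt) (meson not_le real_le_rsqrt real_less_lsqrt norm_ge_zero)+
        moreover have "emeasure area (ball 0 1 - cball 0 (sqrt x)) = ennreal (1 - x)"
        proof -
          have "emeasure area (cball 0 (sqrt x)) = ennreal x"
            using x by (simp add: em emeasure_cball unit_ball_vol_2 flip: ennreal_mult)
          moreover have "cball 0 (sqrt x) \<subseteq> ball (0::complex) 1"
            using x le_less_trans[of _ "sqrt x" 1] real_sqrt_lt_1_iff[of x] True by auto
          ultimately show ?thesis
            using x True by (subst emeasure_Diff) (auto simp: ball1 ennreal_minus simp flip: ennreal_1)
        qed
        moreover have "{0..<1} \<inter> {x<..} = {x<..<1}" using x by auto
        ultimately show ?thesis unfolding M N using True by simp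
      next
        case False
        have "(cmod z)\<^sup>2 \<le> x" if "z \<in> unit_disc" for z
        proof -
          have "(cmod z)\<^sup>2 \<le> 1\<^sup>2" using that by (intro power_mono) auto
          with False show ?thesis by simp
        qed
        then have "{z \<in> unit_disc. x < (cmod z)\<^sup>2} = {}"
          by (metis (mono_tags, lifting) Collect_empty_eq not_less)
        moreover from False have "{0..<1} \<inter> {x<..} = {}" by auto
        ultimately show ?thesis unfolding M N by (metis emeasure_empty)
      qed
    qed
    have "emeasure ?N {x<..} \<le> emeasure lborel {0..<1::real}"
      unfolding N by (intro emeasure_mono) auto
    then show "emeasure ?M {x<..} < \<infinity>"
      unfolding eq by (simp add: le_less_trans)
  qed simp_all
  have "(\<integral>\<^sup>+ t. W t \<partial>?M) = (\<integral>\<^sup>+ z. W ((cmod z)\<^sup>2) \<partial>?D)"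
    by (rule nn_integral_distr) auto
  also have "\<dots> = (\<integral>\<^sup>+ z. indicator unit_disc z * W ((cmod z)\<^sup>2) \<partial>area)"
    by (rule nn_integral_density) (auto intro!: borel_measurable_indicator)
  finally show ?thesis
    using \<open>?M = ?N\<close> by (simp add: nn_integral_density mult.commute)
qed

section \<open>Taylor coefficients and Parseval identities\<close>

definition taylor_coeff :: "(complex \<Rightarrow> complex) \<Rightarrow> nat \<Rightarrow> complex" where
  "taylor_coeff f k = (deriv ^^ k) f 0 / fact k"

lemma taylor_coeff_sums:
  assumes "f holomorphic_on unit_disc" "cmod z < 1"
  shows "(\<lambda>k. taylor_coeff f k * z ^ k) sums f z"
  using holomorphic_power_series[of f 0 1 z] assms by (simp add: taylor_coeff_def)

lemma taylor_coeff_abs_summable: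
  assumes "f holomorphic_on unit_disc" "0 \<le> r" "r < 1"
  shows "summable (\<lambda>k. cmod (taylor_coeff f k) * r ^ k)"
proof -
  obtain s where s: "r < s" "s < 1" using assms dense by blast
  have "summable (\<lambda>k. taylor_coeff f k * complex_of_real s ^ k)"
    using taylor_coeff_sums[of f s] assms s by (auto simp: sums_iff)
  then have "summable (\<lambda>k. norm (taylor_coeff f k * complex_of_real r ^ k))"
    by (rule powser_insidea) (use assms s in auto)
  then show ?thesis using assms by (simp add: norm_mult norm_power)
qed

lemma taylor_coeff_deriv:
  "taylor_coeff (deriv f) k = of_nat (Suc k) * taylor_coeff f (Suc k)"
  using of_nat_neq_0[of k, where ?'a=complex]
  by (simp add: taylor_coeff_def funpow_swap1 divide_simps del: of_nat_Suc)

lemma taylor_coeff_0 [simp]: "taylor_coeff f 0 = f 0"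
  by (simp add: taylor_coeff_def)

lemma has_integral_cis_int:
  "((\<lambda>t. cis (of_int n * t)) has_integral (if n = 0 then of_real (2 * pi) else 0)) {0..2*pi}"
proof (cases "n = 0")
  case True
  then show ?thesis using has_integral_const_real[of "1::complex" 0 "2*pi"]
    by (simp add: scaleR_conv_of_real)
next
  case False
  have "((\<lambda>t. cis (of_int n * t)) has_integral
      cis (of_int n * (2 * pi)) / (\<i> * of_int n) - cis (of_int n * 0) / (\<i> * of_int n)) {0..2*pi}"
  proof (rule fundamental_theorem_of_calculus)
    fix t :: real
    have "((\<lambda>z. exp (\<i> * (of_int n * z)) / (\<i> * of_int n)) has_field_derivative
        exp (\<i> * (of_int n * of_real t))) (at (complex_of_real t))"
      using False by (auto intro!: derivative_eq_intros simp: algebra_simps)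
    then have "((\<lambda>t. exp (\<i> * (of_int n * complex_of_real t)) / (\<i> * of_int n)) has_vector_derivative
        exp (\<i> * (of_int n * of_real t))) (at t within {0..2*pi})"
      by (rule has_vector_derivative_real_field)
    then show "((\<lambda>t. cis (of_int n * t) / (\<i> * of_int n)) has_vector_derivative cis (of_int n * t))
        (at t within {0..2*pi})"
      by (simp add: cis_conv_exp)
  qed simp
  moreover have "cis (of_int n * (2 * pi)) = 1"
    by (metis cis_multiple_2pi Ints_of_int mult.commute)
  ultimately show ?thesis using False by simp
qed

text \<open>Orthogonality of the characters \<open>cis (k * t)\<close>.\<close>

lemma has_integral_norm_sq_trig_poly:
  fixes c :: "nat \<Rightarrow> complex"
  shows "((\<lambda>t. (cmod (\<Sum>k<N. c k * cis (real k * t)))\<^sup>2) has_integral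
     2 * pi * (\<Sum>k<N. (cmod (c k))\<^sup>2)) {0..2*pi}"
proof -
  let ?F = "\<lambda>t. \<Sum>j<N. \<Sum>k<N. c j * cnj (c k) * cis (of_int (int j - int k) * t)"
  have "(?F has_integral (\<Sum>j<N. \<Sum>k<N. c j * cnj (c k) *
        (if int j - int k = 0 then of_real (2 * pi) else 0))) {0..2*pi}"
    by (intro has_integral_sum has_integral_mult_right has_integral_cis_int) auto
  also have "(\<Sum>j<N. \<Sum>k<N. c j * cnj (c k) * (if int j - int k = 0 then of_real (2 * pi) else 0))
      = (\<Sum>j<N. c j * cnj (c j) * of_real (2 * pi))"
    by (simp add: if_distrib cong: if_cong)
  also have "\<dots> = complex_of_real (2 * pi * (\<Sum>k<N. (cmod (c k))\<^sup>2))"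
    by (simp add: sum_distrib_left mult_ac complex_norm_square[symmetric] flip: of_real_power)
  finally have 1: "(?F has_integral complex_of_real (2 * pi * (\<Sum>k<N. (cmod (c k))\<^sup>2))) {0..2*pi}" .
  have 2: "?F t = complex_of_real ((cmod (\<Sum>k<N. c k * cis (real k * t)))\<^sup>2)" for t
  proof -
    have "complex_of_real ((cmod (\<Sum>k<N. c k * cis (real k * t)))\<^sup>2)
       = (\<Sum>k<N. c k * cis (real k * t)) * cnj (\<Sum>k<N. c k * cis (real k * t))"
      by (simp only: complex_norm_square)
    also have "\<dots> = (\<Sum>j<N. \<Sum>k<N. c j * cis (real j * t) * (cnj (c k) * cis (- (real k * t))))"
      by (simp add: sum_product cis_cnj)
    also have "\<dots> = ?F t"
    proof (intro sum.cong refl)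
      fix j k
      have "cis (real j * t) * cis (- (real k * t)) = cis (of_int (int j - int k) * t)"
        by (simp add: cis_mult algebra_simps)
      then show "c j * cis (real j * t) * (cnj (c k) * cis (- (real k * t)))
          = c j * cnj (c k) * cis (of_int (int j - int k) * t)"
        by (metis (no_types, opaque_lifting) mult.assoc mult.left_commute)
    qed
    finally show ?thesis by simp
  qed
  show ?thesis
    using has_integral_Re[OF 1] unfolding 2 by simp
qed

lemma cis_power_mult: "(cis t * z) ^ k = z ^ k * cis (real k * t)"
  by (simp only: power_mult_distrib Complex.DeMoivre mult.commute)

text \<open>The Taylor polynomials converge to \<open>f\<close> on the circle through \<open>z\<close> and are dominated there by a constant, so
Parseval's identity for trigonometric polynomials passes to the limit.\<close>

lemma circle_parseval:
  assumes f: "f holomorphic_on unit_disc" and z: "cmod z < 1"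
  shows "(\<lambda>t. (cmod (f (cis t * z)))\<^sup>2) integrable_on {0..2*pi}"
    and "(\<lambda>k. 2 * pi * ((cmod (taylor_coeff f k))\<^sup>2 * cmod z ^ (2 * k)))
       sums integral {0..2*pi} (\<lambda>t. (cmod (f (cis t * z)))\<^sup>2)"
proof -
  let ?c = "\<lambda>k. taylor_coeff f k * z ^ k"
  let ?S = "\<lambda>N t. (cmod (\<Sum>k<N. ?c k * cis (real k * t)))\<^sup>2"
  let ?B = "\<Sum>k. cmod (taylor_coeff f k) * cmod z ^ k"
  have hi: "(?S N has_integral 2 * pi * (\<Sum>k<N. (cmod (?c k))\<^sup>2)) {0..2*pi}" for N
    by (rule has_integral_norm_sq_trig_poly)
  have bd: "norm (?S N t) \<le> ?B\<^sup>2" for N t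
  proof -
    have "cmod (\<Sum>k<N. ?c k * cis (real k * t)) \<le> (\<Sum>k<N. cmod (taylor_coeff f k) * cmod z ^ k)"
      by (rule order.trans[OF norm_sum]) (simp add: norm_mult norm_power)
    also have "\<dots> \<le> ?B"
      using taylor_coeff_abs_summable[OF f _ z] by (intro sum_le_suminf) auto
    finally show ?thesis by (simp add: power_mono)
  qed
  have lim: "(\<lambda>N. ?S N t) \<longlonglongrightarrow> (cmod (f (cis t * z)))\<^sup>2" for t
  proof -
    have "(\<lambda>k. taylor_coeff f k * (cis t * z) ^ k) sums f (cis t * z)"
      using z by (intro taylor_coeff_sums[OF f]) (simp add: norm_mult)
    then have "(\<lambda>N. \<Sum>k<N. ?c k * cis (real k * t)) \<longlonglongrightarrow> f (cis t * z)"
      by (simp add: sums_def cis_power_mult mult.assoc)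
    then show ?thesis by (intro tendsto_intros)
  qed
  have int: "?S N integrable_on {0..2*pi}" for N using hi by blast
  show "(\<lambda>t. (cmod (f (cis t * z)))\<^sup>2) integrable_on {0..2*pi}"
    by (rule dominated_convergence(1)[OF int integrable_const_ivl bd lim])
  have "(\<lambda>N. integral {0..2*pi} (?S N)) \<longlonglongrightarrow> integral {0..2*pi} (\<lambda>t. (cmod (f (cis t * z)))\<^sup>2)"
    by (rule dominated_convergence(2)[OF int integrable_const_ivl bd lim])
  moreover have "integral {0..2*pi} (?S N)
      = (\<Sum>k<N. 2 * pi * ((cmod (taylor_coeff f k))\<^sup>2 * cmod z ^ (2 * k)))" for N
    using integral_unique[OF hi[of N]]
    by (simp add: sum_distrib_left norm_mult norm_power power_mult_distrib power_mult[symmetric] mult.commute)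
  ultimately show "(\<lambda>k. 2 * pi * ((cmod (taylor_coeff f k))\<^sup>2 * cmod z ^ (2 * k)))
       sums integral {0..2*pi} (\<lambda>t. (cmod (f (cis t * z)))\<^sup>2)"
    by (simp add: sums_def)
qed

lemma nn_circle_parseval:
  assumes f: "f holomorphic_on unit_disc" and z: "cmod z < 1"
  shows "(\<integral>\<^sup>+ t \<in> {0..2*pi}. ennreal ((cmod (f (cis t * z)))\<^sup>2) \<partial>lborel) =
    ennreal (2 * pi) * (\<Sum>k. ennreal ((cmod (taylor_coeff f k))\<^sup>2) * ennreal (((cmod z)\<^sup>2) ^ k))"
proof -
  note cp = circle_parseval[OF f z]
  have "(\<integral>\<^sup>+ t \<in> {0..2*pi}. ennreal ((cmod (f (cis t * z)))\<^sup>2) \<partial>lborel)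
      = ennreal (integral {0..2*pi} (\<lambda>t. (cmod (f (cis t * z)))\<^sup>2))"
    by (rule nn_integral_has_integral_lebesgue') (use cp(1) in auto)
  also have "\<dots> = (\<Sum>k. ennreal (2 * pi * ((cmod (taylor_coeff f k))\<^sup>2 * cmod z ^ (2 * k))))"
    using cp(2) by (intro suminf_ennreal_eq[symmetric]) auto
  also have "\<dots> = (\<Sum>k. ennreal (2 * pi) * (ennreal ((cmod (taylor_coeff f k))\<^sup>2) * ennreal (((cmod z)\<^sup>2) ^ k)))"
    by (simp add: ennreal_mult power_mult)
  finally show ?thesis by simp
qed

text \<open>A radial weight is unchanged when \<open>z\<close> is rotated, so the integral over the disc may be averaged over
all rotations; Parseval on each circle then leaves a sum of radial integrals.\<close>

lemma disc_parseval:
  assumes f: "f holomorphic_on unit_disc" and [measurable]: "W \<in> borel_measurable borel"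
  shows "(\<integral>\<^sup>+ z \<in> unit_disc. (ennreal ((cmod (f z))\<^sup>2) * W ((cmod z)\<^sup>2)) \<partial>area) =
    (\<Sum>k. ennreal ((cmod (taylor_coeff f k))\<^sup>2) * (\<integral>\<^sup>+ t \<in> {0..<1}. (ennreal (t ^ k) * W t) \<partial>lborel))"
proof -
  define g where "g z = (if z \<in> unit_disc then f z else 0)" for z
  have [measurable]: "unit_disc \<in> sets borel" by simp
  have g[measurable]: "g \<in> borel_measurable borel"
    unfolding g_def[abs_def]
    using f by (intro borel_measurable_continuous_on_if) (auto intro: holomorphic_on_imp_continuous_on)
  have sf: "sigma_finite_measure area"
  proof -
    have "area = density lborel (\<lambda>_. ennreal (1 / pi))"
      by (rule measure_eqI) (auto simp: area_def emeasure_scale_measure emeasure_density nn_integral_cmult_indicator)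
    moreover have "sigma_finite_measure (density lborel (\<lambda>_::complex. ennreal (1 / pi)))"
      using sigma_finite_measure.sigma_finite_iff_density_finite[OF sigma_finite_lborel,
        of "\<lambda>_. ennreal (1 / pi)"] by simp
    ultimately show ?thesis by (simp only:)
  qed
  interpret P: pair_sigma_finite area "lborel :: real measure"
    using sf by (simp add: pair_sigma_finite_def sigma_finite_lborel)
  let ?F = "\<lambda>z. ennreal ((cmod (g z))\<^sup>2) * W ((cmod z)\<^sup>2) * indicator unit_disc z"
  have 1: "(\<integral>\<^sup>+ z \<in> unit_disc. (ennreal ((cmod (f z))\<^sup>2) * W ((cmod z)\<^sup>2)) \<partial>area)
      = (\<integral>\<^sup>+ z. ?F z \<partial>area)"
    by (intro nn_integral_cong) (auto simp: g_def indicator_def)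
  have [measurable]: "cis \<in> borel_measurable borel"
    by (intro borel_measurable_continuous_onI continuous_intros)
  have "ennreal (2 * pi) * (\<integral>\<^sup>+ z. ?F z \<partial>area)
      = (\<integral>\<^sup>+ t. (\<integral>\<^sup>+ z. ?F (cis t * z) \<partial>area) * indicator {0..2*pi} t \<partial>lborel)"
  proof -
    have "(\<integral>\<^sup>+ z. ?F (cis t * z) \<partial>area) = (\<integral>\<^sup>+ z. ?F z \<partial>area)" for t
      by (rule nn_integral_area_rotation) auto
    then show ?thesis
      by (simp only: nn_integral_cmult_indicator sets_lborel atLeastAtMost_borel) (simp add: mult.commute)
  qed
  also have "\<dots> = (\<integral>\<^sup>+ t. (\<integral>\<^sup>+ z. ?F (cis t * z) * indicator {0..2*pi} t \<partial>area) \<partial>lborel)"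
    by (intro nn_integral_cong nn_integral_multc[symmetric]) auto
  also have "\<dots> = (\<integral>\<^sup>+ z. (\<integral>\<^sup>+ t. ?F (cis t * z) * indicator {0..2*pi} t \<partial>lborel) \<partial>area)"
    by (rule P.Fubini') simp
  also have "\<dots> = (\<integral>\<^sup>+ z. ennreal (2 * pi) * ((\<Sum>k. ennreal ((cmod (taylor_coeff f k))\<^sup>2) *
       (ennreal (((cmod z)\<^sup>2) ^ k) * W ((cmod z)\<^sup>2))) * indicator unit_disc z) \<partial>area)"
  proof (intro nn_integral_cong)
    fix z :: complex
    show "(\<integral>\<^sup>+ t. ?F (cis t * z) * indicator {0..2*pi} t \<partial>lborel) = ennreal (2 * pi) *
       ((\<Sum>k. ennreal ((cmod (taylor_coeff f k))\<^sup>2) * (ennreal (((cmod z)\<^sup>2) ^ k) * W ((cmod z)\<^sup>2)))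
         * indicator unit_disc z)"
    proof (cases "z \<in> unit_disc")
      case True
      then have z: "cmod z < 1" by simp
      have "(\<integral>\<^sup>+ t. ?F (cis t * z) * indicator {0..2*pi} t \<partial>lborel)
          = (\<integral>\<^sup>+ t. W ((cmod z)\<^sup>2) * (ennreal ((cmod (f (cis t * z)))\<^sup>2) * indicator {0..2*pi} t) \<partial>lborel)"
        using z by (intro nn_integral_cong) (auto simp: g_def norm_mult mult_ac)
      also have "\<dots> = (\<integral>\<^sup>+ t. W ((cmod z)\<^sup>2) * (ennreal ((cmod (g (cis t * z)))\<^sup>2) * indicator {0..2*pi} t) \<partial>lborel)"
        using z by (intro nn_integral_cong) (auto simp: g_def norm_mult mult_ac)
      also have "\<dots> = W ((cmod z)\<^sup>2) * (\<integral>\<^sup>+ t. (ennreal ((cmod (g (cis t * z)))\<^sup>2) * indicator {0..2*pi} t) \<partial>lborel)"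
        by (rule nn_integral_cmult) auto
      also have "\<dots> = W ((cmod z)\<^sup>2) * (\<integral>\<^sup>+ t\<in>{0..2*pi}. (ennreal ((cmod (f (cis t * z)))\<^sup>2)) \<partial>lborel)"
        using z by (intro arg_cong2[where f="(*)"] refl nn_integral_cong) (auto simp: g_def norm_mult mult_ac)
      also have "\<dots> = ennreal (2 * pi) * (W ((cmod z)\<^sup>2) *
          (\<Sum>k. ennreal ((cmod (taylor_coeff f k))\<^sup>2) * ennreal (((cmod z)\<^sup>2) ^ k)))"
        by (simp only: nn_circle_parseval[OF f z] mult.left_commute)
      also have "W ((cmod z)\<^sup>2) * (\<Sum>k. ennreal ((cmod (taylor_coeff f k))\<^sup>2) * ennreal (((cmod z)\<^sup>2) ^ k))
          = (\<Sum>k. ennreal ((cmod (taylor_coeff f k))\<^sup>2) * (ennreal (((cmod z)\<^sup>2) ^ k) * W ((cmod z)\<^sup>2)))"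
        by (subst ennreal_suminf_cmult[symmetric]) (simp add: mult_ac)
      finally show ?thesis using z by simp
    qed (simp add: norm_mult)
  qed
  also have "\<dots> = ennreal (2 * pi) * (\<integral>\<^sup>+ z. (\<Sum>k. ennreal ((cmod (taylor_coeff f k))\<^sup>2) *
       (ennreal (((cmod z)\<^sup>2) ^ k) * W ((cmod z)\<^sup>2))) * indicator unit_disc z \<partial>area)"
    by (rule nn_integral_cmult) simp
  finally have "(\<integral>\<^sup>+ z. ?F z \<partial>area) = (\<integral>\<^sup>+ z. (\<Sum>k. ennreal ((cmod (taylor_coeff f k))\<^sup>2) *
       (ennreal (((cmod z)\<^sup>2) ^ k) * W ((cmod z)\<^sup>2))) * indicator unit_disc z \<partial>area)"
    by (subst (asm) ennreal_mult_cancel_left) auto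
  also have "\<dots> = (\<integral>\<^sup>+ z. (\<Sum>k. ennreal ((cmod (taylor_coeff f k))\<^sup>2) *
       ((ennreal (((cmod z)\<^sup>2) ^ k) * W ((cmod z)\<^sup>2)) * indicator unit_disc z)) \<partial>area)"
    by (intro nn_integral_cong) (simp flip: ennreal_suminf_multc add: mult.assoc)
  also have "\<dots> = (\<Sum>k. \<integral>\<^sup>+ z. ennreal ((cmod (taylor_coeff f k))\<^sup>2) *
       ((ennreal (((cmod z)\<^sup>2) ^ k) * W ((cmod z)\<^sup>2)) * indicator unit_disc z) \<partial>area)"
    by (rule nn_integral_suminf) auto
  also have "\<dots> = (\<Sum>k. ennreal ((cmod (taylor_coeff f k))\<^sup>2) *
       (\<integral>\<^sup>+ z \<in> unit_disc. (ennreal (((cmod z)\<^sup>2) ^ k) * W ((cmod z)\<^sup>2)) \<partial>area))"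
    by (intro suminf_cong nn_integral_cmult) auto
  also have "\<dots> = (\<Sum>k. ennreal ((cmod (taylor_coeff f k))\<^sup>2) *
       (\<integral>\<^sup>+ t \<in> {0..<1}. (ennreal (t ^ k) * W t) \<partial>lborel))"
    by (simp add: nn_integral_disc_radial[of "\<lambda>t. ennreal (t ^ k) * W t" for k])
  finally show ?thesis unfolding 1 .
qed

section \<open>The Dirichlet norm in terms of coefficients\<close>

text \<open>The weight of \<open>\<bar>a\<^sub>k\<bar>\<^sup>2\<close> in the squared norm: for \<open>k > 0\<close> it is \<open>k\<^sup>2\<close> times the moment
\<open>\<integral> t ^ (k - 1) * (1 - t) powr (1 - \<alpha>)\<close> over the unit interval.\<close>

definition dir_weight :: "real \<Rightarrow> nat \<Rightarrow> real" where
  "dir_weight \<alpha> k = (if k = 0 then 1 else (real k)\<^sup>2 * Beta (real k) (2 - \<alpha>))"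

text \<open>The Taylor coefficients of \<open>(1 - z) powr (- \<beta>)\<close>.  With \<open>\<beta> = 1 - \<alpha>\<close> their reciprocals are weights
equivalent to \<open>dir_weight \<alpha>\<close>, for which the reproducing kernel is explicit.\<close>

definition ker_coeff :: "real \<Rightarrow> nat \<Rightarrow> real" where
  "ker_coeff \<beta> k = pochhammer \<beta> k / fact k"

lemma ker_coeff_pos: "0 < \<beta> \<Longrightarrow> 0 < ker_coeff \<beta> k"
  by (simp add: ker_coeff_def pochhammer_pos)

lemma ker_coeff_0 [simp]: "ker_coeff \<beta> 0 = 1"
  by (simp add: ker_coeff_def)

lemma ker_coeff_sums:
  assumes "cmod z < 1"
  shows "(\<lambda>k. of_real (ker_coeff \<beta> k) * z ^ k) sums ((1 - z) powr (- of_real \<beta>))"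
proof -
  have "(\<lambda>n. ((- of_real \<beta>) gchoose n) * (- z) ^ n) sums (1 + (- z)) powr (- of_real \<beta>)"
    by (rule gen_binomial_complex) (use assms in simp)
  moreover have "((- of_real \<beta>) gchoose n) * (- z) ^ n = of_real (ker_coeff \<beta> n) * z ^ n" for n
  proof -
    have "((- complex_of_real \<beta>) gchoose n) * (- z) ^ n
       = ((- 1) ^ n * (- 1) ^ n) * (pochhammer (of_real \<beta>) n / fact n * z ^ n)"
      by (simp only: gbinomial_pochhammer power_minus[of z] minus_minus) (simp add: mult_ac)
    then show ?thesis
      by (simp add: ker_coeff_def pochhammer_of_real flip: power_mult_distrib)
  qed
  ultimately show ?thesis by simp
qed

lemma ker_coeff_sums_real:
  assumes "0 \<le> x" "x < 1"
  shows "(\<lambda>k. ker_coeff \<beta> k * x ^ k) sums ((1 - x) powr (- \<beta>))"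
proof -
  have "(1 - complex_of_real x) powr (- of_real \<beta>) = of_real ((1 - x) powr (- \<beta>))"
    using powr_of_real[of "1 - x" "- \<beta>"] assms by simp
  then have "(\<lambda>k. complex_of_real (ker_coeff \<beta> k * x ^ k)) sums (of_real ((1 - x) powr (- \<beta>)))"
    using ker_coeff_sums[of "of_real x" \<beta>] assms by simp
  then show ?thesis by (simp only: sums_of_real_iff)
qed

text \<open>Written in Gamma functions, both sides differ only by the rational factor that remains when \<open>Gamma\<close> is
shifted by one.  For \<open>\<alpha> \<ge> 0\<close> that factor lies between \<open>(1 - \<alpha>) / 2\<close> and \<open>1\<close>, which makes the two weights equivalent.\<close>

lemma dir_weight_Suc:
  assumes "\<alpha> < 1"
  shows "dir_weight \<alpha> (Suc k) = (1 - \<alpha>) * real (Suc k) / (real (Suc k) + (1 - \<alpha>)) / ker_coeff (1 - \<alpha>) (Suc k)"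
proof -
  define \<beta> where "\<beta> = 1 - \<alpha>"
  have \<beta>: "\<beta> > 0" using assms by (simp add: \<beta>_def)
  have nz: "\<beta> \<notin> \<int>\<^sub>\<le>\<^sub>0" using \<beta> by (meson nonpos_Ints_nonpos not_le)
  have G: "Gamma \<beta> > 0" using \<beta> by simp
  have 1: "Gamma (\<beta> + real (Suc k)) = pochhammer \<beta> (Suc k) * Gamma \<beta>"
    by (subst pochhammer_Gamma[OF nz]) (use G in simp)
  have 2: "Gamma (real (Suc k) + (1 + \<beta>)) = (\<beta> + real (Suc k)) * Gamma (\<beta> + real (Suc k))"
  proof -
    have "\<beta> + real (Suc k) > 0" using \<beta> by simp
    then have "\<beta> + real (Suc k) \<notin> \<int>\<^sub>\<le>\<^sub>0" by (meson nonpos_Ints_nonpos not_le)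
    moreover have "real (Suc k) + (1 + \<beta>) = (\<beta> + real (Suc k)) + 1" by simp
    ultimately show ?thesis by (metis Gamma_plus1)
  qed
  have 3: "Gamma (1 + \<beta>) = \<beta> * Gamma \<beta>"
    unfolding add.commute[of 1 \<beta>] by (rule Gamma_plus1[OF nz])
  have 4: "Gamma (real (Suc k)) = fact k"
    using Gamma_fact[of k, where ?'a=real] by (simp add: add.commute)
  have "2 - \<alpha> = 1 + \<beta>" by (simp add: \<beta>_def)
  then have "dir_weight \<alpha> (Suc k) = (real (Suc k))\<^sup>2 * (fact k * (\<beta> * Gamma \<beta>) /
      ((\<beta> + real (Suc k)) * (pochhammer \<beta> (Suc k) * Gamma \<beta>)))"
    by (simp only: dir_weight_def Beta_def 1 2 3 4 nat.distinct if_False)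
  also have "\<dots> = \<beta> * real (Suc k) / (real (Suc k) + \<beta>) / (pochhammer \<beta> (Suc k) / (real (Suc k) * fact k))"
  proof -
    have alg: "s\<^sup>2 * (F * (\<beta> * G) / ((\<beta> + s) * (P * G))) = \<beta> * s / (s + \<beta>) / (P / (s * F))"
      if "G > 0" "P > 0" "s > 0" "F > 0" for s F G P :: real
    proof -
      have "\<beta> + s > 0" using that \<beta> by simp
      then show ?thesis using that by (simp add: divide_simps power2_eq_square)
    qed
    show ?thesis
      by (rule alg) (use G pochhammer_pos[OF \<beta>, of "Suc k"] in \<open>auto simp del: pochhammer_Suc of_nat_Suc\<close>)
  qed
  also have "\<dots> = \<beta> * real (Suc k) / (real (Suc k) + \<beta>) / ker_coeff \<beta> (Suc k)"
    by (simp only: ker_coeff_def fact_Suc of_nat_mult of_nat_fact)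
  finally show ?thesis by (simp add: \<beta>_def)
qed

lemma dir_weight_nonneg: "\<alpha> < 1 \<Longrightarrow> 0 \<le> dir_weight \<alpha> k"
proof (cases k)
  case (Suc n)
  assume "\<alpha> < 1"
  then show ?thesis
    unfolding Suc by (subst dir_weight_Suc) (use ker_coeff_pos[of "1 - \<alpha>" "Suc n"] in auto)
qed (simp add: dir_weight_def)

lemma dir_weight_le:
  assumes "0 \<le> \<alpha>" "\<alpha> < 1"
  shows "dir_weight \<alpha> k \<le> 1 / ker_coeff (1 - \<alpha>) k"
proof (cases k)
  case (Suc n)
  have "(1 - \<alpha>) * real (Suc n) / (real (Suc n) + (1 - \<alpha>)) \<le> 1"
  proof -
    have "(1 - \<alpha>) * real (Suc n) \<le> 1 * real (Suc n)" using assms by (intro mult_right_mono) auto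
    then have "(1 - \<alpha>) * real (Suc n) \<le> real (Suc n) + (1 - \<alpha>)"
      by (rule order.trans) (use assms in simp)
    then show ?thesis using assms by (subst divide_le_eq_1_pos) auto
  qed
  then show ?thesis unfolding Suc dir_weight_Suc[OF assms(2)]
    using ker_coeff_pos[of "1 - \<alpha>" "Suc n"] assms by (intro divide_right_mono) auto
qed (simp add: dir_weight_def)

lemma dir_weight_ge:
  assumes "0 \<le> \<alpha>" "\<alpha> < 1"
  shows "1 / ker_coeff (1 - \<alpha>) k \<le> 2 / (1 - \<alpha>) * dir_weight \<alpha> k"
proof (cases k)
  case 0
  then show ?thesis using assms by (simp add: dir_weight_def divide_simps)
next
  case (Suc n)
  have "1 \<le> 2 / (1 - \<alpha>) * ((1 - \<alpha>) * real (Suc n) / (real (Suc n) + (1 - \<alpha>)))"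
    using assms by (simp add: divide_simps)
  then have "1 / ker_coeff (1 - \<alpha>) k \<le> 2 / (1 - \<alpha>) * ((1 - \<alpha>) * real (Suc n) / (real (Suc n) + (1 - \<alpha>))) / ker_coeff (1 - \<alpha>) k"
    using ker_coeff_pos[of "1 - \<alpha>" k] assms by (intro divide_right_mono) auto
  then show ?thesis unfolding Suc dir_weight_Suc[OF assms(2)] by simp
qed

lemma nn_integral_Beta:
  assumes "s > -1"
  shows "(\<integral>\<^sup>+ t \<in> {0..<1}. (ennreal (t ^ k) * ennreal ((1 - t) powr s)) \<partial>lborel)
     = ennreal (Beta (real k + 1) (s + 1))"
proof -
  have "((\<lambda>t. t powr (real k + 1 - 1) * (1 - t) powr (s + 1 - 1)) has_integral Beta (real k + 1) (s + 1)) {0<..<1}"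
    unfolding has_integral_Icc_iff_Ioo[symmetric]
    by (rule has_integral_Beta_real) (use assms in auto)
  then have "(\<integral>\<^sup>+ t. ennreal (t powr (real k + 1 - 1) * (1 - t) powr (s + 1 - 1)) * indicator {0<..<1} t \<partial>lborel)
     = ennreal (Beta (real k + 1) (s + 1))"
    by (intro nn_integral_has_integral_lebesgue') auto
  moreover have "(\<integral>\<^sup>+ t \<in> {0..<1}. (ennreal (t ^ k) * ennreal ((1 - t) powr s)) \<partial>lborel) =
     (\<integral>\<^sup>+ t. ennreal (t powr (real k + 1 - 1) * (1 - t) powr (s + 1 - 1)) * indicator {0<..<1} t \<partial>lborel)"
  proof (rule nn_integral_cong_AE)
    have "AE t in lborel. t \<noteq> (0::real)" by (rule AE_lborel_singleton)
    then show "AE t in lborel. ennreal (t ^ k) * ennreal ((1 - t) powr s) * indicator {0..<1} t =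
       ennreal (t powr (real k + 1 - 1) * (1 - t) powr (s + 1 - 1)) * indicator {0<..<1} t"
      by eventually_elim (auto simp: indicator_def powr_realpow ennreal_mult)
  qed
  ultimately show ?thesis by simp
qed

lemma holomorphic_deriv_disc: "f holomorphic_on unit_disc \<Longrightarrow> deriv f holomorphic_on unit_disc"
  by (intro holomorphic_deriv) auto

lemma dirichlet_norm_sq_eq_suminf:
  assumes f: "f holomorphic_on unit_disc" and "\<alpha> < 1"
  shows "dirichlet_norm_sq \<alpha> f = (\<Sum>k. ennreal (dir_weight \<alpha> k * (cmod (taylor_coeff f k))\<^sup>2))"
proof -
  have "(\<integral>\<^sup>+ z \<in> unit_disc. ennreal ((cmod (deriv f z))\<^sup>2 * (1 - (cmod z)\<^sup>2) powr (1 - \<alpha>)) \<partial>area)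
     = (\<integral>\<^sup>+ z \<in> unit_disc. (ennreal ((cmod (deriv f z))\<^sup>2) * ennreal ((1 - (cmod z)\<^sup>2) powr (1 - \<alpha>))) \<partial>area)"
    by (simp add: ennreal_mult)
  also have "\<dots> = (\<Sum>k. ennreal ((cmod (taylor_coeff (deriv f) k))\<^sup>2) *
     (\<integral>\<^sup>+ t \<in> {0..<1}. (ennreal (t ^ k) * ennreal ((1 - t) powr (1 - \<alpha>))) \<partial>lborel))"
    by (rule disc_parseval[OF holomorphic_deriv_disc[OF f], where W="\<lambda>t. ennreal ((1 - t) powr (1 - \<alpha>))"]) measurable
  also have "\<dots> = (\<Sum>k. ennreal (dir_weight \<alpha> (Suc k) * (cmod (taylor_coeff f (Suc k)))\<^sup>2))"
  proof (intro suminf_cong)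
    fix k
    have "(\<integral>\<^sup>+ t \<in> {0..<1}. (ennreal (t ^ k) * ennreal ((1 - t) powr (1 - \<alpha>))) \<partial>lborel)
       = ennreal (Beta (real (Suc k)) (2 - \<alpha>))"
      using assms by (subst nn_integral_Beta) (auto simp: add_ac)
    moreover have "0 \<le> Beta (real (Suc k)) (2 - \<alpha>)"
      using assms by (simp add: Beta_def del: of_nat_Suc)
    ultimately show "ennreal ((cmod (taylor_coeff (deriv f) k))\<^sup>2) *
       (\<integral>\<^sup>+ t \<in> {0..<1}. (ennreal (t ^ k) * ennreal ((1 - t) powr (1 - \<alpha>))) \<partial>lborel)
      = ennreal (dir_weight \<alpha> (Suc k) * (cmod (taylor_coeff f (Suc k)))\<^sup>2)"
      by (simp add: dir_weight_def taylor_coeff_deriv norm_mult power_mult_distrib mult_ac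
          del: of_nat_Suc flip: ennreal_mult)
  qed
  finally have "dirichlet_norm_sq \<alpha> f = ennreal (dir_weight \<alpha> 0 * (cmod (taylor_coeff f 0))\<^sup>2) +
      (\<Sum>k. ennreal (dir_weight \<alpha> (Suc k) * (cmod (taylor_coeff f (Suc k)))\<^sup>2))"
    by (simp add: dirichlet_norm_sq_def dir_weight_def)
  then show ?thesis
    using suminf_offset[of "\<lambda>k. ennreal (dir_weight \<alpha> k * (cmod (taylor_coeff f k))\<^sup>2)" 1] by simp
qed

lemma sum_dir_weight_le:
  assumes f: "f holomorphic_on unit_disc" and "\<alpha> < 1" and "dirichlet_norm_sq \<alpha> f \<le> ennreal K" "0 \<le> K"
    and "finite A"
  shows "(\<Sum>k\<in>A. dir_weight \<alpha> k * (cmod (taylor_coeff f k))\<^sup>2) \<le> K"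
proof -
  have "ennreal (\<Sum>k\<in>A. dir_weight \<alpha> k * (cmod (taylor_coeff f k))\<^sup>2)
     = (\<Sum>k\<in>A. ennreal (dir_weight \<alpha> k * (cmod (taylor_coeff f k))\<^sup>2))"
    using dir_weight_nonneg[OF assms(2)] by (subst sum_ennreal) auto
  also have "\<dots> \<le> (\<Sum>k. ennreal (dir_weight \<alpha> k * (cmod (taylor_coeff f k))\<^sup>2))"
    using assms by (intro sum_le_suminf) auto
  also have "\<dots> \<le> ennreal K" using assms by (simp add: dirichlet_norm_sq_eq_suminf)
  finally show ?thesis using \<open>0 \<le> K\<close> by (subst (asm) ennreal_le_iff)
qed

lemma dirichlet_norm_sq_leI:
  assumes f: "f holomorphic_on unit_disc" and "\<alpha> < 1"
    and "\<And>n. (\<Sum>k<n. dir_weight \<alpha> k * (cmod (taylor_coeff f k))\<^sup>2) \<le> K"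
  shows "dirichlet_norm_sq \<alpha> f \<le> ennreal K"
  unfolding dirichlet_norm_sq_eq_suminf[OF assms(1,2)]
proof (rule suminf_le_const)
  fix n
  have "(\<Sum>k<n. ennreal (dir_weight \<alpha> k * (cmod (taylor_coeff f k))\<^sup>2)) =
      ennreal (\<Sum>k<n. dir_weight \<alpha> k * (cmod (taylor_coeff f k))\<^sup>2)"
    using dir_weight_nonneg[OF assms(2)] by (subst sum_ennreal) auto
  then show "(\<Sum>k<n. ennreal (dir_weight \<alpha> k * (cmod (taylor_coeff f k))\<^sup>2)) \<le> ennreal K"
    using assms(3)[of n] by (simp add: ennreal_leI)
qed simp

text \<open>Cauchy-Schwarz against the kernel \<open>(1 - \<bar>z\<bar>\<^sup>2) powr (\<alpha> - 1)\<close>.\<close>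

lemma dirichlet_pointwise_bound:
  assumes f: "f holomorphic_on unit_disc" and \<alpha>: "0 \<le> \<alpha>" "\<alpha> < 1"
    and K: "dirichlet_norm_sq \<alpha> f \<le> ennreal K" "0 \<le> K" and z: "cmod z < 1"
  shows "(cmod (f z))\<^sup>2 \<le> 2 / (1 - \<alpha>) * K * (1 - (cmod z)\<^sup>2) powr (\<alpha> - 1)"
proof -
  let ?a = "taylor_coeff f" and ?k = "ker_coeff (1 - \<alpha>)"
  have kp: "?k k > 0" for k using \<alpha> by (intro ker_coeff_pos) simp
  have z2: "(cmod z)\<^sup>2 < 1" using z by (simp add: abs_square_less_1)
  have "(\<lambda>n. (cmod (\<Sum>k<n. ?a k * z ^ k))\<^sup>2) \<longlonglongrightarrow> (cmod (f z))\<^sup>2"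
    using taylor_coeff_sums[OF f z] by (intro tendsto_intros) (simp add: sums_def)
  moreover have "(cmod (\<Sum>k<n. ?a k * z ^ k))\<^sup>2 \<le> 2 / (1 - \<alpha>) * K * (1 - (cmod z)\<^sup>2) powr (\<alpha> - 1)" for n
  proof -
    have "cmod (\<Sum>k<n. ?a k * z ^ k) \<le> (\<Sum>k<n. (cmod (?a k) / sqrt (?k k)) * (sqrt (?k k) * cmod z ^ k))"
      by (rule order.trans[OF norm_sum]) (use kp in \<open>simp add: norm_mult norm_power less_imp_neq[symmetric]\<close>)
    then have "(cmod (\<Sum>k<n. ?a k * z ^ k))\<^sup>2 \<le> (\<Sum>k<n. (cmod (?a k) / sqrt (?k k)) * (sqrt (?k k) * cmod z ^ k))\<^sup>2"
      by (intro power_mono) auto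
    also have "\<dots> \<le> (\<Sum>k<n. (cmod (?a k) / sqrt (?k k))\<^sup>2) * (\<Sum>k<n. (sqrt (?k k) * cmod z ^ k)\<^sup>2)"
      by (rule Cauchy_Schwarz_ineq_sum)
    also have "\<dots> \<le> (2 / (1 - \<alpha>) * K) * (1 - (cmod z)\<^sup>2) powr (\<alpha> - 1)"
    proof (rule mult_mono)
      have "(\<Sum>k<n. (cmod (?a k) / sqrt (?k k))\<^sup>2) = (\<Sum>k<n. 1 / ?k k * (cmod (?a k))\<^sup>2)"
        using kp by (intro sum.cong) (auto simp: power_divide less_imp_le)
      also have "\<dots> \<le> (\<Sum>k<n. (2 / (1 - \<alpha>) * dir_weight \<alpha> k) * (cmod (?a k))\<^sup>2)"
        by (intro sum_mono mult_right_mono dir_weight_ge \<alpha>) auto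
      also have "\<dots> = 2 / (1 - \<alpha>) * (\<Sum>k<n. dir_weight \<alpha> k * (cmod (?a k))\<^sup>2)"
        by (simp add: sum_distrib_left mult.assoc)
      also have "\<dots> \<le> 2 / (1 - \<alpha>) * K"
        using \<alpha> by (intro mult_left_mono sum_dir_weight_le[OF f \<alpha>(2) K]) auto
      finally show "(\<Sum>k<n. (cmod (?a k) / sqrt (?k k))\<^sup>2) \<le> 2 / (1 - \<alpha>) * K" .
      have "(\<Sum>k<n. (sqrt (?k k) * cmod z ^ k)\<^sup>2) = (\<Sum>k<n. ?k k * ((cmod z)\<^sup>2) ^ k)"
        using kp by (intro sum.cong) (auto simp: power_mult_distrib less_imp_le power_mult[symmetric] mult.commute)
      also have "\<dots> \<le> (\<Sum>k. ?k k * ((cmod z)\<^sup>2) ^ k)"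
        using ker_coeff_sums_real[of "(cmod z)\<^sup>2" "1 - \<alpha>"] z2 kp
        by (intro sum_le_suminf) (auto simp: sums_iff less_imp_le)
      also have "\<dots> = (1 - (cmod z)\<^sup>2) powr (- (1 - \<alpha>))"
        using ker_coeff_sums_real[of "(cmod z)\<^sup>2" "1 - \<alpha>"] z2 by (auto simp: sums_iff)
      finally show "(\<Sum>k<n. (sqrt (?k k) * cmod z ^ k)\<^sup>2) \<le> (1 - (cmod z)\<^sup>2) powr (\<alpha> - 1)" by simp
    qed (use \<alpha> K in \<open>auto intro!: sum_nonneg\<close>)
    finally show ?thesis .
  qed
  ultimately show ?thesis by (intro LIMSEQ_le_const2) auto
qed

section \<open>Compactness\<close>

text \<open>Functions of bounded norm are locally bounded, so Montel's theorem gives a locally uniform limit of a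
subsequence.  Taylor coefficients converge, so every partial sum of the norm stays below the bound;
local uniformity lets the zeros move while they converge.  The lower bound at \<open>w\<close> keeps the limit from
vanishing identically.\<close>

lemma dirichlet_zero_limit:
  assumes \<alpha>: "0 \<le> \<alpha>" "\<alpha> < 1" and K: "0 \<le> K"
    and holf: "\<And>n. f n holomorphic_on unit_disc"
    and normf: "\<And>n. dirichlet_norm_sq \<alpha> (f n) \<le> ennreal K"
    and w: "w \<in> unit_disc" and c: "\<And>n. c \<le> cmod (f n w)"
    and zlim: "\<And>i. (\<lambda>n. z n i) \<longlonglongrightarrow> y i" and y: "\<And>i. y i \<in> unit_disc"
    and zero: "\<And>i. \<forall>\<^sub>F n in sequentially. f n (z n i) = 0"
  obtains g where "g holomorphic_on unit_disc" "dirichlet_norm_sq \<alpha> g \<le> ennreal K"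
    "c \<le> cmod (g w)" "\<And>i. g (y i) = 0"
proof -
  have bd: "\<exists>B. \<forall>h\<in>range f. \<forall>x\<in>S. cmod (h x) \<le> B" if S: "compact S" "S \<subseteq> unit_disc" for S
  proof (cases "S = {}")
    case False
    obtain x0 where x0: "x0 \<in> S" "\<And>x. x \<in> S \<Longrightarrow> cmod x \<le> cmod x0"
      using continuous_attains_sup[OF S(1) False continuous_on_norm_id] by blast
    let ?C = "2 / (1 - \<alpha>) * K * (1 - (cmod x0)\<^sup>2) powr (\<alpha> - 1)"
    have "cmod (f n x) \<le> sqrt ?C" if "x \<in> S" for n x
    proof -
      have x1: "cmod x \<le> cmod x0" "cmod x0 < 1" "cmod x < 1" using x0 that S by (auto simp: subset_iff)
      have "(cmod (f n x))\<^sup>2 \<le> 2 / (1 - \<alpha>) * K * (1 - (cmod x)\<^sup>2) powr (\<alpha> - 1)"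
        by (rule dirichlet_pointwise_bound[OF holf \<alpha> normf K x1(3)])
      also have "\<dots> \<le> ?C"
      proof (intro mult_left_mono powr_mono2')
        show "0 < 1 - (cmod x0)\<^sup>2" using x1 by (simp add: abs_square_less_1)
        show "1 - (cmod x0)\<^sup>2 \<le> 1 - (cmod x)\<^sup>2" using x1 by (simp add: power_mono)
      qed (use \<alpha> K in auto)
      finally show ?thesis by (rule real_le_rsqrt)
    qed
    then show ?thesis by blast
  qed auto
  have hol: "h holomorphic_on unit_disc" if "h \<in> range f" for h
    using that holf by auto
  obtain g r where g: "g holomorphic_on unit_disc" and r: "strict_mono (r :: nat \<Rightarrow> nat)"
    and pw: "\<And>x. x \<in> unit_disc \<Longrightarrow> (\<lambda>n. f (r n) x) \<longlonglongrightarrow> g x"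
    and unif: "\<And>S. compact S \<Longrightarrow> S \<subseteq> unit_disc \<Longrightarrow> uniform_limit S (f \<circ> r) g sequentially"
    using Montel[OF open_ball hol bd subset_refl, of thesis] by auto
  show thesis
  proof (rule that[OF g])
    show "c \<le> cmod (g w)"
      by (rule LIMSEQ_le_const[OF tendsto_norm[OF pw[OF w]]]) (use c in auto)
    have coeff: "(\<lambda>n. taylor_coeff (f (r n)) k) \<longlonglongrightarrow> taylor_coeff g k" for k
    proof -
      have "uniform_limit (cball 0 (1/2)) (f \<circ> r) g sequentially"
        by (rule unif) (auto intro: le_less_trans)
      then have u: "uniform_limit (ball 0 (1/2)) (\<lambda>n. f (r n)) g sequentially"
        using uniform_limit_on_subset[OF _ ball_subset_cball] by (force simp: comp_def)
      have "(\<lambda>n. (deriv ^^ k) (f (r n)) 0) \<longlonglongrightarrow> (deriv ^^ k) g 0"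
        by (rule higher_deriv_complex_uniform_limit[OF u])
           (auto intro!: always_eventually holomorphic_on_subset[OF holf])
      then show ?thesis unfolding taylor_coeff_def by (intro tendsto_intros) auto
    qed
    show "dirichlet_norm_sq \<alpha> g \<le> ennreal K"
    proof (rule dirichlet_norm_sq_leI[OF g \<alpha>(2)])
      fix n
      have "(\<lambda>j. \<Sum>k<n. dir_weight \<alpha> k * (cmod (taylor_coeff (f (r j)) k))\<^sup>2)
          \<longlonglongrightarrow> (\<Sum>k<n. dir_weight \<alpha> k * (cmod (taylor_coeff g k))\<^sup>2)"
        by (intro tendsto_intros coeff)
      then show "(\<Sum>k<n. dir_weight \<alpha> k * (cmod (taylor_coeff g k))\<^sup>2) \<le> K"
        by (rule LIMSEQ_le_const2) (use sum_dir_weight_le[OF holf \<alpha>(2) normf K] in auto)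
    qed
    show "g (y i) = 0" for i
    proof -
      obtain e where e: "e > 0" "cball (y i) e \<subseteq> unit_disc"
        using y open_contains_cball[of unit_disc] by blast
      have zr: "(\<lambda>n. z (r n) i) \<longlonglongrightarrow> y i"
        using LIMSEQ_subseq_LIMSEQ[OF zlim r] by (simp add: comp_def)
      have "\<forall>\<^sub>F n in sequentially. z (r n) i \<in> cball (y i) e"
        using tendstoD[OF zr e(1)] by eventually_elim (auto simp: dist_commute)
      moreover have "\<forall>\<^sub>F n in sequentially. f (r n) (z (r n) i) = 0"
        using eventually_subseq[OF r zero[of i]] .
      ultimately have ev: "\<forall>\<^sub>F n in sequentially. z (r n) i \<in> cball (y i) e \<and> f (r n) (z (r n) i) = 0"
        by eventually_elim auto
      have "isCont g (y i)"
        using g y[of i] holomorphic_on_imp_continuous_on continuous_on_eq_continuous_at open_ball by blast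
      then have lim: "(\<lambda>n. cmod (g (z (r n) i))) \<longlonglongrightarrow> cmod (g (y i))"
        by (intro tendsto_norm isCont_tendsto_compose[OF _ zr])
      have "cmod (g (y i)) \<le> d" if "d > 0" for d
      proof -
        have "\<forall>\<^sub>F n in sequentially. \<forall>x\<in>cball (y i) e. dist ((f \<circ> r) n x) (g x) < d"
          using uniform_limitD[OF unif[OF compact_cball e(2)] that] .
        then have "\<forall>\<^sub>F n in sequentially. cmod (g (z (r n) i)) \<le> d"
          using ev
        proof eventually_elim
          case (elim n)
          then have "dist ((f \<circ> r) n (z (r n) i)) (g (z (r n) i)) < d" by blast
          with elim show ?case by simp
        qed
        then show ?thesis by (intro tendsto_upperbound[OF lim]) auto
      qed
      then show ?thesis using dense_ge[of 0 "cmod (g (y i))"] by simp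
    qed
  qed
qed

section \<open>Finite Blaschke products\<close>

lemma taylor_coeff_unique:
  assumes "\<And>z. cmod z < 1 \<Longrightarrow> (\<lambda>k. c k * z ^ k) sums f z"
  shows "taylor_coeff f k = c k"
proof -
  have "conv_radius c \<ge> norm (1/2 :: complex)"
    by (rule conv_radius_geI) (use assms[of "1/2"] in \<open>auto simp: sums_iff\<close>)
  then have "fps_conv_radius (Abs_fps c) \<ge> ereal (1/2)"
    by (simp add: fps_conv_radius_def)
  then have r: "fps_conv_radius (Abs_fps c) > 0"
    by (rule less_le_trans[rotated]) simp
  have "c k = (deriv ^^ k) (eval_fps (Abs_fps c)) 0 / fact k"
    using fps_nth_conv_deriv[OF r, of k] by simp
  also have "(deriv ^^ k) (eval_fps (Abs_fps c)) 0 = (deriv ^^ k) f 0"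
  proof (rule higher_deriv_cong_ev)
    have "\<forall>\<^sub>F x in nhds 0. x \<in> ball (0::complex) 1"
      by (intro eventually_nhds_in_open) auto
    then show "\<forall>\<^sub>F x in nhds 0. eval_fps (Abs_fps c) x = f x"
      by eventually_elim (use assms in \<open>auto simp: eval_fps_def sums_iff\<close>)
  qed simp
  finally show ?thesis by (simp add: taylor_coeff_def)
qed

definition blaschke_factor :: "complex \<Rightarrow> complex \<Rightarrow> complex" where
  "blaschke_factor a z = (z - a) / (1 - cnj a * z)"

lemma blaschke_denom_nonzero:
  assumes "cmod a < 1" "cmod z \<le> 1"
  shows "1 - cnj a * z \<noteq> 0"
proof
  assume "1 - cnj a * z = 0"
  then have "cmod (cnj a * z) = 1" by (metis eq_iff_diff_eq_0 norm_one)
  moreover have "cmod (cnj a * z) \<le> cmod a * 1"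
    unfolding norm_mult complex_mod_cnj by (intro mult_left_mono assms) simp
  ultimately show False using assms by simp
qed

lemma one_minus_blaschke_factor:
  assumes "cmod a < 1" "cmod z \<le> 1"
  shows "1 - (cmod (blaschke_factor a z))\<^sup>2 =
    (1 - (cmod a)\<^sup>2) * (1 - (cmod z)\<^sup>2) / (cmod (1 - cnj a * z))\<^sup>2"
proof -
  have "(cmod (1 - cnj a * z))\<^sup>2 - (cmod (z - a))\<^sup>2 = (1 - (cmod a)\<^sup>2) * (1 - (cmod z)\<^sup>2)"
    unfolding cmod_power2 by (simp add: power2_eq_square algebra_simps)
  with blaschke_denom_nonzero[OF assms] show ?thesis
    by (simp add: blaschke_factor_def norm_divide power_divide divide_simps)
qed

lemma norm_blaschke_factor_le: "cmod a < 1 \<Longrightarrow> cmod z \<le> 1 \<Longrightarrow> cmod (blaschke_factor a z) \<le> 1"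
proof -
  assume a: "cmod a < 1" "cmod z \<le> 1"
  have "0 \<le> 1 - (cmod (blaschke_factor a z))\<^sup>2"
    unfolding one_minus_blaschke_factor[OF a] using a
    by (intro divide_nonneg_nonneg mult_nonneg_nonneg) (auto simp: power_le_one)
  then show ?thesis by (simp add: abs_square_le_1)
qed

lemma blaschke_factor_deriv:
  assumes "cmod a < 1" "cmod z \<le> 1"
  shows "(blaschke_factor a has_field_derivative
    of_real (1 - (cmod a)\<^sup>2) / (1 - cnj a * z)\<^sup>2) (at z)"
proof -
  have "(1 - cnj a * z) + (z - a) * cnj a = of_real (1 - (cmod a)\<^sup>2)"
    by (simp add: complex_norm_square algebra_simps flip: of_real_power)
  then have "1 * (1 - cnj a * z) - (z - a) * (- cnj a) = of_real (1 - (cmod a)\<^sup>2)" by simp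
  then show ?thesis
    unfolding blaschke_factor_def[abs_def]
    using blaschke_denom_nonzero[OF assms]
    by (auto intro!: derivative_eq_intros simp: power2_eq_square)
qed

definition blaschke_prod :: "complex set \<Rightarrow> complex \<Rightarrow> complex" where
  "blaschke_prod F z = (\<Prod>a\<in>F. blaschke_factor a z)"

lemma blaschke_prod_insert:
  "finite F \<Longrightarrow> a \<notin> F \<Longrightarrow> blaschke_prod (insert a F) = (\<lambda>z. blaschke_factor a z * blaschke_prod F z)"
  by (auto simp: blaschke_prod_def)

lemma blaschke_prod_zero: "finite F \<Longrightarrow> a \<in> F \<Longrightarrow> blaschke_prod F a = 0"
  by (auto simp: blaschke_prod_def blaschke_factor_def intro!: prod_zero)

lemma norm_blaschke_prod_le:
  assumes "F \<subseteq> unit_disc" "cmod z \<le> 1"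
  shows "cmod (blaschke_prod F z) \<le> 1"
  unfolding blaschke_prod_def prod_norm[symmetric]
  using assms by (intro prod_le_1) (auto intro!: norm_blaschke_factor_le)

lemma holomorphic_blaschke_factor: "cmod a < 1 \<Longrightarrow> blaschke_factor a holomorphic_on unit_disc"
  using blaschke_denom_nonzero[of a] unfolding blaschke_factor_def[abs_def]
  by (intro holomorphic_intros) auto

lemma holomorphic_blaschke_prod: "F \<subseteq> unit_disc \<Longrightarrow> blaschke_prod F holomorphic_on unit_disc"
  unfolding blaschke_prod_def[abs_def]
  by (intro holomorphic_intros holomorphic_blaschke_factor) auto

text \<open>The inequality that propagates the Schwarz-Pick bound to a product of two functions: the difference of the
two sides is \<open>(1 - x) * (1 - y) * (1 - x * y)\<close>.\<close>

lemma schwarz_pick_step: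
  fixes x y :: real
  assumes "0 \<le> x" "x \<le> 1" "0 \<le> y" "y \<le> 1"
  shows "(1 - x\<^sup>2) * y + x * (1 - y\<^sup>2) \<le> 1 - (x * y)\<^sup>2"
proof -
  have "0 \<le> (1 - x) * (1 - y) * (1 - x * y)"
    using assms by (intro mult_nonneg_nonneg) (auto intro: mult_le_one)
  then show ?thesis by (simp add: algebra_simps power2_eq_square)
qed

text \<open>A Blaschke factor has equality in the Schwarz-Pick inequality.  By the product rule and
\<open>schwarz_pick_step\<close> the inequality survives multiplication by a further factor, and so does the bound by
the sum of the derivatives of the factors, as all factors are at most \<open>1\<close> in modulus.\<close>

lemma blaschke_prod_deriv_bounds:
  assumes "finite F" "F \<subseteq> unit_disc" "cmod z < 1"
  shows "cmod (deriv (blaschke_prod F) z) * (1 - (cmod z)\<^sup>2) \<le> 1 - (cmod (blaschke_prod F z))\<^sup>2"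
    and "cmod (deriv (blaschke_prod F) z) \<le> (\<Sum>a\<in>F. (1 - (cmod a)\<^sup>2) / (cmod (1 - cnj a * z))\<^sup>2)"
proof -
  have "cmod (deriv (blaschke_prod F) z) * (1 - (cmod z)\<^sup>2) \<le> 1 - (cmod (blaschke_prod F z))\<^sup>2 \<and>
    cmod (deriv (blaschke_prod F) z) \<le> (\<Sum>a\<in>F. (1 - (cmod a)\<^sup>2) / (cmod (1 - cnj a * z))\<^sup>2)"
    using assms(1,2)
  proof (induction F rule: finite_induct)
    case empty
    have "blaschke_prod {} = (\<lambda>_. 1)" by (auto simp: blaschke_prod_def)
    then show ?case by simp
  next
    case (insert a F)
    let ?B = "blaschke_prod F" and ?b = "blaschke_factor a"
    define u where "u = 1 - (cmod z)\<^sup>2"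
    have a: "cmod a < 1" and F: "F \<subseteq> unit_disc" using insert.prems by auto
    have z: "cmod z \<le> 1" using assms by simp
    have u: "u \<ge> 0" using z by (simp add: u_def power_le_one)
    define b' where "b' = of_real (1 - (cmod a)\<^sup>2) / (1 - cnj a * z)\<^sup>2"
    have nb': "cmod b' = (1 - (cmod a)\<^sup>2) / (cmod (1 - cnj a * z))\<^sup>2"
    proof -
      have "(cmod a)\<^sup>2 \<le> 1" using a by (simp add: abs_square_le_1)
      then show ?thesis by (simp only: b'_def norm_divide norm_of_real norm_power)
    qed
    have b'u: "cmod b' * u = 1 - (cmod (?b z))\<^sup>2"
      by (simp add: nb' u_def one_minus_blaschke_factor[OF a z])
    have x: "0 \<le> cmod (?b z)" "cmod (?b z) \<le> 1" using norm_blaschke_factor_le[OF a z] by auto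
    have y: "0 \<le> cmod (?B z)" "cmod (?B z) \<le> 1" using norm_blaschke_prod_le[OF F z] by auto
    have "(?B has_field_derivative deriv ?B z) (at z)"
      using holomorphic_blaschke_prod[OF F] assms(3)
      by (intro holomorphic_derivI[of _ unit_disc]) auto
    then have "((\<lambda>z. ?b z * ?B z) has_field_derivative b' * ?B z + deriv ?B z * ?b z) (at z)"
      unfolding b'_def by (intro DERIV_mult blaschke_factor_deriv a z)
    then have d: "deriv (blaschke_prod (insert a F)) z = b' * ?B z + deriv ?B z * ?b z"
      using insert by (simp add: blaschke_prod_insert DERIV_imp_deriv)
    have le: "cmod (deriv (blaschke_prod (insert a F)) z) \<le> cmod b' * cmod (?B z) + cmod (deriv ?B z) * cmod (?b z)"
      unfolding d by (metis norm_mult norm_triangle_ineq)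
    have "cmod (deriv (blaschke_prod (insert a F)) z) * u
        \<le> (cmod b' * u) * cmod (?B z) + cmod (?b z) * (cmod (deriv ?B z) * u)"
      using mult_right_mono[OF le u] by (simp add: algebra_simps)
    also have "\<dots> \<le> (1 - (cmod (?b z))\<^sup>2) * cmod (?B z) + cmod (?b z) * (1 - (cmod (?B z))\<^sup>2)"
      unfolding b'u using insert.IH[OF F] x by (intro add_left_mono mult_left_mono) (auto simp: u_def)
    also have "\<dots> \<le> 1 - (cmod (?b z) * cmod (?B z))\<^sup>2"
      by (rule schwarz_pick_step[OF x y])
    finally have 1: "cmod (deriv (blaschke_prod (insert a F)) z) * u \<le> 1 - (cmod (blaschke_prod (insert a F) z))\<^sup>2"
      using insert by (simp add: blaschke_prod_insert norm_mult)
    have "cmod b' * cmod (?B z) + cmod (deriv ?B z) * cmod (?b z) \<le> cmod b' * 1 + cmod (deriv ?B z) * 1"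
      using x y by (intro add_mono mult_left_mono) auto
    also have "\<dots> \<le> cmod b' + (\<Sum>a\<in>F. (1 - (cmod a)\<^sup>2) / (cmod (1 - cnj a * z))\<^sup>2)"
      using insert.IH[OF F] by simp
    finally show ?case using 1 le insert.hyps by (auto simp: u_def nb')
  qed
  then show "cmod (deriv (blaschke_prod F) z) * (1 - (cmod z)\<^sup>2) \<le> 1 - (cmod (blaschke_prod F z))\<^sup>2"
    and "cmod (deriv (blaschke_prod F) z) \<le> (\<Sum>a\<in>F. (1 - (cmod a)\<^sup>2) / (cmod (1 - cnj a * z))\<^sup>2)"
    by blast+
qed

text \<open>Parseval on circles of radius \<open>r < 1\<close>, and then \<open>r\<close> tends to \<open>1\<close>.\<close>

lemma sum_taylor_coeff_sq_le_sup:
  assumes f: "f holomorphic_on unit_disc" and 1: "\<And>z. cmod z < 1 \<Longrightarrow> cmod (f z) \<le> 1"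
  shows "(\<Sum>k<n. (cmod (taylor_coeff f k))\<^sup>2) \<le> 1"
proof -
  let ?a = "\<lambda>k. (cmod (taylor_coeff f k))\<^sup>2"
  have *: "(\<Sum>k<n. ?a k * r ^ (2 * k)) \<le> 1" if r: "0 < r" "r < 1" for r :: real
  proof -
    have r': "cmod (of_real r) < 1" using r by simp
    note cp = circle_parseval[OF f r']
    have "(\<Sum>k<n. 2 * pi * (?a k * r ^ (2 * k))) \<le> integral {0..2*pi} (\<lambda>t. (cmod (f (cis t * of_real r)))\<^sup>2)"
      using cp(2) r sum_le_suminf[of "\<lambda>k. 2 * pi * (?a k * r ^ (2 * k))" "{..<n}"]
      by (simp add: sums_iff)
    also have "\<dots> \<le> integral {0..2*pi} (\<lambda>t. 1)"
      using cp(1) r by (intro integral_le) (auto intro!: power_le_one 1 simp: norm_mult)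
    also have "\<dots> = 2 * pi" by simp
    finally show ?thesis by (simp flip: sum_distrib_left)
  qed
  have "((\<lambda>r. \<Sum>k<n. ?a k * r ^ (2 * k)) \<longlongrightarrow> (\<Sum>k<n. ?a k * 1 ^ (2 * k))) (at_left (1::real))"
    by (intro tendsto_intros)
  moreover have "\<forall>\<^sub>F r in at_left (1::real). (\<Sum>k<n. ?a k * r ^ (2 * k)) \<le> 1"
    using eventually_at_left_real[OF zero_less_one] by eventually_elim (auto intro: *)
  ultimately show ?thesis
    using tendsto_upperbound[of "\<lambda>r. \<Sum>k<n. ?a k * r ^ (2 * k)" _ "at_left (1::real)" 1] by simp
qed

lemma ker_coeff_one [simp]: "ker_coeff 1 k = 1"
  by (simp add: ker_coeff_def pochhammer_fact[symmetric])

lemma dirichlet_norm_sq_0_le_sup: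
  assumes f: "f holomorphic_on unit_disc" and "\<And>z. cmod z < 1 \<Longrightarrow> cmod (f z) \<le> 1"
  shows "dirichlet_norm_sq 0 f \<le> 1"
proof -
  have "dirichlet_norm_sq 0 f \<le> ennreal 1"
  proof (rule dirichlet_norm_sq_leI[OF f])
    fix n
    have "(\<Sum>k<n. dir_weight 0 k * (cmod (taylor_coeff f k))\<^sup>2) \<le> (\<Sum>k<n. 1 * (cmod (taylor_coeff f k))\<^sup>2)"
      using dir_weight_le[of 0] by (intro sum_mono mult_right_mono) auto
    also have "\<dots> \<le> 1" using sum_taylor_coeff_sq_le_sup[OF assms] by simp
    finally show "(\<Sum>k<n. dir_weight 0 k * (cmod (taylor_coeff f k))\<^sup>2) \<le> 1" .
  qed simp
  then show ?thesis by simp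
qed

text \<open>After cancelling Gamma factors this is \<open>Gamma (k + 1) ^ 2 \<le> Gamma (k + \<alpha>) * Gamma (k + 2 - \<alpha>)\<close>, which is
log-convexity at the midpoint \<open>k + 1\<close>.\<close>

lemma Beta_le_ker_coeff:
  assumes \<alpha>: "0 < \<alpha>" "\<alpha> < 1"
  shows "Beta (real k + 1) (1 - \<alpha>) \<le> Gamma \<alpha> * Gamma (1 - \<alpha>) * ker_coeff \<alpha> k"
proof -
  let ?x = "\<alpha> + real k" and ?y = "real k + 2 - \<alpha>"
  have pos: "?x > 0" "?y > 0" using \<alpha> by auto
  have gp: "Gamma ?x > 0" "Gamma ?y > 0" "Gamma (1 - \<alpha>) > 0" "Gamma \<alpha> > 0" "Gamma (real k + 1) > 0"
    using pos \<alpha> by (auto intro!: Gamma_real_pos)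
  have "(ln \<circ> Gamma) ((1 - 1/2) *\<^sub>R ?x + (1/2) *\<^sub>R ?y) \<le> (1 - 1/2) * (ln \<circ> Gamma) ?x + (1/2) * (ln \<circ> Gamma) ?y"
    by (rule convex_onD[OF log_convex_Gamma_real]) (use pos in auto)
  moreover have "(1 - 1/2) *\<^sub>R ?x + (1/2) *\<^sub>R ?y = real k + 1" by (simp add: field_simps)
  ultimately have ln2: "2 * ln (Gamma (real k + 1)) \<le> ln (Gamma ?x) + ln (Gamma ?y)" by simp
  have lnm: "ln (s * t) = ln s + ln t" if "s > 0" "t > 0" for s t :: real
    using that by (simp add: ln_mult)
  have "ln (Gamma (real k + 1) * Gamma (real k + 1)) \<le> ln (Gamma ?x * Gamma ?y)"
    unfolding lnm[OF gp(5) gp(5)] lnm[OF gp(1) gp(2)] using ln2 by simp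
  then have G: "Gamma (real k + 1) * Gamma (real k + 1) \<le> Gamma ?x * Gamma ?y"
    using gp by (subst (asm) ln_le_cancel_iff) auto
  have f: "Gamma (real k + 1) = fact k"
    using Gamma_fact[of k, where ?'a=real] by (simp add: add.commute)
  have nz: "\<alpha> \<notin> \<int>\<^sub>\<le>\<^sub>0" using \<alpha> by (meson nonpos_Ints_nonpos not_le)
  have kc: "ker_coeff \<alpha> k = Gamma ?x / Gamma \<alpha> / Gamma (real k + 1)"
    by (simp add: ker_coeff_def f pochhammer_Gamma[OF nz])
  have B: "Beta (real k + 1) (1 - \<alpha>) = Gamma (real k + 1) * Gamma (1 - \<alpha>) / Gamma ?y"
    by (simp add: Beta_def algebra_simps)
  have "Gamma (real k + 1) / Gamma ?y \<le> Gamma ?x / Gamma (real k + 1)"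
    using G gp by (simp add: divide_simps mult.commute)
  then have "Gamma (1 - \<alpha>) * (Gamma (real k + 1) / Gamma ?y) \<le> Gamma (1 - \<alpha>) * (Gamma ?x / Gamma (real k + 1))"
    using gp by (intro mult_left_mono) auto
  then show ?thesis unfolding B kc using gp by (simp add: mult_ac)
qed

text \<open>The geometric series and \<open>disc_parseval\<close> turn the integral into \<open>(\<Sum>k. \<bar>a\<bar> ^ (2 * k) * Beta (k + 1) (1 - \<alpha>))\<close>,
which \<open>Beta_le_ker_coeff\<close> compares with the binomial series of the right-hand side.\<close>

lemma nn_integral_weighted_szego_kernel:
  assumes \<alpha>: "0 < \<alpha>" "\<alpha> < 1" and a: "cmod a < 1"
  shows "(\<integral>\<^sup>+ z \<in> unit_disc. ennreal ((1 - (cmod z)\<^sup>2) powr (- \<alpha>) / (cmod (1 - cnj a * z))\<^sup>2) \<partial>area)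
    \<le> ennreal (Gamma \<alpha> * Gamma (1 - \<alpha>) * (1 - (cmod a)\<^sup>2) powr (- \<alpha>))"
proof -
  let ?h = "\<lambda>z. 1 / (1 - cnj a * z)"
  let ?C = "Gamma \<alpha> * Gamma (1 - \<alpha>)"
  have a2: "(cmod a)\<^sup>2 < 1" using a by (simp add: abs_square_less_1)
  have C: "?C \<ge> 0" using \<alpha> by (simp add: Gamma_real_pos less_imp_le)
  have hol: "?h holomorphic_on unit_disc"
    using blaschke_denom_nonzero[OF a] by (intro holomorphic_intros) auto
  have co: "taylor_coeff ?h k = cnj a ^ k" for k
  proof (rule taylor_coeff_unique)
    fix z :: complex assume "cmod z < 1"
    then have "cmod (cnj a * z) < 1"
      using a by (simp add: norm_mult) (metis mult_less_cancel_left2 mult_strict_mono' norm_ge_zero mult_1)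
    from geometric_sums[OF this] show "(\<lambda>k. cnj a ^ k * z ^ k) sums ?h z"
      by (simp add: power_mult_distrib)
  qed
  have "(\<integral>\<^sup>+ z \<in> unit_disc. ennreal ((1 - (cmod z)\<^sup>2) powr (- \<alpha>) / (cmod (1 - cnj a * z))\<^sup>2) \<partial>area)
    = (\<integral>\<^sup>+ z \<in> unit_disc. (ennreal ((cmod (?h z))\<^sup>2) * ennreal ((1 - (cmod z)\<^sup>2) powr (- \<alpha>))) \<partial>area)"
    by (simp add: norm_divide power_divide flip: ennreal_mult)
  also have "\<dots> = (\<Sum>k. ennreal ((cmod (cnj a ^ k))\<^sup>2) *
     (\<integral>\<^sup>+ t \<in> {0..<1}. (ennreal (t ^ k) * ennreal ((1 - t) powr (- \<alpha>))) \<partial>lborel))"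
    unfolding co[symmetric]
    by (rule disc_parseval[OF hol, where W="\<lambda>t. ennreal ((1 - t) powr (- \<alpha>))"]) measurable
  also have "\<dots> \<le> (\<Sum>k. ennreal (?C * (ker_coeff \<alpha> k * ((cmod a)\<^sup>2) ^ k)))"
  proof (intro suminf_le)
    fix k
    have "ennreal ((cmod (cnj a ^ k))\<^sup>2) * (\<integral>\<^sup>+ t \<in> {0..<1}. (ennreal (t ^ k) * ennreal ((1 - t) powr (- \<alpha>))) \<partial>lborel)
      = ennreal (((cmod a)\<^sup>2) ^ k) * ennreal (Beta (real k + 1) (1 - \<alpha>))"
      using \<alpha> by (subst nn_integral_Beta) (auto simp: norm_power mult.commute simp flip: power_mult)
    also have "\<dots> \<le> ennreal (((cmod a)\<^sup>2) ^ k) * ennreal (?C * ker_coeff \<alpha> k)"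
      by (intro mult_left_mono ennreal_leI Beta_le_ker_coeff \<alpha>) auto
    also have "\<dots> = ennreal (?C * (ker_coeff \<alpha> k * ((cmod a)\<^sup>2) ^ k))"
    proof -
      have "0 \<le> ?C * ker_coeff \<alpha> k"
        by (rule mult_nonneg_nonneg[OF C less_imp_le[OF ker_coeff_pos[OF \<alpha>(1)]]])
      then show ?thesis by (subst ennreal_mult''[symmetric]) (auto simp: mult_ac)
    qed
    finally show "ennreal ((cmod (cnj a ^ k))\<^sup>2) * (\<integral>\<^sup>+ t \<in> {0..<1}. (ennreal (t ^ k) * ennreal ((1 - t) powr (- \<alpha>))) \<partial>lborel)
      \<le> ennreal (?C * (ker_coeff \<alpha> k * ((cmod a)\<^sup>2) ^ k))" .
  qed auto
  also have "\<dots> = ennreal (?C * (1 - (cmod a)\<^sup>2) powr (- \<alpha>))"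
    using sums_mult[OF ker_coeff_sums_real[of "(cmod a)\<^sup>2" \<alpha>], of ?C] a2 C ker_coeff_pos[OF \<alpha>(1)]
    by (intro suminf_ennreal_eq) (auto simp: less_imp_le)
  finally show ?thesis .
qed

text \<open>One of the two factors \<open>\<bar>B'\<bar>\<close> is absorbed by Schwarz-Pick and the other is replaced by the sum of
the derivatives of the factors, so that the weighted kernel estimate applies term by term.\<close>

lemma dirichlet_norm_sq_blaschke_prod:
  assumes \<alpha>: "0 < \<alpha>" "\<alpha> < 1" and F: "finite F" "F \<subseteq> unit_disc"
  shows "dirichlet_norm_sq \<alpha> (blaschke_prod F) \<le>
    ennreal (1 + Gamma \<alpha> * Gamma (1 - \<alpha>) * (\<Sum>a\<in>F. (1 - (cmod a)\<^sup>2) powr (1 - \<alpha>)))"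
proof -
  let ?B = "blaschke_prod F" and ?C = "Gamma \<alpha> * Gamma (1 - \<alpha>)"
  have C: "?C \<ge> 0" using \<alpha> by (simp add: Gamma_real_pos less_imp_le)
  have [measurable]: "unit_disc \<in> sets borel" by simp
  have pt: "(cmod (deriv ?B z))\<^sup>2 * (1 - (cmod z)\<^sup>2) powr (1 - \<alpha>)
      \<le> (\<Sum>a\<in>F. (1 - (cmod a)\<^sup>2) * ((1 - (cmod z)\<^sup>2) powr (- \<alpha>) / (cmod (1 - cnj a * z))\<^sup>2))"
    if z: "cmod z < 1" for z
  proof -
    have u: "1 - (cmod z)\<^sup>2 > 0" using z by (simp add: abs_square_less_1)
    have p: "(1 - (cmod z)\<^sup>2) powr (1 - \<alpha>) = (1 - (cmod z)\<^sup>2) * (1 - (cmod z)\<^sup>2) powr (- \<alpha>)"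
      using u by (simp add: powr_diff powr_minus field_simps)
    have "(cmod (deriv ?B z))\<^sup>2 * (1 - (cmod z)\<^sup>2) powr (1 - \<alpha>)
        = (cmod (deriv ?B z) * (1 - (cmod z)\<^sup>2)) * (cmod (deriv ?B z) * (1 - (cmod z)\<^sup>2) powr (- \<alpha>))"
      unfolding p by (simp add: power2_eq_square mult_ac)
    also have "\<dots> \<le> 1 * (cmod (deriv ?B z) * (1 - (cmod z)\<^sup>2) powr (- \<alpha>))"
      using blaschke_prod_deriv_bounds(1)[OF F z]
      by (intro mult_right_mono) (auto intro: order.trans)
    also have "\<dots> \<le> (\<Sum>a\<in>F. (1 - (cmod a)\<^sup>2) / (cmod (1 - cnj a * z))\<^sup>2) * (1 - (cmod z)\<^sup>2) powr (- \<alpha>)"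
      using blaschke_prod_deriv_bounds(2)[OF F z] by (simp add: mult_right_mono)
    also have "\<dots> = (\<Sum>a\<in>F. (1 - (cmod a)\<^sup>2) * ((1 - (cmod z)\<^sup>2) powr (- \<alpha>) / (cmod (1 - cnj a * z))\<^sup>2))"
      by (simp add: sum_distrib_right)
    finally show ?thesis .
  qed
  have F1: "0 \<le> 1 - (cmod a)\<^sup>2" "0 < 1 - (cmod a)\<^sup>2" if "a \<in> F" for a
    using that F by (auto simp: abs_square_less_1 subset_iff intro: less_imp_le)
  have "(\<integral>\<^sup>+ z \<in> unit_disc. ennreal ((cmod (deriv ?B z))\<^sup>2 * (1 - (cmod z)\<^sup>2) powr (1 - \<alpha>)) \<partial>area)
    \<le> (\<integral>\<^sup>+ z. (\<Sum>a\<in>F. ennreal (1 - (cmod a)\<^sup>2) *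
        (ennreal ((1 - (cmod z)\<^sup>2) powr (- \<alpha>) / (cmod (1 - cnj a * z))\<^sup>2) * indicator unit_disc z)) \<partial>area)"
  proof (intro nn_integral_mono)
    fix z :: complex
    show "ennreal ((cmod (deriv ?B z))\<^sup>2 * (1 - (cmod z)\<^sup>2) powr (1 - \<alpha>)) * indicator unit_disc z \<le>
      (\<Sum>a\<in>F. ennreal (1 - (cmod a)\<^sup>2) *
        (ennreal ((1 - (cmod z)\<^sup>2) powr (- \<alpha>) / (cmod (1 - cnj a * z))\<^sup>2) * indicator unit_disc z))"
    proof (cases "cmod z < 1")
      case True
      have "ennreal ((cmod (deriv ?B z))\<^sup>2 * (1 - (cmod z)\<^sup>2) powr (1 - \<alpha>)) \<le>
         ennreal (\<Sum>a\<in>F. (1 - (cmod a)\<^sup>2) * ((1 - (cmod z)\<^sup>2) powr (- \<alpha>) / (cmod (1 - cnj a * z))\<^sup>2))"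
        by (intro ennreal_leI pt True)
      also have "\<dots> = (\<Sum>a\<in>F. ennreal ((1 - (cmod a)\<^sup>2) * ((1 - (cmod z)\<^sup>2) powr (- \<alpha>) / (cmod (1 - cnj a * z))\<^sup>2)))"
        using F1 by (subst sum_ennreal) auto
      also have "\<dots> = (\<Sum>a\<in>F. ennreal (1 - (cmod a)\<^sup>2) * ennreal ((1 - (cmod z)\<^sup>2) powr (- \<alpha>) / (cmod (1 - cnj a * z))\<^sup>2))"
        using F1 by (intro sum.cong ennreal_mult) auto
      finally show ?thesis using True by simp
    qed simp
  qed
  also have "\<dots> = (\<Sum>a\<in>F. ennreal (1 - (cmod a)\<^sup>2) * (\<integral>\<^sup>+ z \<in> unit_disc.
        ennreal ((1 - (cmod z)\<^sup>2) powr (- \<alpha>) / (cmod (1 - cnj a * z))\<^sup>2) \<partial>area))"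
    by (subst nn_integral_sum) (auto intro!: sum.cong nn_integral_cmult)
  also have "\<dots> \<le> (\<Sum>a\<in>F. ennreal (1 - (cmod a)\<^sup>2) * ennreal (?C * (1 - (cmod a)\<^sup>2) powr (- \<alpha>)))"
    using F by (intro sum_mono mult_left_mono nn_integral_weighted_szego_kernel \<alpha>) auto
  also have "\<dots> = (\<Sum>a\<in>F. ennreal (?C * (1 - (cmod a)\<^sup>2) powr (1 - \<alpha>)))"
  proof (intro sum.cong refl)
    fix a assume "a \<in> F"
    then have u: "1 - (cmod a)\<^sup>2 > 0" by (rule F1)
    have p: "(1 - (cmod a)\<^sup>2) powr (1 - \<alpha>) = (1 - (cmod a)\<^sup>2) * (1 - (cmod a)\<^sup>2) powr (- \<alpha>)"
      using u by (simp add: powr_diff powr_minus field_simps)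
    have "0 \<le> ?C * (1 - (cmod a)\<^sup>2) powr (- \<alpha>)"
      by (rule mult_nonneg_nonneg[OF C powr_ge_zero])
    then show "ennreal (1 - (cmod a)\<^sup>2) * ennreal (?C * (1 - (cmod a)\<^sup>2) powr (- \<alpha>))
        = ennreal (?C * (1 - (cmod a)\<^sup>2) powr (1 - \<alpha>))"
      using u unfolding p by (subst ennreal_mult[symmetric]) (auto simp: mult_ac)
  qed
  also have "\<dots> = ennreal (?C * (\<Sum>a\<in>F. (1 - (cmod a)\<^sup>2) powr (1 - \<alpha>)))"
    using C by (subst sum_ennreal) (auto simp: sum_distrib_left)
  finally have I: "(\<integral>\<^sup>+ z \<in> unit_disc. ennreal ((cmod (deriv ?B z))\<^sup>2 * (1 - (cmod z)\<^sup>2) powr (1 - \<alpha>)) \<partial>area)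
    \<le> ennreal (?C * (\<Sum>a\<in>F. (1 - (cmod a)\<^sup>2) powr (1 - \<alpha>)))" .
  have "ennreal ((cmod (?B 0))\<^sup>2) \<le> ennreal 1"
    using norm_blaschke_prod_le[OF F(2), of 0] by (intro ennreal_leI) (simp add: power_le_one)
  with I have "dirichlet_norm_sq \<alpha> ?B \<le> ennreal 1 + ennreal (?C * (\<Sum>a\<in>F. (1 - (cmod a)\<^sup>2) powr (1 - \<alpha>)))"
    unfolding dirichlet_norm_sq_def by (intro add_mono)
  also have "\<dots> = ennreal (1 + ?C * (\<Sum>a\<in>F. (1 - (cmod a)\<^sup>2) powr (1 - \<alpha>)))"
    using C by (intro ennreal_plus[symmetric]) (auto intro!: mult_nonneg_nonneg sum_nonneg)
  finally show ?thesis .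
qed

section \<open>Zero sets from a convergent sum\<close>

lemma one_minus_blaschke_factor_bounds:
  assumes a: "cmod a < 1" and w: "cmod w < 1"
  shows "1 - (cmod (blaschke_factor a w))\<^sup>2 \<le> 2 / (1 - cmod w)\<^sup>2 * (1 - cmod a)"
    and "(1 - (cmod w)\<^sup>2) / 4 * (1 - cmod a) \<le> 1 - (cmod (blaschke_factor a w))\<^sup>2"
proof -
  let ?d = "(cmod (1 - cnj a * w))\<^sup>2"
  have aw: "cmod (cnj a * w) \<le> cmod w" "cmod (cnj a * w) \<le> 1"
    using a w by (auto simp: norm_mult mult_left_le_one_le intro: mult_le_one)
  have "1 - cmod w \<le> cmod (1 - cnj a * w)"
    using norm_triangle_ineq2[of 1 "cnj a * w"] aw by simp
  then have d1: "(1 - cmod w)\<^sup>2 \<le> ?d" using w by (intro power_mono) auto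
  have "cmod (1 - cnj a * w) \<le> 2"
    using norm_triangle_ineq4[of 1 "cnj a * w"] aw by simp
  then have "?d \<le> 2\<^sup>2" by (intro power_mono) auto
  then have d2: "?d \<le> 4" by simp
  have d0: "0 < (1 - cmod w)\<^sup>2" using w by simp
  have w2: "0 \<le> 1 - (cmod w)\<^sup>2" "1 - (cmod w)\<^sup>2 \<le> 1" using w by (auto simp: abs_square_le_1)
  have a2: "1 - (cmod a)\<^sup>2 = (1 + cmod a) * (1 - cmod a)" by (simp add: power2_eq_square algebra_simps)
  have "(1 + cmod a) * (1 - cmod a) \<le> 2 * (1 - cmod a)" using a by (intro mult_right_mono) auto
  then have a2u: "1 - (cmod a)\<^sup>2 \<le> 2 * (1 - cmod a)" unfolding a2 .
  have "1 * (1 - cmod a) \<le> (1 + cmod a) * (1 - cmod a)" using a by (intro mult_right_mono) auto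
  then have a2l: "1 - cmod a \<le> 1 - (cmod a)\<^sup>2" unfolding a2 by simp
  have a20: "0 \<le> 1 - (cmod a)\<^sup>2" using a a2l by linarith
  have eq: "1 - (cmod (blaschke_factor a w))\<^sup>2 = (1 - (cmod a)\<^sup>2) * (1 - (cmod w)\<^sup>2) / ?d"
    by (rule one_minus_blaschke_factor) (use a w in auto)
  have "(1 - (cmod a)\<^sup>2) * (1 - (cmod w)\<^sup>2) / ?d \<le> (2 * (1 - cmod a)) * 1 / (1 - cmod w)\<^sup>2"
    using a2u w2 d1 d0 a a20 by (intro frac_le mult_mono) auto
  then show "1 - (cmod (blaschke_factor a w))\<^sup>2 \<le> 2 / (1 - cmod w)\<^sup>2 * (1 - cmod a)"
    unfolding eq by simp
  have "(1 - cmod a) * (1 - (cmod w)\<^sup>2) / 4 \<le> (1 - (cmod a)\<^sup>2) * (1 - (cmod w)\<^sup>2) / ?d"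
    using a2l w2 d1 d0 d2 a a20 by (intro frac_le mult_mono) auto
  then show "(1 - (cmod w)\<^sup>2) / 4 * (1 - cmod a) \<le> 1 - (cmod (blaschke_factor a w))\<^sup>2"
    unfolding eq by (simp add: mult.commute)
qed

lemma exp_minus_le_one_minus:
  fixes x :: real
  assumes "0 \<le> x" "x \<le> 1/2"
  shows "exp (- (2 * x)) \<le> 1 - x"
proof -
  have "- x - 2 * x\<^sup>2 \<le> ln (1 - x)" using assms by (rule ln_one_minus_pos_lower_bound)
  moreover have "x * x \<le> x * (1/2)" using assms by (intro mult_left_mono) auto
  ultimately have "- (2 * x) \<le> ln (1 - x)" by (simp add: power2_eq_square)
  then show ?thesis using assms by (simp add: ln_ge_iff)
qed

text \<open>The squared modulus at \<open>w\<close> is the product of the numbers \<open>1 - x a\<close> with \<open>x a \<le> M * (1 - \<bar>a\<bar>)\<close>, so only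
finitely many \<open>x a\<close> exceed \<open>1/2\<close>.  These contribute a fixed positive factor, and the rest is
bounded below by an exponential of the sum.\<close>

lemma blaschke_prod_bounded_below:
  assumes w: "cmod w < 1" and L: "L \<subseteq> unit_disc" "w \<notin> L"
    and C: "\<And>F. finite F \<Longrightarrow> F \<subseteq> L \<Longrightarrow> (\<Sum>a\<in>F. 1 - cmod a) \<le> C"
  obtains c where "c > 0" "\<And>F. finite F \<Longrightarrow> F \<subseteq> L \<Longrightarrow> c \<le> cmod (blaschke_prod F w)"
proof -
  define x where "x a = 1 - (cmod (blaschke_factor a w))\<^sup>2" for a
  define M where "M = 2 / (1 - cmod w)\<^sup>2"
  have M: "M > 0" using w by (simp add: M_def)
  have x0: "0 \<le> x a" and x1: "x a < 1" and xM: "x a \<le> M * (1 - cmod a)" if "a \<in> L" for a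
  proof -
    have a: "cmod a < 1" using that L by auto
    show "0 \<le> x a" using norm_blaschke_factor_le[OF a, of w] w by (simp add: x_def power_le_one)
    show "x a \<le> M * (1 - cmod a)"
      unfolding x_def M_def by (rule one_minus_blaschke_factor_bounds(1)[OF a w])
    have "blaschke_factor a w \<noteq> 0"
      using that L blaschke_denom_nonzero[OF a, of w] w by (auto simp: blaschke_factor_def)
    then show "x a < 1" by (simp add: x_def)
  qed
  have sx: "sum x F \<le> M * C" if "finite F" "F \<subseteq> L" for F
  proof -
    have "sum x F \<le> (\<Sum>a\<in>F. M * (1 - cmod a))" using that xM by (intro sum_mono) auto
    also have "\<dots> \<le> M * C" using C[OF that] M by (simp flip: sum_distrib_left)
    finally show ?thesis .
  qed
  define G where "G = {a \<in> L. x a > 1/2}"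
  have fG: "finite G"
  proof (rule ccontr)
    assume "infinite G"
    then obtain F where F: "F \<subseteq> G" "finite F" "card F = Suc (nat \<lceil>2 * M * C\<rceil>)"
      by (meson infinite_arbitrarily_large)
    have "2 * M * C < real (card F)" unfolding F(3) by linarith
    moreover have "real (card F) * (1/2) \<le> sum x F"
      using F by (intro sum_bounded_below) (auto simp: G_def less_imp_le)
    moreover have "sum x F \<le> M * C" using F by (intro sx) (auto simp: G_def)
    ultimately show False by simp
  qed
  define c where "c = (\<Prod>a\<in>G. 1 - x a) * exp (- (2 * (M * C)))"
  have c: "c > 0" using x1 by (auto simp: c_def G_def intro!: mult_pos_pos prod_pos)
  have "c \<le> (cmod (blaschke_prod F w))\<^sup>2" if F: "finite F" "F \<subseteq> L" for F
  proof -
    have "(\<Prod>a\<in>F. 1 - x a) = (\<Prod>a\<in>F \<inter> G. 1 - x a) * (\<Prod>a\<in>F - G. 1 - x a)"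
      using F by (metis Int_Diff_disjoint Int_Diff_Un finite_Diff finite_Int prod.union_disjoint)
    moreover have "(\<Prod>a\<in>G. 1 - x a) \<le> (\<Prod>a\<in>F \<inter> G. 1 - x a)"
    proof -
      have "(\<Prod>a\<in>G. 1 - x a) = (\<Prod>a\<in>G - F \<inter> G. 1 - x a) * (\<Prod>a\<in>F \<inter> G. 1 - x a)"
        using fG by (intro prod.subset_diff) auto
      then have "(\<Prod>a\<in>G. 1 - x a) = (\<Prod>a\<in>F \<inter> G. 1 - x a) * (\<Prod>a\<in>G - F \<inter> G. 1 - x a)"
        by (simp only: mult.commute)
      also have "\<dots> \<le> (\<Prod>a\<in>F \<inter> G. 1 - x a) * 1"
        using x0 x1 by (intro mult_left_mono prod_le_1 prod_nonneg) (auto simp: G_def less_imp_le)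
      finally show ?thesis by simp
    qed
    moreover have "exp (- (2 * (M * C))) \<le> (\<Prod>a\<in>F - G. 1 - x a)"
    proof -
      have "exp (- (2 * (M * C))) \<le> exp (\<Sum>a\<in>F - G. - (2 * x a))"
        using sx[of "F - G"] F by (auto simp: sum_negf simp flip: sum_distrib_left)
      also have "\<dots> = (\<Prod>a\<in>F - G. exp (- (2 * x a)))" using F by (simp add: exp_sum)
      also have "\<dots> \<le> (\<Prod>a\<in>F - G. 1 - x a)"
        using F x0 by (intro prod_mono conjI exp_minus_le_one_minus) (auto simp: G_def)
      finally show ?thesis .
    qed
    ultimately have "c \<le> (\<Prod>a\<in>F. 1 - x a)"
      unfolding c_def using x1 F
      by (auto intro!: mult_mono prod_nonneg simp: less_imp_le subset_iff)
    also have "\<dots> = (cmod (blaschke_prod F w))\<^sup>2"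
      by (simp add: x_def blaschke_prod_def prod_norm[symmetric] prod_power_distrib)
    finally show ?thesis .
  qed
  then have "sqrt c \<le> cmod (blaschke_prod F w)" if "finite F" "F \<subseteq> L" for F
    using that by (intro real_le_lsqrt) auto
  with c show thesis by (intro that[of "sqrt c"]) auto
qed

lemma one_minus_le_powr:
  assumes "0 \<le> \<alpha>" "\<alpha> < 1" "0 \<le> r" "r < (1::real)"
  shows "1 - r \<le> (1 - r) powr (1 - \<alpha>)" "(1 - r\<^sup>2) powr (1 - \<alpha>) \<le> 2 * (1 - r) powr (1 - \<alpha>)"
proof -
  have "(1 - r) powr 1 \<le> (1 - r) powr (1 - \<alpha>)"
    using assms by (intro powr_mono') auto
  then show "1 - r \<le> (1 - r) powr (1 - \<alpha>)" using assms by simp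
  have "(1 + r) * (1 - r) \<le> 2 * (1 - r)" using assms by (intro mult_right_mono) auto
  moreover have "0 \<le> (1 + r) * (1 - r)" using assms by (intro mult_nonneg_nonneg) auto
  moreover have "1 - r\<^sup>2 = (1 + r) * (1 - r)" by (simp add: power2_eq_square algebra_simps)
  ultimately have "(1 - r\<^sup>2) powr (1 - \<alpha>) \<le> (2 * (1 - r)) powr (1 - \<alpha>)"
    using assms by (intro powr_mono2) auto
  also have "\<dots> = 2 powr (1 - \<alpha>) * (1 - r) powr (1 - \<alpha>)"
    by (rule powr_mult)
  also have "\<dots> \<le> 2 powr 1 * (1 - r) powr (1 - \<alpha>)"
    using assms by (intro mult_right_mono powr_mono) auto
  finally show "(1 - r\<^sup>2) powr (1 - \<alpha>) \<le> 2 * (1 - r) powr (1 - \<alpha>)" by simp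
qed

text \<open>The point \<open>w\<close> is chosen off the countable set \<open>range z\<close>, so that the finite Blaschke products are
uniformly bounded away from \<open>0\<close> there and the compactness lemma yields a nonzero limit.\<close>

lemma is_zero_set_if_summable:
  fixes z :: "nat \<Rightarrow> complex"
  assumes \<alpha>: "0 \<le> \<alpha>" "\<alpha> < 1" and z: "range z \<subseteq> unit_disc"
    and C: "\<And>F. finite F \<Longrightarrow> F \<subseteq> range z \<Longrightarrow> (\<Sum>a\<in>F. (1 - cmod a) powr (1 - \<alpha>)) \<le> C"
  shows "is_zero_set \<alpha> (range z)"
proof -
  have zn: "cmod (z n) < 1" for n
  proof -
    have "z n \<in> unit_disc" using z by blast
    then show ?thesis by simp
  qed
  \<comment> \<open>The disc is uncountable.\<close>
  obtain w where w: "w \<in> unit_disc" "w \<notin> range z"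
  proof -
    have "\<not> unit_disc \<subseteq> range z"
    proof
      assume "unit_disc \<subseteq> range z"
      then have "countable unit_disc" by (rule countable_subset) simp
      then show False using uncountable_ball[of 1 "0::complex"] by simp
    qed
    then have "\<exists>x. x \<in> unit_disc \<and> x \<notin> range z" unfolding subset_iff by (simp only: not_all not_imp)
    then show thesis by (elim exE conjE) (rule that)
  qed
  have w1: "cmod w < 1" using w by simp
  have sC: "(\<Sum>a\<in>F. 1 - cmod a) \<le> C" if "finite F" "F \<subseteq> range z" for F
  proof -
    have "(\<Sum>a\<in>F. 1 - cmod a) \<le> (\<Sum>a\<in>F. (1 - cmod a) powr (1 - \<alpha>))"
      using that z by (intro sum_mono one_minus_le_powr \<alpha>) (auto dest!: subsetD)
    with C[OF that] show ?thesis by simp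
  qed
  obtain c where c: "c > 0" "\<And>F. finite F \<Longrightarrow> F \<subseteq> range z \<Longrightarrow> c \<le> cmod (blaschke_prod F w)"
    using blaschke_prod_bounded_below[OF w1 z w(2) sC] by blast
  define K where "K = max 1 (1 + Gamma \<alpha> * Gamma (1 - \<alpha>) * (2 * C))"
  define f where "f n = blaschke_prod (z ` {..<n})" for n
  have sub: "z ` {..<n} \<subseteq> unit_disc" for n using zn by auto
  have hol: "f n holomorphic_on unit_disc" for n
    unfolding f_def by (rule holomorphic_blaschke_prod[OF sub])
  have nrm: "dirichlet_norm_sq \<alpha> (f n) \<le> ennreal K" for n
  proof (cases "\<alpha> = 0")
    case True
    have "dirichlet_norm_sq 0 (f n) \<le> 1"
      by (rule dirichlet_norm_sq_0_le_sup[OF hol]) (auto simp: f_def intro!: norm_blaschke_prod_le sub)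
    also have "(1::ennreal) \<le> ennreal K" by (simp add: K_def flip: ennreal_1)
    finally show ?thesis using True by simp
  next
    case False
    then have \<alpha>0: "0 < \<alpha>" using \<alpha> by simp
    have G: "0 \<le> Gamma \<alpha> * Gamma (1 - \<alpha>)" using \<alpha> \<alpha>0 by (simp add: Gamma_real_pos less_imp_le)
    have "(\<Sum>a\<in>z ` {..<n}. (1 - (cmod a)\<^sup>2) powr (1 - \<alpha>)) \<le> (\<Sum>a\<in>z ` {..<n}. 2 * (1 - cmod a) powr (1 - \<alpha>))"
      using zn by (intro sum_mono one_minus_le_powr \<alpha>) auto
    also have "\<dots> \<le> 2 * C" using C[of "z ` {..<n}"] by (simp add: image_mono flip: sum_distrib_left)
    finally have "1 + Gamma \<alpha> * Gamma (1 - \<alpha>) * (\<Sum>a\<in>z ` {..<n}. (1 - (cmod a)\<^sup>2) powr (1 - \<alpha>)) \<le> K"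
      using mult_left_mono[OF _ G] unfolding K_def by (meson add_left_mono max.coboundedI2)
    then show ?thesis
      using dirichlet_norm_sq_blaschke_prod[OF \<alpha>0 \<alpha>(2) _ sub, of n] unfolding f_def
      by (meson ennreal_leI finite_imageI finite_lessThan order.trans)
  qed
  obtain g where g: "g holomorphic_on unit_disc" "dirichlet_norm_sq \<alpha> g \<le> ennreal K"
    "c \<le> cmod (g w)" "\<And>i. g (z i) = 0"
  proof (rule dirichlet_zero_limit[OF \<alpha>, of K f w c "\<lambda>_. z" z])
    show "\<forall>\<^sub>F n in sequentially. f n (z i) = 0" for i
      using eventually_gt_at_top[of i] by eventually_elim (auto simp: f_def intro!: blaschke_prod_zero)
    show "c \<le> cmod (f n w)" for n unfolding f_def by (rule c(2)) auto
  qed (use hol nrm w zn in \<open>auto simp: K_def\<close>)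
  show ?thesis
    unfolding is_zero_set_def
  proof (intro conjI z bexI[of _ g])
    show "\<exists>z\<in>unit_disc. g z \<noteq> 0" using g(3) c(1) w(1) by (intro bexI[of _ w]) auto
    show "g \<in> dirichlet_space \<alpha>"
      using g(1,2) by (auto simp: dirichlet_space_def intro: le_less_trans)
  qed (use g(4) in auto)
qed

section \<open>Zeros in the Hardy space\<close>

text \<open>A Blaschke factor has modulus at least \<open>sqrt (m r)\<close> on the circle of radius \<open>r\<close>, where \<open>m r\<close> tends to \<open>1\<close>
as \<open>r\<close> does; so dividing by it does not increase the limit of the circle means.\<close>

lemma hardy_divide_blaschke_factor:
  assumes f: "f holomorphic_on unit_disc" and K: "\<And>n. (\<Sum>k<n. (cmod (taylor_coeff f k))\<^sup>2) \<le> K"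
    and a: "cmod a < 1" and fa: "f a = 0"
  obtains h where "h holomorphic_on unit_disc" "\<And>n. (\<Sum>k<n. (cmod (taylor_coeff h k))\<^sup>2) \<le> K"
    "\<And>z. cmod z < 1 \<Longrightarrow> f z = blaschke_factor a z * h z"
proof -
  \<comment> \<open>The quotient by \<open>z - a\<close>, with its removable singularity filled in.\<close>
  define q where "q z = (if z = a then deriv f a else (f z - f a) / (z - a))" for z
  define h where "h z = (1 - cnj a * z) * q z" for z
  have q: "q holomorphic_on unit_disc"
    unfolding q_def[abs_def] by (rule pole_lemma[OF f]) (use a in \<open>simp add: interior_open\<close>)
  have h: "h holomorphic_on unit_disc" unfolding h_def[abs_def] by (intro holomorphic_intros q)
  have fh: "f z = blaschke_factor a z * h z" if "cmod z < 1" for z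
    using blaschke_denom_nonzero[OF a, of z] that fa
    by (auto simp: blaschke_factor_def h_def q_def)
  let ?b = "\<lambda>k. (cmod (taylor_coeff h k))\<^sup>2"
  have hK: "(\<Sum>k<n. ?b k) \<le> K" for n
  proof -
    define M where "M = (1 - (cmod a)\<^sup>2) / (1 - cmod a)\<^sup>2"
    define m where "m r = 1 - (1 - r\<^sup>2) * M" for r :: real
    have a2: "0 \<le> 1 - (cmod a)\<^sup>2" using a by (simp add: abs_square_le_1)
    have mlim: "(m \<longlongrightarrow> m 1) (at_left 1)" unfolding m_def by (intro tendsto_intros)
    have ev: "\<forall>\<^sub>F r in at_left 1. 0 < m r"
      using mlim by (rule order_tendstoD) (simp add: m_def)
    have *: "m r * (\<Sum>k<n. ?b k * r ^ (2 * k)) \<le> K" if r: "r \<in> {0<..<1}" "0 < m r" for r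
    proof -
      have r': "cmod (of_real r) < 1" using r by simp
      note ch = circle_parseval[OF h r'] and cf = circle_parseval[OF f r']
      have pt: "m r * (cmod (h (cis t * of_real r)))\<^sup>2 \<le> (cmod (f (cis t * of_real r)))\<^sup>2" for t
      proof -
        let ?z = "cis t * of_real r"
        have nz: "cmod ?z = r" using r by (simp add: norm_mult)
        then have z1: "cmod ?z < 1" "cmod ?z \<le> 1" using r by auto
        have "cmod (cnj a * ?z) \<le> cmod a" unfolding norm_mult[of "cnj a"] nz using r by (simp add: mult_left_le)
        then have "1 - cmod a \<le> cmod (1 - cnj a * ?z)"
          using norm_triangle_ineq2[of 1 "cnj a * ?z"] by simp
        then have "(1 - cmod a)\<^sup>2 \<le> (cmod (1 - cnj a * ?z))\<^sup>2" using a by (intro power_mono) auto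
        then have "(1 - (cmod a)\<^sup>2) * (1 - r\<^sup>2) / (cmod (1 - cnj a * ?z))\<^sup>2 \<le> (1 - (cmod a)\<^sup>2) * (1 - r\<^sup>2) / (1 - cmod a)\<^sup>2"
          using a r a2 by (intro divide_left_mono) (auto simp: power_le_one intro!: mult_nonneg_nonneg mult_pos_pos)
        then have "1 - (cmod (blaschke_factor a ?z))\<^sup>2 \<le> (1 - r\<^sup>2) * M"
          unfolding one_minus_blaschke_factor[OF a z1(2)] nz by (simp add: M_def mult.commute)
        then have "m r \<le> (cmod (blaschke_factor a ?z))\<^sup>2" by (simp add: m_def)
        then have "m r * (cmod (h ?z))\<^sup>2 \<le> (cmod (blaschke_factor a ?z))\<^sup>2 * (cmod (h ?z))\<^sup>2"
          by (rule mult_right_mono) simp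
        also have "\<dots> = (cmod (f ?z))\<^sup>2" unfolding fh[OF z1(1)] by (simp add: norm_mult power_mult_distrib)
        finally show ?thesis .
      qed
      have "(\<Sum>k<n. 2 * pi * (?b k * r ^ (2 * k))) \<le> integral {0..2*pi} (\<lambda>t. (cmod (h (cis t * of_real r)))\<^sup>2)"
        using ch(2) r sum_le_suminf[of "\<lambda>k. 2 * pi * (?b k * r ^ (2 * k))" "{..<n}"]
        by (simp add: sums_iff)
      then have "m r * (\<Sum>k<n. 2 * pi * (?b k * r ^ (2 * k))) \<le> m r * integral {0..2*pi} (\<lambda>t. (cmod (h (cis t * of_real r)))\<^sup>2)"
        using r by (intro mult_left_mono) auto
      also have "\<dots> = integral {0..2*pi} (\<lambda>t. m r * (cmod (h (cis t * of_real r)))\<^sup>2)" by simp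
      also have "\<dots> \<le> integral {0..2*pi} (\<lambda>t. (cmod (f (cis t * of_real r)))\<^sup>2)"
        using ch(1) cf(1) pt by (intro integral_le integrable_on_mult_right) auto
      also have "\<dots> \<le> 2 * pi * K"
      proof -
        have "(\<Sum>k<N. 2 * pi * ((cmod (taylor_coeff f k))\<^sup>2 * r ^ (2 * k))) \<le> 2 * pi * K" for N
        proof -
          have "(\<Sum>k<N. (cmod (taylor_coeff f k))\<^sup>2 * r ^ (2 * k)) \<le> (\<Sum>k<N. (cmod (taylor_coeff f k))\<^sup>2 * 1)"
            using r by (intro sum_mono mult_left_mono power_le_one) auto
          then show ?thesis using K[of N] by (simp flip: sum_distrib_left)
        qed
        then show ?thesis using cf(2) r unfolding sums_def by (intro LIMSEQ_le_const2) (auto simp: abs_of_pos)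
      qed
      finally show ?thesis by (simp add: mult.left_commute flip: sum_distrib_left)
    qed
    have "((\<lambda>r. m r * (\<Sum>k<n. ?b k * r ^ (2 * k))) \<longlongrightarrow> m 1 * (\<Sum>k<n. ?b k * 1 ^ (2 * k))) (at_left 1)"
      by (intro tendsto_intros mlim)
    moreover have "\<forall>\<^sub>F r in at_left (1::real). m r * (\<Sum>k<n. ?b k * r ^ (2 * k)) \<le> K"
      using eventually_at_left_real[OF zero_less_one] ev by eventually_elim (rule *)
    ultimately have "m 1 * (\<Sum>k<n. ?b k * 1 ^ (2 * k)) \<le> K"
      by (rule tendsto_upperbound) simp
    then show ?thesis by (simp add: m_def)
  qed
  show thesis by (rule that[OF h hK fh])
qed

lemma hardy_divide_blaschke_prod:
  assumes "finite F" "F \<subseteq> unit_disc" and f: "f holomorphic_on unit_disc"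
    and K: "\<And>n. (\<Sum>k<n. (cmod (taylor_coeff f k))\<^sup>2) \<le> K" and "\<And>a. a \<in> F \<Longrightarrow> f a = 0"
  shows "\<exists>h. h holomorphic_on unit_disc \<and> (\<forall>n. (\<Sum>k<n. (cmod (taylor_coeff h k))\<^sup>2) \<le> K) \<and>
    (\<forall>z. cmod z < 1 \<longrightarrow> f z = blaschke_prod F z * h z)"
  using assms
proof (induction F arbitrary: f rule: finite_induct)
  case empty
  then show ?case by (intro exI[of _ f]) (simp add: blaschke_prod_def)
next
  case (insert a F)
  have a: "cmod a < 1" and F: "F \<subseteq> unit_disc" using insert.prems by auto
  obtain h where h: "h holomorphic_on unit_disc" "\<And>n. (\<Sum>k<n. (cmod (taylor_coeff h k))\<^sup>2) \<le> K"
    "\<And>z. cmod z < 1 \<Longrightarrow> f z = blaschke_factor a z * h z"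
    using hardy_divide_blaschke_factor[OF insert.prems(2,3) a] insert.prems(4) by blast
  have "h b = 0" if b: "b \<in> F" for b
  proof -
    have b1: "cmod b < 1" "b \<noteq> a" using b F insert.hyps by auto
    have "f b = 0" using insert.prems(4) b by auto
    moreover have "blaschke_factor a b \<noteq> 0"
      using b1 blaschke_denom_nonzero[OF a, of b] by (auto simp: blaschke_factor_def)
    ultimately show ?thesis using h(3)[OF b1(1)] by simp
  qed
  from insert.IH[OF F h(1,2) this] obtain g where g: "g holomorphic_on unit_disc"
    "\<And>n. (\<Sum>k<n. (cmod (taylor_coeff g k))\<^sup>2) \<le> K" "\<And>z. cmod z < 1 \<Longrightarrow> h z = blaschke_prod F z * g z"
    by blast
  then show ?case
    using h(3) insert.hyps by (intro exI[of _ g]) (simp add: blaschke_prod_insert mult.assoc)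
qed

lemma dir_weight_0_ge: "1 \<le> 2 * dir_weight 0 k"
  using dir_weight_ge[of 0 k] by simp

text \<open>Dividing \<open>f\<close> by the Blaschke product of a finite set \<open>F\<close> of zeros leaves a function of no larger norm, so
\<open>\<bar>f w\<bar>\<close> is at most \<open>\<bar>B w\<bar>\<close> times a constant that is the same for all \<open>F\<close>.  Since \<open>\<bar>B w\<bar>\<^sup>2\<close> is at most the
exponential of minus a multiple of \<open>(\<Sum>a\<in>F. 1 - \<bar>a\<bar>)\<close>, that sum is bounded.\<close>

lemma hardy_zeros_summable:
  assumes f: "f \<in> dirichlet_space 0" and w: "cmod w < 1" "f w \<noteq> 0" and L: "L \<subseteq> unit_disc"
    and fL: "\<And>a. a \<in> L \<Longrightarrow> f a = 0"
  shows "\<exists>C. \<forall>F. finite F \<longrightarrow> F \<subseteq> L \<longrightarrow> (\<Sum>a\<in>F. 1 - cmod a) \<le> C"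
proof -
  have hol: "f holomorphic_on unit_disc" using f by (simp add: dirichlet_space_def)
  obtain K0 where K0: "dirichlet_norm_sq 0 f \<le> ennreal K0" "K0 \<ge> 0"
    using f by (cases "dirichlet_norm_sq 0 f" rule: ennreal_cases) (auto simp: dirichlet_space_def)
  define K where "K = 2 * K0"
  have K: "(\<Sum>k<n. (cmod (taylor_coeff f k))\<^sup>2) \<le> K" for n
  proof -
    have "(\<Sum>k<n. 1 * (cmod (taylor_coeff f k))\<^sup>2) \<le> (\<Sum>k<n. 2 * dir_weight 0 k * (cmod (taylor_coeff f k))\<^sup>2)"
      by (intro sum_mono mult_right_mono dir_weight_0_ge) auto
    also have "\<dots> = 2 * (\<Sum>k<n. dir_weight 0 k * (cmod (taylor_coeff f k))\<^sup>2)"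
      by (simp add: sum_distrib_left mult.assoc)
    also have "\<dots> \<le> K" unfolding K_def using sum_dir_weight_le[OF hol _ K0] by simp
    finally show ?thesis by simp
  qed
  define D where "D = 2 * K * (1 - (cmod w)\<^sup>2) powr (- 1)"
  define C where "C = 4 / (1 - (cmod w)\<^sup>2) * ln (D / (cmod (f w))\<^sup>2)"
  have w2: "0 < 1 - (cmod w)\<^sup>2" using w by (simp add: abs_square_less_1)
  have "(\<Sum>a\<in>F. 1 - cmod a) \<le> C" if F: "finite F" "F \<subseteq> L" for F
  proof -
    have Fd: "F \<subseteq> unit_disc" using F L by auto
    obtain h where h: "h holomorphic_on unit_disc" "\<And>n. (\<Sum>k<n. (cmod (taylor_coeff h k))\<^sup>2) \<le> K"
      and fh: "\<And>z. cmod z < 1 \<Longrightarrow> f z = blaschke_prod F z * h z"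
      using hardy_divide_blaschke_prod[OF F(1) Fd hol K] F fL by blast
    have K0': "0 \<le> K" using K0 by (simp add: K_def)
    have "dirichlet_norm_sq 0 h \<le> ennreal K"
    proof (rule dirichlet_norm_sq_leI[OF h(1)])
      fix n
      have "(\<Sum>k<n. dir_weight 0 k * (cmod (taylor_coeff h k))\<^sup>2) \<le> (\<Sum>k<n. 1 * (cmod (taylor_coeff h k))\<^sup>2)"
        using dir_weight_le[of 0] by (intro sum_mono mult_right_mono) auto
      then show "(\<Sum>k<n. dir_weight 0 k * (cmod (taylor_coeff h k))\<^sup>2) \<le> K" using h(2)[of n] by simp
    qed simp
    from dirichlet_pointwise_bound[OF h(1) _ _ this K0' w(1)]
    have hw: "(cmod (h w))\<^sup>2 \<le> D" by (simp add: D_def)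
    define x where "x a = 1 - (cmod (blaschke_factor a w))\<^sup>2" for a
    have B: "(cmod (blaschke_prod F w))\<^sup>2 = (\<Prod>a\<in>F. 1 - x a)"
      by (simp add: x_def blaschke_prod_def prod_norm[symmetric] prod_power_distrib)
    also have "\<dots> \<le> (\<Prod>a\<in>F. exp (- x a))"
      using exp_ge_add_one_self[of "- x a" for a] by (intro prod_mono) (auto simp: x_def)
    also have "\<dots> = exp (- (\<Sum>a\<in>F. x a))" using F by (subst exp_sum[symmetric]) (auto simp: sum_negf)
    finally have Be: "(cmod (blaschke_prod F w))\<^sup>2 \<le> exp (- (\<Sum>a\<in>F. x a))" .
    have "(cmod (f w))\<^sup>2 = (cmod (blaschke_prod F w))\<^sup>2 * (cmod (h w))\<^sup>2"
      unfolding fh[OF w(1)] by (simp add: norm_mult power_mult_distrib)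
    also have "\<dots> \<le> exp (- (\<Sum>a\<in>F. x a)) * D" by (intro mult_mono Be hw) auto
    finally have le: "(cmod (f w))\<^sup>2 \<le> exp (- (\<Sum>a\<in>F. x a)) * D" .
    have fw: "0 < (cmod (f w))\<^sup>2" using w by simp
    have D: "0 < D"
    proof (rule ccontr)
      assume "\<not> 0 < D"
      then have "exp (- (\<Sum>a\<in>F. x a)) * D \<le> 0" by (intro mult_nonneg_nonpos) auto
      with le fw show False by simp
    qed
    have "exp (\<Sum>a\<in>F. x a) * (cmod (f w))\<^sup>2 \<le> D"
      using le by (simp add: exp_minus field_simps)
    then have "exp (\<Sum>a\<in>F. x a) \<le> D / (cmod (f w))\<^sup>2" using fw by (simp add: pos_le_divide_eq)
    then have s: "(\<Sum>a\<in>F. x a) \<le> ln (D / (cmod (f w))\<^sup>2)" using D fw by (simp add: ln_ge_iff)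
    have "(\<Sum>a\<in>F. (1 - (cmod w)\<^sup>2) / 4 * (1 - cmod a)) \<le> (\<Sum>a\<in>F. x a)"
      using Fd w unfolding x_def by (intro sum_mono one_minus_blaschke_factor_bounds) auto
    with s have "(1 - (cmod w)\<^sup>2) / 4 * (\<Sum>a\<in>F. 1 - cmod a) \<le> ln (D / (cmod (f w))\<^sup>2)"
      by (simp only: sum_distrib_left[symmetric])
    then show ?thesis unfolding C_def using w2 by (simp add: field_simps)
  qed
  then show ?thesis by blast
qed

section \<open>A Carleson estimate for disjoint tangential arcs\<close>

text \<open>Moving \<open>rcis r t\<close> to the circle costs \<open>1 - r\<close>, which is itself at most \<open>\<bar>1 - rcis r t\<bar>\<close>; on the circle
the chord is compared with the arc.  The range of \<open>t\<close> keeps \<open>t / 2\<close> where the cosine is at least \<open>1/2\<close>.\<close>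

lemma one_minus_rcis_ge:
  assumes r: "0 \<le> r" "r \<le> 1" and t: "\<bar>t\<bar> \<le> 2 * pi / 3"
  shows "\<bar>t\<bar> / 4 \<le> cmod (1 - rcis r t)"
proof -
  have sin_ge: "x / 2 \<le> sin x" if x: "0 \<le> x" "x \<le> pi / 3" for x :: real
  proof (cases "x = 0")
    case False
    then have "0 < x" using x by simp
    then obtain y where y: "0 < y" "y < x" "sin x - sin 0 = (x - 0) * cos y"
      using MVT2[of 0 x sin cos] by (auto intro: DERIV_sin)
    have "cos (pi / 3) \<le> cos y" using y x by (intro cos_monotone_0_pi_le) auto
    then have "x * (1 / 2) \<le> x * cos y" using x by (intro mult_left_mono) (auto simp: cos_60)
    then show ?thesis using y by simp
  qed simp
  have "\<bar>t\<bar> / 4 \<le> sin (\<bar>t\<bar> / 2)" using sin_ge[of "\<bar>t\<bar> / 2"] t by simp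
  also have "\<dots> \<le> \<bar>sin (t / 2)\<bar>" by (cases "t \<ge> 0") auto
  finally have "\<bar>t\<bar> / 2 \<le> cmod (1 - cis t)"
    using dist_exp_i_1[of t] by (simp add: cis_conv_exp norm_minus_commute)
  also have "\<dots> \<le> cmod (1 - rcis r t) + cmod (rcis r t - cis t)"
    using norm_triangle_ineq[of "1 - rcis r t" "rcis r t - cis t"] by simp
  also have "cmod (rcis r t - cis t) = 1 - r"
  proof -
    have "rcis r t - cis t = of_real (r - 1) * cis t" by (simp add: rcis_def algebra_simps)
    then show ?thesis using r by (simp add: norm_mult del: of_real_diff)
  qed
  also have "1 - r \<le> cmod (1 - rcis r t)"
    using norm_triangle_ineq2[of 1 "rcis r t"] r by simp
  finally show ?thesis by simp
qed

lemma nn_integral_abs_powr_le: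
  assumes "-1 < s" "0 \<le> R"
  shows "(\<integral>\<^sup>+ x \<in> {t - R..t + R}. ennreal (\<bar>x - t\<bar> powr s) \<partial>lborel) \<le> ennreal (2 * (R powr (s + 1) / (s + 1)))"
proof -
  let ?f = "\<lambda>x. ennreal (\<bar>x\<bar> powr s) * indicator {0..R} x"
  have "((\<lambda>x. \<bar>x\<bar> powr s) has_integral (R powr (s+1) / (s+1))) {0..R}"
    using has_integral_powr_from_0[OF assms] by (rule has_integral_eq[rotated]) auto
  then have I: "(\<integral>\<^sup>+ x. ?f x \<partial>lborel) = ennreal (R powr (s+1) / (s+1))"
    by (intro nn_integral_has_integral_lebesgue') auto
  have I': "(\<integral>\<^sup>+ x. ?f (- x) \<partial>lborel) = ennreal (R powr (s+1) / (s+1))"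
    using nn_integral_real_affine[of ?f "-1" 0] I by simp
  have "(\<integral>\<^sup>+ x \<in> {t - R..t + R}. ennreal (\<bar>x - t\<bar> powr s) \<partial>lborel)
     = (\<integral>\<^sup>+ x. ennreal (\<bar>x\<bar> powr s) * indicator {t - R..t + R} (t + x) \<partial>lborel)"
    using nn_integral_real_affine[of "\<lambda>x. ennreal (\<bar>x - t\<bar> powr s) * indicator {t - R..t + R} x" 1 t] by simp
  also have "\<dots> \<le> (\<integral>\<^sup>+ x. ?f x + ?f (- x) \<partial>lborel)"
    by (intro nn_integral_mono) (auto simp: indicator_def)
  also have "\<dots> = (\<integral>\<^sup>+ x. ?f x \<partial>lborel) + (\<integral>\<^sup>+ x. ?f (- x) \<partial>lborel)"
    by (rule nn_integral_add) auto
  also have "\<dots> = ennreal (2 * (R powr (s + 1) / (s + 1)))"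
    unfolding I I' using assms by (subst ennreal_plus[symmetric]) auto
  finally show ?thesis .
qed

lemma abs_diff_ge_if_balls_disjnt:
  fixes x y :: real
  assumes "disjnt (ball x r) (ball y s)" "0 < r" "0 < s"
  shows "r + s \<le> \<bar>x - y\<bar>"
proof (rule ccontr)
  assume *: "\<not> r + s \<le> \<bar>x - y\<bar>"
  define p where "p = x + (y - x) * (r / (r + s))"
  have 1: "\<bar>p - x\<bar> = \<bar>x - y\<bar> * (r / (r + s))"
    using assms by (simp add: p_def abs_mult abs_minus_commute)
  have "y - p = (y - x) * (s / (r + s))" using assms by (simp add: p_def field_simps)
  then have 2: "\<bar>y - p\<bar> = \<bar>x - y\<bar> * (s / (r + s))"
    using assms by (simp add: abs_mult abs_minus_commute)
  have "\<bar>x - y\<bar> * (r / (r + s)) < (r + s) * (r / (r + s))"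
    using * assms by (intro mult_strict_right_mono) auto
  then have "p \<in> ball x r" using assms 1 by (simp add: dist_real_def abs_minus_commute)
  have "\<bar>x - y\<bar> * (s / (r + s)) < (r + s) * (s / (r + s))"
    using * assms by (intro mult_strict_right_mono) auto
  then have "p \<in> ball y s" using assms 2 by (simp add: dist_real_def)
  with \<open>p \<in> ball x r\<close> assms(1) show False by (auto simp: disjnt_def)
qed

text \<open>The diagonal contributes \<open>1\<close>; the second summand is the integral of \<open>\<bar>s\<bar> powr (\<alpha> - 1)\<close> over the interval of radius
\<open>4 * pi / 3\<close>, times the constants lost in comparing the kernel with it.\<close>

definition arc_row_bound :: "real \<Rightarrow> real" where
  "arc_row_bound \<alpha> = 1 + 4 powr (1 - \<alpha>) * (2 * (2 powr (1 - \<alpha>) * ((4 * pi / 3) powr \<alpha> / \<alpha>)))"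

text \<open>For \<open>j \<noteq> i\<close> the arcs are disjoint, so \<open>\<bar>t i - x\<bar> \<le> 2 * \<bar>t i - t j\<bar>\<close> for all \<open>x\<close> in the arc of \<open>j\<close>, and the kernel at
\<open>(i, j)\<close> times the length of that arc is, up to a constant, dominated by the integral of \<open>\<bar>x - t i\<bar> powr (\<alpha> - 1)\<close> over it.
Disjointness allows these integrals to be added.  On the diagonal the kernel is at most the reciprocal
of the radius, which is why the radius is \<open>\<delta> powr (1 - \<alpha>)\<close>.\<close>

lemma arcs_row_sum:
  fixes t \<delta> :: "'i \<Rightarrow> real"
  assumes \<alpha>: "0 < \<alpha>" "\<alpha> < 1" and D: "finite D" and i: "i \<in> D"
    and \<delta>: "\<And>j. j \<in> D \<Longrightarrow> 0 < \<delta> j \<and> \<delta> j \<le> 1"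
    and disj: "pairwise (\<lambda>i j. disjnt (ball (t i) (\<delta> i powr (1 - \<alpha>))) (ball (t j) (\<delta> j powr (1 - \<alpha>)))) D"
    and near: "\<And>j. j \<in> D \<Longrightarrow> \<bar>t i - t j\<bar> \<le> 2 * pi / 3"
  shows "(\<Sum>j\<in>D. \<delta> j powr (1 - \<alpha>) *
      cmod (1 - rcis (1 - \<delta> i) (t i) * cnj (rcis (1 - \<delta> j) (t j))) powr (- (1 - \<alpha>))) \<le> arc_row_bound \<alpha>"
proof -
  define L where "L j = \<delta> j powr (1 - \<alpha>)" for j
  define B where "B j = ball (t j) (L j)" for j
  define k where "k j = cmod (1 - rcis (1 - \<delta> i) (t i) * cnj (rcis (1 - \<delta> j) (t j)))" for j
  define E where "E = D - {i}"
  have [measurable]: "B j \<in> sets borel" for j by (simp add: B_def)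
  have Lp: "L j > 0" if "j \<in> D" for j using \<delta>[OF that] by (simp add: L_def)
  have k: "k j = cmod (1 - rcis ((1 - \<delta> i) * (1 - \<delta> j)) (t i - t j))" for j
  proof -
    have "rcis (1 - \<delta> i) (t i) * cnj (rcis (1 - \<delta> j) (t j)) = rcis ((1 - \<delta> i) * (1 - \<delta> j)) (t i - t j)"
      by (simp add: rcis_def cis_cnj[symmetric] cis_mult cis_divide[symmetric] divide_inverse)
    then show ?thesis by (simp add: k_def)
  qed
  have i01: "0 < \<delta> i" "\<delta> i \<le> 1" using \<delta>[OF i] by auto
  have diag: "L i * k i powr (- (1 - \<alpha>)) \<le> 1"
  proof -
    have "rcis ((1 - \<delta> i) * (1 - \<delta> i)) (t i - t i) = of_real ((1 - \<delta> i) * (1 - \<delta> i))" by (simp add: rcis_def)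
    then have "k i = \<bar>1 - (1 - \<delta> i) * (1 - \<delta> i)\<bar>"
      unfolding k by (metis norm_of_real of_real_1 of_real_diff)
    moreover have "(1 - \<delta> i) * (1 - \<delta> i) \<le> 1 * (1 - \<delta> i)" using i01 by (intro mult_right_mono) auto
    ultimately have "\<delta> i \<le> k i" by simp
    then have "k i powr (- (1 - \<alpha>)) \<le> \<delta> i powr (- (1 - \<alpha>))"
      using i01 \<alpha> by (intro powr_mono2') auto
    then have "L i * k i powr (- (1 - \<alpha>)) \<le> \<delta> i powr (1 - \<alpha>) * \<delta> i powr (- (1 - \<alpha>))"
      unfolding L_def by (intro mult_left_mono) auto
    also have "\<dots> = 1" using i01 by (simp flip: powr_add)
    finally show ?thesis .
  qed
  have off: "ennreal (L j * k j powr (- (1 - \<alpha>))) \<le>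
      ennreal (4 powr (1 - \<alpha>) * 2 powr (1 - \<alpha>)) * (\<integral>\<^sup>+ x \<in> B j. ennreal (\<bar>x - t i\<bar> powr (\<alpha> - 1)) \<partial>lborel)"
    if j: "j \<in> E" for j
  proof -
    have jD: "j \<in> D" "i \<noteq> j" using j by (auto simp: E_def)
    have jd: "0 < \<delta> j" "\<delta> j \<le> 1" using \<delta>[OF jD(1)] by auto
    have "L i + L j \<le> \<bar>t i - t j\<bar>"
      using disj Lp i jD by (intro abs_diff_ge_if_balls_disjnt) (auto simp: L_def pairwise_def)
    then have d: "L j \<le> \<bar>t i - t j\<bar>" "0 < \<bar>t i - t j\<bar>" using Lp[OF i] Lp[OF jD(1)] by auto
    have "\<bar>t i - t j\<bar> / 4 \<le> k j"
      unfolding k using i01 jd near[OF jD(1)]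
      by (intro one_minus_rcis_ge) (auto intro: mult_le_one)
    then have "k j powr (- (1 - \<alpha>)) \<le> (\<bar>t i - t j\<bar> / 4) powr (- (1 - \<alpha>))"
      using d \<alpha> by (intro powr_mono2') auto
    also have "\<dots> = 4 powr (1 - \<alpha>) * \<bar>t i - t j\<bar> powr (- (1 - \<alpha>))"
    proof -
      have "(x / 4) powr (- s) = 4 powr s * x powr (- s)" if "x > 0" for x s :: real
        using that by (simp add: powr_divide powr_minus field_simps)
      then show ?thesis using d by blast
    qed
    finally have k_le: "k j powr (- (1 - \<alpha>)) \<le> 4 powr (1 - \<alpha>) * \<bar>t i - t j\<bar> powr (- (1 - \<alpha>))" .
    let ?c = "(2 * \<bar>t i - t j\<bar>) powr (- (1 - \<alpha>))"
    have c: "\<bar>t i - t j\<bar> powr (- (1 - \<alpha>)) = 2 powr (1 - \<alpha>) * ?c"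
    proof -
      have "x powr (- s) = 2 powr s * (2 * x) powr (- s)" if "x > 0" for x s :: real
        using that by (simp add: powr_mult powr_minus field_simps)
      then show ?thesis using d by blast
    qed
    have null: "AE x in lborel. x \<noteq> t i" by (rule AE_lborel_singleton)
    have "ennreal (L j * ?c) \<le> ennreal ?c * emeasure lborel (B j)"
    proof -
      have "ennreal (L j * ?c) \<le> ennreal (?c * (2 * L j))"
        using Lp[OF jD(1)] by (intro ennreal_leI) (simp add: mult.commute)
      also have "\<dots> = ennreal ?c * emeasure lborel (B j)"
        using Lp[OF jD(1)] by (simp add: B_def ball_eq_greaterThanLessThan ennreal_mult flip: mult_2)
      finally show ?thesis .
    qed
    also have "\<dots> = (\<integral>\<^sup>+ x. ennreal ?c * indicator (B j) x \<partial>lborel)"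
      by (rule nn_integral_cmult_indicator[symmetric]) (simp add: B_def)
    also have "\<dots> \<le> (\<integral>\<^sup>+ x \<in> B j. ennreal (\<bar>x - t i\<bar> powr (\<alpha> - 1)) \<partial>lborel)"
    proof (rule nn_integral_mono_AE, use null in eventually_elim)
      case (elim x)
      show ?case
      proof (cases "x \<in> B j")
        case True
        then have "\<bar>x - t j\<bar> < L j" by (simp add: B_def dist_real_def abs_minus_commute)
        then have "\<bar>x - t i\<bar> \<le> 2 * \<bar>t i - t j\<bar>"
          using d(1) abs_triangle_ineq[of "x - t j" "t j - t i"] by (simp add: abs_minus_commute)
        then have "?c \<le> \<bar>x - t i\<bar> powr (- (1 - \<alpha>))"
          using elim \<alpha> by (intro powr_mono2') auto
        then show ?thesis using True by (simp add: ennreal_leI)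
      qed simp
    qed
    finally have I: "ennreal (L j * ?c) \<le> (\<integral>\<^sup>+ x \<in> B j. ennreal (\<bar>x - t i\<bar> powr (\<alpha> - 1)) \<partial>lborel)" .
    have "L j * k j powr (- (1 - \<alpha>)) \<le> L j * (4 powr (1 - \<alpha>) * (2 powr (1 - \<alpha>) * ?c))"
      using k_le Lp[OF jD(1)] unfolding c by (intro mult_left_mono) auto
    also have "\<dots> = (4 powr (1 - \<alpha>) * 2 powr (1 - \<alpha>)) * (L j * ?c)" by (simp only: mult_ac)
    finally have "ennreal (L j * k j powr (- (1 - \<alpha>))) \<le> ennreal (4 powr (1 - \<alpha>) * 2 powr (1 - \<alpha>)) * ennreal (L j * ?c)"
      by (subst ennreal_mult'[symmetric]) (auto intro: ennreal_leI)
    also have "\<dots> \<le> ennreal (4 powr (1 - \<alpha>) * 2 powr (1 - \<alpha>)) * (\<integral>\<^sup>+ x \<in> B j. ennreal (\<bar>x - t i\<bar> powr (\<alpha> - 1)) \<partial>lborel)"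
      by (intro mult_left_mono I) auto
    finally show ?thesis .
  qed
  have sumI: "(\<Sum>j\<in>E. \<integral>\<^sup>+ x \<in> B j. ennreal (\<bar>x - t i\<bar> powr (\<alpha> - 1)) \<partial>lborel)
      \<le> ennreal (2 * ((4 * pi / 3) powr \<alpha> / \<alpha>))"
  proof -
    have "(\<Sum>j\<in>E. \<integral>\<^sup>+ x \<in> B j. ennreal (\<bar>x - t i\<bar> powr (\<alpha> - 1)) \<partial>lborel)
       = (\<integral>\<^sup>+ x. (\<Sum>j\<in>E. ennreal (\<bar>x - t i\<bar> powr (\<alpha> - 1)) * indicator (B j) x) \<partial>lborel)"
      by (rule nn_integral_sum[symmetric]) simp
    also have "\<dots> \<le> (\<integral>\<^sup>+ x \<in> {t i - 4 * pi / 3..t i + 4 * pi / 3}. ennreal (\<bar>x - t i\<bar> powr (\<alpha> - 1)) \<partial>lborel)"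
    proof (rule nn_integral_mono)
      fix x :: real
      show "(\<Sum>j\<in>E. ennreal (\<bar>x - t i\<bar> powr (\<alpha> - 1)) * indicator (B j) x)
        \<le> ennreal (\<bar>x - t i\<bar> powr (\<alpha> - 1)) * indicator {t i - 4 * pi / 3..t i + 4 * pi / 3} x"
      proof (cases "\<exists>j\<in>E. x \<in> B j")
        case True
        then obtain j where j: "j \<in> E" "x \<in> B j" by blast
        have "x \<notin> B l" if "l \<in> E - {j}" for l
          using disj j that unfolding pairwise_def B_def L_def E_def disjnt_iff by blast
        then have "(\<Sum>l\<in>E - {j}. ennreal (\<bar>x - t i\<bar> powr (\<alpha> - 1)) * indicator (B l) x) = 0"
          by (intro sum.neutral) auto
        then have "(\<Sum>l\<in>E. ennreal (\<bar>x - t i\<bar> powr (\<alpha> - 1)) * indicator (B l) x) = ennreal (\<bar>x - t i\<bar> powr (\<alpha> - 1))"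
          using j D by (subst sum.remove[of _ j]) (auto simp: E_def)
        moreover have "x \<in> {t i - 4 * pi / 3..t i + 4 * pi / 3}"
        proof -
          have jD: "j \<in> D" "i \<noteq> j" using j by (auto simp: E_def)
          have "L i + L j \<le> \<bar>t i - t j\<bar>"
            using disj Lp i jD by (intro abs_diff_ge_if_balls_disjnt) (auto simp: L_def pairwise_def)
          moreover have "\<bar>x - t j\<bar> < L j" using j(2) by (simp add: B_def dist_real_def abs_minus_commute)
          ultimately have "\<bar>x - t i\<bar> \<le> 2 * \<bar>t i - t j\<bar>"
            using Lp[OF i] abs_triangle_ineq[of "x - t j" "t j - t i"] by (simp add: abs_minus_commute)
          then have "\<bar>x - t i\<bar> \<le> 4 * pi / 3" using near[OF jD(1)] by simp
          then show ?thesis unfolding abs_le_iff atLeastAtMost_iff by linarith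
        qed
        ultimately show ?thesis by simp
      next
        case False
        then have "(\<Sum>l\<in>E. ennreal (\<bar>x - t i\<bar> powr (\<alpha> - 1)) * indicator (B l) x) = 0"
          by (intro sum.neutral) auto
        then show ?thesis by simp
      qed
    qed
    also have "\<dots> \<le> ennreal (2 * ((4 * pi / 3) powr \<alpha> / \<alpha>))"
      using nn_integral_abs_powr_le[of "\<alpha> - 1" "4 * pi / 3" "t i"] \<alpha> by simp
    finally show ?thesis .
  qed
  have "ennreal (\<Sum>j\<in>E. L j * k j powr (- (1 - \<alpha>))) = (\<Sum>j\<in>E. ennreal (L j * k j powr (- (1 - \<alpha>))))"
    by (subst sum_ennreal) (auto simp: L_def)
  also have "\<dots> \<le> (\<Sum>j\<in>E. ennreal (4 powr (1 - \<alpha>) * 2 powr (1 - \<alpha>)) *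
       (\<integral>\<^sup>+ x \<in> B j. ennreal (\<bar>x - t i\<bar> powr (\<alpha> - 1)) \<partial>lborel))"
    by (rule sum_mono) (rule off)
  also have "\<dots> \<le> ennreal (4 powr (1 - \<alpha>) * 2 powr (1 - \<alpha>)) * ennreal (2 * ((4 * pi / 3) powr \<alpha> / \<alpha>))"
    unfolding sum_distrib_left[symmetric] by (intro mult_left_mono sumI) simp
  also have "\<dots> = ennreal (4 powr (1 - \<alpha>) * (2 * (2 powr (1 - \<alpha>) * ((4 * pi / 3) powr \<alpha> / \<alpha>))))"
    using \<alpha> by (subst ennreal_mult[symmetric]) (auto simp: mult_ac)
  finally have "(\<Sum>j\<in>E. L j * k j powr (- (1 - \<alpha>))) \<le> 4 powr (1 - \<alpha>) * (2 * (2 powr (1 - \<alpha>) * ((4 * pi / 3) powr \<alpha> / \<alpha>)))"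
    by (subst (asm) ennreal_le_iff) (use \<alpha> in auto)
  moreover have "(\<Sum>j\<in>D. L j * k j powr (- (1 - \<alpha>))) = L i * k i powr (- (1 - \<alpha>)) + (\<Sum>j\<in>E. L j * k j powr (- (1 - \<alpha>)))"
    unfolding E_def by (rule sum.remove[OF D i])
  ultimately show ?thesis
    using diag unfolding L_def k_def arc_row_bound_def by linarith
qed

lemma arc_row_bound_nonneg: "0 < \<alpha> \<Longrightarrow> 0 \<le> arc_row_bound \<alpha>"
  by (simp add: arc_row_bound_def)

text \<open>Write \<open>S\<close> for the left-hand side.  It is the pairing of \<open>g\<close> with a combination of reproducing kernels, so
Cauchy-Schwarz gives \<open>S\<^sup>2 \<le> K * T\<close> with \<open>T\<close> the squared norm of that combination, a quadratic form in the
kernel at pairs of points.  The Schur test, with rows bounded by \<open>arcs_row_sum\<close>, gives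
\<open>T \<le> arc_row_bound \<alpha> * S\<close>.\<close>

lemma arcs_carleson:
  fixes t \<delta> :: "'i \<Rightarrow> real" and b :: "nat \<Rightarrow> complex"
  assumes \<alpha>: "0 < \<alpha>" "\<alpha> < 1" and D: "finite D"
    and \<delta>: "\<And>j. j \<in> D \<Longrightarrow> 0 < \<delta> j \<and> \<delta> j \<le> 1"
    and disj: "pairwise (\<lambda>i j. disjnt (ball (t i) (\<delta> i powr (1 - \<alpha>))) (ball (t j) (\<delta> j powr (1 - \<alpha>)))) D"
    and near: "\<And>i j. i \<in> D \<Longrightarrow> j \<in> D \<Longrightarrow> \<bar>t i - t j\<bar> \<le> 2 * pi / 3"
    and g: "\<And>z. cmod z < 1 \<Longrightarrow> (\<lambda>k. b k * z ^ k) sums g z"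
    and K: "\<And>n. (\<Sum>k<n. (cmod (b k))\<^sup>2 / ker_coeff (1 - \<alpha>) k) \<le> K"
  shows "(\<Sum>i\<in>D. \<delta> i powr (1 - \<alpha>) * (cmod (g (rcis (1 - \<delta> i) (t i))))\<^sup>2) \<le> K * arc_row_bound \<alpha>"
proof -
  define \<kappa> where "\<kappa> = ker_coeff (1 - \<alpha>)"
  have \<kappa>: "\<kappa> k > 0" for k unfolding \<kappa>_def using \<alpha> by (intro ker_coeff_pos) simp
  define L where "L j = \<delta> j powr (1 - \<alpha>)" for j
  define l where "l j = rcis (1 - \<delta> j) (t j)" for j
  have l1: "cmod (l j) < 1" if "j \<in> D" for j using \<delta>[OF that] by (simp add: l_def)
  define G where "G j = cmod (g (l j))" for j
  define S where "S = (\<Sum>i\<in>D. L i * (G i)\<^sup>2)"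
  \<comment> \<open>With these coefficients the pairing with \<open>g\<close> is \<open>S\<close> itself.\<close>
  define c where "c i = of_real (L i) * cnj (g (l i))" for i
  define A where "A k = (\<Sum>i\<in>D. c i * l i ^ k)" for k
  have L0: "0 \<le> L j" for j by (simp add: L_def)
  have nc: "cmod (c i) = L i * G i" for i by (simp add: c_def G_def norm_mult L0)
  have S0: "0 \<le> S" unfolding S_def by (intro sum_nonneg mult_nonneg_nonneg L0) auto
  have Slim: "(\<lambda>n. \<Sum>k<n. b k * A k) \<longlonglongrightarrow> of_real S"
  proof -
    have "(\<lambda>n. \<Sum>i\<in>D. c i * (\<Sum>k<n. b k * l i ^ k)) \<longlonglongrightarrow> (\<Sum>i\<in>D. c i * g (l i))"
      using g[OF l1] by (intro tendsto_intros) (auto simp: sums_def)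
    moreover have "(\<Sum>i\<in>D. c i * (\<Sum>k<n. b k * l i ^ k)) = (\<Sum>k<n. b k * A k)" for n
      unfolding A_def sum_distrib_left by (subst sum.swap) (simp add: mult_ac)
    moreover have "(\<Sum>i\<in>D. c i * g (l i)) = of_real S"
      unfolding S_def of_real_sum
      by (intro sum.cong refl) (simp add: c_def G_def complex_norm_square mult_ac del: of_real_power flip: of_real_power)
    ultimately show ?thesis by simp
  qed
  \<comment> \<open>\<open>T\<close> is the limit of the partial sums of the squared norm of the kernel combination.\<close>
  define T where "T = (\<Sum>i\<in>D. \<Sum>j\<in>D. c i * cnj (c j) * (1 - l i * cnj (l j)) powr (- of_real (1 - \<alpha>)))"
  have Tlim: "(\<lambda>n. of_real (\<Sum>k<n. \<kappa> k * (cmod (A k))\<^sup>2)) \<longlonglongrightarrow> T"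
  proof -
    have "cmod (l i * cnj (l j)) < 1" if "i \<in> D" "j \<in> D" for i j
      using l1[OF that(1)] l1[OF that(2)] unfolding norm_mult complex_mod_cnj
      by (metis mult_strict_mono' mult_1 norm_ge_zero)
    then have "(\<lambda>n. \<Sum>i\<in>D. \<Sum>j\<in>D. c i * cnj (c j) * (\<Sum>k<n. of_real (\<kappa> k) * (l i * cnj (l j)) ^ k)) \<longlonglongrightarrow> T"
      unfolding T_def \<kappa>_def using ker_coeff_sums[of _ "1 - \<alpha>"]
      by (intro tendsto_intros) (auto simp: sums_def)
    moreover have "(\<Sum>i\<in>D. \<Sum>j\<in>D. c i * cnj (c j) * (\<Sum>k<n. of_real (\<kappa> k) * (l i * cnj (l j)) ^ k))
       = of_real (\<Sum>k<n. \<kappa> k * (cmod (A k))\<^sup>2)" for n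
    proof -
      have "of_real (\<Sum>k<n. \<kappa> k * (cmod (A k))\<^sup>2) = (\<Sum>k<n. of_real (\<kappa> k) * (A k * cnj (A k)))"
        by (simp add: complex_norm_square del: of_real_power flip: of_real_power)
      also have "\<dots> = (\<Sum>k<n. \<Sum>i\<in>D. \<Sum>j\<in>D. c i * cnj (c j) * (of_real (\<kappa> k) * (l i * cnj (l j)) ^ k))"
      proof -
        have "A k * cnj (A k) = (\<Sum>i\<in>D. \<Sum>j\<in>D. (c i * l i ^ k) * cnj (c j * l j ^ k))" for k
          unfolding A_def cnj_sum by (rule sum_product)
        then show ?thesis
          unfolding sum_distrib_left
          by (simp only: sum_distrib_left) (intro sum.cong refl, simp add: power_mult_distrib mult_ac)
      qed
      also have "\<dots> = (\<Sum>i\<in>D. \<Sum>j\<in>D. \<Sum>k<n. c i * cnj (c j) * (of_real (\<kappa> k) * (l i * cnj (l j)) ^ k))"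
        by (subst sum.swap) (intro sum.cong refl sum.swap)
      finally show ?thesis by (simp add: sum_distrib_left)
    qed
    ultimately show ?thesis by simp
  qed
  define m where "m i j = cmod (1 - l i * cnj (l j)) powr (- (1 - \<alpha>))" for i j
  have msym: "m i j = m j i" for i j
  proof -
    have "cnj (1 - l i * cnj (l j)) = 1 - l j * cnj (l i)" by (simp add: mult.commute)
    then show ?thesis unfolding m_def by (metis complex_mod_cnj)
  qed
  have m0: "0 \<le> m i j" for i j by (simp add: m_def)
  have row: "(\<Sum>j\<in>D. L j * m i j) \<le> arc_row_bound \<alpha>" if "i \<in> D" for i
    using arcs_row_sum[OF \<alpha> D that \<delta> disj near[OF that]] by (simp add: L_def m_def l_def)
  have "cmod T \<le> (\<Sum>i\<in>D. \<Sum>j\<in>D. (L i * G i) * (L j * G j) * m i j)"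
  proof -
    have np: "cmod (z powr (- complex_of_real s)) = cmod z powr (- s)" for z s
      using norm_powr_real_powr'[of "- complex_of_real s" z] by simp
    show ?thesis
      unfolding T_def m_def by (intro sum_norm_le) (simp only: norm_mult nc np complex_mod_cnj order_refl)
  qed
  also have "\<dots> \<le> (\<Sum>i\<in>D. \<Sum>j\<in>D. (1/2) * (L i * (G i)\<^sup>2 * (L j * m i j)) + (1/2) * (L j * (G j)\<^sup>2 * (L i * m j i)))"
  proof (intro sum_mono)
    fix i j
    have "G i * G j \<le> (1/2) * ((G i)\<^sup>2 + (G j)\<^sup>2)"
      using sum_squares_bound[of "G i" "G j"] by simp
    then have "(L i * L j * m i j) * (G i * G j) \<le> (L i * L j * m i j) * ((1/2) * ((G i)\<^sup>2 + (G j)\<^sup>2))"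
      by (intro mult_left_mono mult_nonneg_nonneg L0 m0)
    then show "(L i * G i) * (L j * G j) * m i j \<le>
        (1/2) * (L i * (G i)\<^sup>2 * (L j * m i j)) + (1/2) * (L j * (G j)\<^sup>2 * (L i * m j i))"
      unfolding msym[of j i] by (simp add: algebra_simps)
  qed
  also have "\<dots> = (\<Sum>i\<in>D. L i * (G i)\<^sup>2 * (\<Sum>j\<in>D. L j * m i j))"
  proof -
    have swap: "(\<Sum>i\<in>D. \<Sum>j\<in>D. L j * (G j)\<^sup>2 * (L i * m j i)) = (\<Sum>i\<in>D. L i * (G i)\<^sup>2 * (\<Sum>j\<in>D. L j * m i j))"
      by (subst sum.swap) (simp only: sum_distrib_left)
    show ?thesis
      unfolding sum.distrib sum_distrib_left[symmetric] swap by simp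
  qed
  also have "\<dots> \<le> (\<Sum>i\<in>D. L i * (G i)\<^sup>2 * arc_row_bound \<alpha>)"
    by (intro sum_mono mult_left_mono row) (auto simp: L0)
  also have "\<dots> = S * arc_row_bound \<alpha>" by (simp add: S_def sum_distrib_right)
  finally have T: "cmod T \<le> S * arc_row_bound \<alpha>" .
  have K0: "0 \<le> K" using K[of 0] by simp
  have "(cmod (\<Sum>k<n. b k * A k))\<^sup>2 \<le> K * cmod (of_real (\<Sum>k<n. \<kappa> k * (cmod (A k))\<^sup>2))" for n
  proof -
    have "cmod (\<Sum>k<n. b k * A k) \<le> (\<Sum>k<n. (cmod (b k) / sqrt (\<kappa> k)) * (sqrt (\<kappa> k) * cmod (A k)))"
      by (rule order.trans[OF norm_sum]) (use \<kappa> in \<open>simp add: norm_mult less_imp_neq[symmetric]\<close>)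
    then have "(cmod (\<Sum>k<n. b k * A k))\<^sup>2 \<le> (\<Sum>k<n. (cmod (b k) / sqrt (\<kappa> k)) * (sqrt (\<kappa> k) * cmod (A k)))\<^sup>2"
      by (intro power_mono) auto
    also have "\<dots> \<le> (\<Sum>k<n. (cmod (b k) / sqrt (\<kappa> k))\<^sup>2) * (\<Sum>k<n. (sqrt (\<kappa> k) * cmod (A k))\<^sup>2)"
      by (rule Cauchy_Schwarz_ineq_sum)
    also have "(\<Sum>k<n. (cmod (b k) / sqrt (\<kappa> k))\<^sup>2) = (\<Sum>k<n. (cmod (b k))\<^sup>2 / ker_coeff (1 - \<alpha>) k)"
      using \<kappa> by (intro sum.cong) (auto simp: power_divide less_imp_le \<kappa>_def)
    also have "(\<Sum>k<n. (sqrt (\<kappa> k) * cmod (A k))\<^sup>2) = (\<Sum>k<n. \<kappa> k * (cmod (A k))\<^sup>2)"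
      using \<kappa> by (intro sum.cong) (auto simp: power_mult_distrib less_imp_le)
    also have "(\<Sum>k<n. (cmod (b k))\<^sup>2 / ker_coeff (1 - \<alpha>) k) * (\<Sum>k<n. \<kappa> k * (cmod (A k))\<^sup>2)
       \<le> K * (\<Sum>k<n. \<kappa> k * (cmod (A k))\<^sup>2)"
      using \<kappa> by (intro mult_right_mono K sum_nonneg) (auto simp: less_imp_le)
    also have "(\<Sum>k<n. \<kappa> k * (cmod (A k))\<^sup>2) = cmod (of_real (\<Sum>k<n. \<kappa> k * (cmod (A k))\<^sup>2))"
      unfolding norm_of_real using \<kappa> by (intro abs_of_nonneg[symmetric] sum_nonneg) (auto simp: less_imp_le)
    finally show ?thesis .
  qed
  then have "(cmod (of_real S))\<^sup>2 \<le> K * cmod T"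
    by (intro LIMSEQ_le[OF tendsto_power[OF tendsto_norm[OF Slim]] tendsto_mult_left[OF tendsto_norm[OF Tlim]]]) auto
  also have "\<dots> \<le> K * (S * arc_row_bound \<alpha>)" by (intro mult_left_mono T K0)
  finally have *: "S * S \<le> S * (K * arc_row_bound \<alpha>)" by (simp add: power2_eq_square mult_ac)
  have "S \<le> K * arc_row_bound \<alpha>"
  proof (cases "S = 0")
    case True
    then show ?thesis using K0 arc_row_bound_nonneg[OF \<alpha>(1)] by simp
  next
    case False
    then show ?thesis using * S0 by simp
  qed
  then show ?thesis by (simp add: S_def L_def G_def l_def)
qed

section \<open>Functions vanishing at centres of a covering family of arcs\<close>

lemma negligible_imp_AE_lborel:
  assumes "negligible (X :: 'a::euclidean_space set)"
  shows "AE x in lborel. x \<notin> X"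
proof -
  have "X \<in> null_sets (completion lborel)" using assms by (simp add: negligible_iff_null_sets)
  then obtain N where "N \<in> null_sets lborel" "X \<subseteq> N" unfolding null_sets_completion_iff2 by blast
  then show ?thesis using AE_not_in[of N lborel] by (auto elim: eventually_mono)
qed

text \<open>Only finitely many arcs exceed a given size, so a point lying in infinitely many of them lies in
arbitrarily small ones; these fit into the interval and form a Vitali cover.\<close>

lemma vitali_arcs:
  fixes \<theta> \<delta> :: "nat \<Rightarrow> real"
  assumes \<alpha>: "\<alpha> < 1" and \<delta>: "\<And>n. n \<in> J \<Longrightarrow> 0 < \<delta> n"
    and fin: "\<And>e. 0 < e \<Longrightarrow> finite {n \<in> J. e \<le> \<delta> n}"
    and cov: "AE x in lborel. x \<in> {a<..<b} \<longrightarrow> infinite {n \<in> J. \<bar>\<theta> n - x\<bar> < \<delta> n powr (1 - \<alpha>)}"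
    and \<eta>: "0 < \<eta>"
  obtains C where "C \<subseteq> J"
    "\<And>n. n \<in> C \<Longrightarrow> ball (\<theta> n) (\<delta> n powr (1 - \<alpha>)) \<subseteq> {a<..<b}"
    "\<And>n. n \<in> C \<Longrightarrow> \<delta> n powr (1 - \<alpha>) + \<delta> n < \<eta>"
    "pairwise (\<lambda>i j. disjnt (ball (\<theta> i) (\<delta> i powr (1 - \<alpha>))) (ball (\<theta> j) (\<delta> j powr (1 - \<alpha>)))) C"
    "AE x in lborel. x \<in> {a<..<b} \<longrightarrow> (\<exists>n\<in>C. x \<in> ball (\<theta> n) (\<delta> n powr (1 - \<alpha>)))"
proof -
  define L where "L n = \<delta> n powr (1 - \<alpha>)" for n
  define K where "K = {n \<in> J. ball (\<theta> n) (L n) \<subseteq> {a<..<b} \<and> L n + \<delta> n < \<eta>}"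
  define S where "S = {x \<in> {a<..<b}. infinite {n \<in> J. \<bar>\<theta> n - x\<bar> < L n}}"
  have ex: "\<exists>n. n \<in> K \<and> x \<in> ball (\<theta> n) (L n) \<and> L n < d" if x: "x \<in> S" and d: "0 < d" for x d
  proof -
    obtain r where r: "r > 0" "ball x r \<subseteq> {a<..<b}"
    proof -
      have "x \<in> {a<..<b}" using x by (simp add: S_def)
      then show thesis using open_contains_ball[of "{a<..<b}"] open_greaterThanLessThan that by blast
    qed
    define m where "m = min d (min (r / 2) (\<eta> / 2))"
    have m: "m > 0" using d r \<eta> by (simp add: m_def)
    \<comment> \<open>\<open>\<delta> n < e\<close> forces \<open>\<delta> n powr (1 - \<alpha>) < m\<close>.\<close>
    define e where "e = min (m powr (1 / (1 - \<alpha>))) (\<eta> / 2)"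
    have e: "e > 0" using m \<eta> by (simp add: e_def)
    have "infinite ({n \<in> J. \<bar>\<theta> n - x\<bar> < L n} - {n \<in> J. e \<le> \<delta> n})"
      using x fin[OF e] by (intro Diff_infinite_finite) (auto simp: S_def)
    then have "{n \<in> J. \<bar>\<theta> n - x\<bar> < L n} - {n \<in> J. e \<le> \<delta> n} \<noteq> {}"
      by (rule infinite_imp_nonempty)
    then obtain n where "n \<in> {n \<in> J. \<bar>\<theta> n - x\<bar> < L n} - {n \<in> J. e \<le> \<delta> n}" by blast
    then have n: "n \<in> J" "\<bar>\<theta> n - x\<bar> < L n" "\<delta> n < e" by auto
    have "L n < (m powr (1 / (1 - \<alpha>))) powr (1 - \<alpha>)"
      unfolding L_def using n \<alpha> \<delta>[OF n(1)] by (intro powr_less_mono2) (auto simp: e_def)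
    also have "\<dots> = m" using \<alpha> m by (simp add: powr_powr)
    finally have Lm: "L n < m" .
    have "ball (\<theta> n) (L n) \<subseteq> ball x r"
    proof
      fix y assume "y \<in> ball (\<theta> n) (L n)"
      then have "\<bar>y - \<theta> n\<bar> < L n" by (simp add: dist_real_def abs_minus_commute)
      moreover have "2 * L n < r" using Lm by (simp add: m_def)
      ultimately show "y \<in> ball x r"
        using n(2) abs_triangle_ineq[of "y - \<theta> n" "\<theta> n - x"] by (simp add: dist_real_def abs_minus_commute)
    qed
    moreover have "L n + \<delta> n < \<eta>" using Lm n(3) by (simp add: m_def e_def)
    ultimately have "n \<in> K" using r(2) n(1) by (auto simp: K_def)
    moreover have "x \<in> ball (\<theta> n) (L n)" using n(2) by (simp add: dist_real_def)
    moreover have "L n < d" using Lm by (simp add: m_def)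
    ultimately show ?thesis by blast
  qed
  obtain C where C: "countable C" "C \<subseteq> K"
    "pairwise (\<lambda>i j. disjnt (ball (\<theta> i) (L i)) (ball (\<theta> j) (L j))) C"
    "negligible (S - (\<Union>i\<in>C. ball (\<theta> i) (L i)))"
    using Vitali_covering_theorem_balls[of S K \<theta> L, OF ex] by blast
  show thesis
  proof (rule that[of C])
    show "AE x in lborel. x \<in> {a<..<b} \<longrightarrow> (\<exists>n\<in>C. x \<in> ball (\<theta> n) (\<delta> n powr (1 - \<alpha>)))"
      using cov negligible_imp_AE_lborel[OF C(4)]
      by eventually_elim (auto simp: S_def L_def)
  qed (use C in \<open>auto simp: K_def L_def\<close>)
qed

text \<open>\<open>P\<close> is the Taylor polynomial of \<open>f\<close> of degree below \<open>N\<close>.  On each arc of a Vitali selection \<open>\<bar>P\<bar>\<^sup>2\<close> exceeds its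
value at the point to which the arc belongs by at most \<open>e\<close>, and there \<open>P\<close> agrees in modulus with \<open>f - P\<close>, to which
\<open>arcs_carleson\<close> applies.  The length restriction is that of \<open>one_minus_rcis_ge\<close>.\<close>

lemma arcs_interval_bound:
  fixes \<theta> \<rho> :: "nat \<Rightarrow> real"
  assumes \<alpha>: "0 < \<alpha>" "\<alpha> < 1" and f: "f holomorphic_on unit_disc"
    and \<rho>: "\<And>n. n \<in> J \<Longrightarrow> 0 \<le> \<rho> n \<and> \<rho> n < 1"
    and fin: "\<And>e. 0 < e \<Longrightarrow> finite {n \<in> J. e \<le> 1 - \<rho> n}"
    and zero: "\<And>n. n \<in> J \<Longrightarrow> f (rcis (\<rho> n) (\<theta> n)) = 0"
    and ab: "a < b" "b - a \<le> 2 * pi / 3"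
    and cov: "AE x in lborel. x \<in> {a<..<b} \<longrightarrow> infinite {n \<in> J. \<bar>\<theta> n - x\<bar> < (1 - \<rho> n) powr (1 - \<alpha>)}"
    and K: "\<And>n. (\<Sum>k<n. (cmod (if k < N then 0 else taylor_coeff f k))\<^sup>2 / ker_coeff (1 - \<alpha>) k) \<le> K"
  shows "(\<integral>\<^sup>+ x \<in> {a<..<b}. ennreal ((cmod (\<Sum>k<N. taylor_coeff f k * cis (real k * x)))\<^sup>2) \<partial>lborel)
    \<le> ennreal (2 * (K * arc_row_bound \<alpha>))"
proof (rule ennreal_le_epsilon)
  fix e0 :: real assume e0: "0 < e0"
  \<comment> \<open>The lengths of the disjoint arcs add up to at most \<open>b - a\<close>, so an error \<open>e\<close> on each costs at most \<open>e0\<close>.\<close>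
  define e where "e = e0 / (b - a)"
  have e: "0 < e" using e0 ab by (simp add: e_def)
  define P where "P z = (\<Sum>k<N. taylor_coeff f k * z ^ k)" for z
  define F where "F z = (cmod (P z))\<^sup>2" for z
  define L where "L n = (1 - \<rho> n) powr (1 - \<alpha>)" for n
  define l where "l n = rcis (\<rho> n) (\<theta> n)" for n
  have "continuous_on (cball 0 1) F" unfolding F_def P_def by (intro continuous_intros)
  then have "uniformly_continuous_on (cball 0 1) F" by (rule compact_uniformly_continuous) simp
  then obtain \<eta> where \<eta>: "0 < \<eta>"
    "\<And>z w. z \<in> cball 0 1 \<Longrightarrow> w \<in> cball 0 1 \<Longrightarrow> dist w z < \<eta> \<Longrightarrow> dist (F w) (F z) < e"
    unfolding uniformly_continuous_on_def using e by metis
  have \<rho>0: "0 < 1 - \<rho> n" if "n \<in> J" for n using \<rho>[OF that] by simp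
  obtain C where C: "C \<subseteq> J" "\<And>n. n \<in> C \<Longrightarrow> ball (\<theta> n) (L n) \<subseteq> {a<..<b}"
    "\<And>n. n \<in> C \<Longrightarrow> L n + (1 - \<rho> n) < \<eta>"
    "pairwise (\<lambda>i j. disjnt (ball (\<theta> i) (L i)) (ball (\<theta> j) (L j))) C"
    "AE x in lborel. x \<in> {a<..<b} \<longrightarrow> (\<exists>n\<in>C. x \<in> ball (\<theta> n) (L n))"
    unfolding L_def
  proof (rule vitali_arcs[of \<alpha> J "\<lambda>n. 1 - \<rho> n" a b \<theta> \<eta>])
    fix C
    assume "C \<subseteq> J" "\<And>n. n \<in> C \<Longrightarrow> ball (\<theta> n) ((1 - \<rho> n) powr (1 - \<alpha>)) \<subseteq> {a<..<b}"
      "\<And>n. n \<in> C \<Longrightarrow> (1 - \<rho> n) powr (1 - \<alpha>) + (1 - \<rho> n) < \<eta>"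
      "pairwise (\<lambda>i j. disjnt (ball (\<theta> i) ((1 - \<rho> i) powr (1 - \<alpha>))) (ball (\<theta> j) ((1 - \<rho> j) powr (1 - \<alpha>)))) C"
      "AE x in lborel. x \<in> {a<..<b} \<longrightarrow> (\<exists>n\<in>C. x \<in> ball (\<theta> n) ((1 - \<rho> n) powr (1 - \<alpha>)))"
    then show thesis by (rule that[unfolded L_def])
  next
    show "0 < 1 - \<rho> n" if "n \<in> J" for n using \<rho>0[OF that] .
    show "finite {n \<in> J. e \<le> 1 - \<rho> n}" if "0 < e" for e using fin[OF that] .
  qed (use \<alpha>(2) cov \<eta>(1) in simp_all)
  define B where "B n = (if n \<in> C then ball (\<theta> n) (L n) else {})" for n
  have [measurable]: "B n \<in> sets borel" for n by (simp add: B_def)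
  have L0: "0 < L n" if "n \<in> C" for n
  proof -
    have "n \<in> J" using C(1) that by blast
    then show ?thesis using \<rho>0[of n] by (simp add: L_def)
  qed
  have dj: "disjoint_family_on B UNIV"
    using C(4) by (auto simp: disjoint_family_on_def B_def pairwise_def disjnt_def)
  have [measurable]: "(\<lambda>x. F (cis x)) \<in> borel_measurable borel"
    unfolding F_def P_def by (intro borel_measurable_continuous_onI continuous_intros)
  have near: "F (cis x) \<le> F (l n) + e" if n: "n \<in> C" and x: "x \<in> ball (\<theta> n) (L n)" for n x
  proof -
    have r: "0 \<le> \<rho> n" "\<rho> n < 1" using \<rho> C(1) n by auto
    have eq: "cis x - l n = (cis x - cis (\<theta> n)) + of_real (1 - \<rho> n) * cis (\<theta> n)"
      by (simp add: l_def rcis_def algebra_simps)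
    have "cmod (cis x - l n) \<le> cmod (cis x - cis (\<theta> n)) + (1 - \<rho> n)"
      unfolding eq
      using norm_triangle_ineq[of "cis x - cis (\<theta> n)" "of_real (1 - \<rho> n) * cis (\<theta> n)"] r
      by (simp add: norm_mult del: of_real_diff)
    moreover have "cmod (cis x - cis (\<theta> n)) \<le> \<bar>x - \<theta> n\<bar>"
    proof -
      have "cis x - cis (\<theta> n) = cis (\<theta> n) * (cis (x - \<theta> n) - 1)"
        by (simp add: right_diff_distrib cis_mult)
      then have "cmod (cis x - cis (\<theta> n)) = cmod (cis (x - \<theta> n) - 1)" by (simp add: norm_mult)
      also have "\<dots> = 2 * \<bar>sin ((x - \<theta> n) / 2)\<bar>"
        using dist_exp_i_1[of "x - \<theta> n"] by (simp add: cis_conv_exp)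
      also have "\<dots> \<le> 2 * \<bar>(x - \<theta> n) / 2\<bar>" using abs_sin_x_le_abs_x[of "(x - \<theta> n) / 2"] by linarith
      finally show ?thesis by simp
    qed
    moreover have "\<bar>x - \<theta> n\<bar> < L n" using x by (simp add: dist_real_def abs_minus_commute)
    ultimately have "dist (cis x) (l n) < \<eta>" using C(3)[OF n] by (simp add: dist_norm)
    then have "dist (F (cis x)) (F (l n)) < e" using r by (intro \<eta>(2)) (auto simp: l_def)
    then show ?thesis by (simp add: dist_real_def abs_less_iff)
  qed
  have gz: "(\<lambda>k. (if k < N then 0 else taylor_coeff f k) * z ^ k) sums (f z - P z)" if "cmod z < 1" for z
  proof -
    have "(\<lambda>k. if k \<in> {..<N} then taylor_coeff f k * z ^ k else 0) sums P z"
      unfolding P_def by (rule sums_If_finite_set) simp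
    from sums_diff[OF taylor_coeff_sums[OF f that] this] show ?thesis
      by (rule back_subst[of "\<lambda>h. h sums _"]) auto
  qed
  have fin_sum: "(\<Sum>n\<in>D. (F (l n) + e) * (2 * L n)) \<le> 2 * (K * arc_row_bound \<alpha>) + e0"
    if D: "finite D" "D \<subseteq> C" for D
  proof -
    have th: "\<theta> n \<in> {a<..<b}" if "n \<in> D" for n
      using C(2)[of n] L0[of n] that D centre_in_ball[of "\<theta> n" "L n"] by blast
    have "(\<Sum>i\<in>D. (1 - \<rho> i) powr (1 - \<alpha>) * (cmod (f (rcis (1 - (1 - \<rho> i)) (\<theta> i)) - P (rcis (1 - (1 - \<rho> i)) (\<theta> i))))\<^sup>2)
      \<le> K * arc_row_bound \<alpha>"
    proof (rule arcs_carleson[OF \<alpha> D(1) _ _ _ gz K])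
      show "0 < 1 - \<rho> j \<and> 1 - \<rho> j \<le> 1" if "j \<in> D" for j using \<rho>[of j] that D C(1) by auto
      show "pairwise (\<lambda>i j. disjnt (ball (\<theta> i) ((1 - \<rho> i) powr (1 - \<alpha>))) (ball (\<theta> j) ((1 - \<rho> j) powr (1 - \<alpha>)))) D"
        using pairwise_subset[OF C(4) D(2)] by (simp add: L_def)
      show "\<bar>\<theta> i - \<theta> j\<bar> \<le> 2 * pi / 3" if "i \<in> D" "j \<in> D" for i j
        using th[OF that(1)] th[OF that(2)] ab(2) unfolding greaterThanLessThan_iff abs_le_iff by linarith
    qed
    moreover have "(\<Sum>i\<in>D. (1 - \<rho> i) powr (1 - \<alpha>) * (cmod (f (rcis (1 - (1 - \<rho> i)) (\<theta> i)) - P (rcis (1 - (1 - \<rho> i)) (\<theta> i))))\<^sup>2)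
       = (\<Sum>n\<in>D. L n * F (l n))"
      using zero C(1) D by (intro sum.cong refl) (auto simp: L_def F_def l_def norm_minus_commute)
    ultimately have 1: "(\<Sum>n\<in>D. L n * F (l n)) \<le> K * arc_row_bound \<alpha>" by simp
    have "ennreal (\<Sum>n\<in>D. 2 * L n) = (\<Sum>n\<in>D. emeasure lborel (B n))"
    proof -
      have "(\<Sum>n\<in>D. emeasure lborel (B n)) = (\<Sum>n\<in>D. ennreal (2 * L n))"
        using D L0 by (intro sum.cong refl) (auto simp: B_def ball_eq_greaterThanLessThan subset_iff less_imp_le)
      also have "\<dots> = ennreal (\<Sum>n\<in>D. 2 * L n)" by (rule sum_ennreal) (simp add: L_def)
      finally show ?thesis by simp
    qed
    also have "\<dots> = emeasure lborel (\<Union>n\<in>D. B n)"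
      by (intro sum_emeasure D) (auto intro: disjoint_family_on_mono[OF _ dj])
    also have "\<dots> \<le> emeasure lborel {a<..<b}"
      using C(2) by (intro emeasure_mono) (auto simp: B_def split: if_splits)
    also have "\<dots> = ennreal (b - a)" using ab by simp
    finally have 2: "(\<Sum>n\<in>D. 2 * L n) \<le> b - a" using ab by (simp add: ennreal_le_iff)
    have "(\<Sum>n\<in>D. (F (l n) + e) * (2 * L n)) = 2 * (\<Sum>n\<in>D. L n * F (l n)) + e * (\<Sum>n\<in>D. 2 * L n)"
      by (simp add: sum_distrib_left sum.distrib[symmetric] algebra_simps)
    also have "\<dots> \<le> 2 * (K * arc_row_bound \<alpha>) + e * (b - a)"
      using 1 mult_left_mono[OF 2, of e] e by linarith
    also have "e * (b - a) = e0" using ab by (simp add: e_def)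
    finally show ?thesis .
  qed
  have F0: "0 \<le> F z" for z by (simp add: F_def)
  have "(\<integral>\<^sup>+ x \<in> {a<..<b}. ennreal (F (cis x)) \<partial>lborel)
     \<le> (\<integral>\<^sup>+ x. (\<Sum>n. ennreal (F (cis x)) * indicator (B n) x) \<partial>lborel)"
  proof (rule nn_integral_mono_AE, use C(5) in eventually_elim)
    case (elim x)
    show ?case
    proof (cases "x \<in> {a<..<b}")
      case True
      then obtain n where n: "n \<in> C" "x \<in> ball (\<theta> n) (L n)" using elim by blast
      have "ennreal (F (cis x)) * indicator {a<..<b} x = (\<Sum>i\<in>{n}. ennreal (F (cis x)) * indicator (B i) x)"
        using n True by (simp add: B_def)
      also have "\<dots> \<le> (\<Sum>i. ennreal (F (cis x)) * indicator (B i) x)" by (intro sum_le_suminf) auto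
      finally show ?thesis .
    qed simp
  qed
  also have "\<dots> = (\<Sum>n. \<integral>\<^sup>+ x \<in> B n. ennreal (F (cis x)) \<partial>lborel)"
    by (rule nn_integral_suminf) simp
  also have "\<dots> \<le> ennreal (2 * (K * arc_row_bound \<alpha>) + e0)"
  proof (rule suminf_le_const)
    fix m
    define D where "D = C \<inter> {..<m}"
    have "(\<Sum>n<m. \<integral>\<^sup>+ x \<in> B n. ennreal (F (cis x)) \<partial>lborel) = (\<Sum>n\<in>D. \<integral>\<^sup>+ x \<in> B n. ennreal (F (cis x)) \<partial>lborel)"
      by (intro sum.mono_neutral_right) (auto simp: D_def B_def)
    also have "\<dots> \<le> (\<Sum>n\<in>D. ennreal ((F (l n) + e) * (2 * L n)))"
    proof (rule sum_mono)
      fix n assume "n \<in> D"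
      then have n: "n \<in> C" by (simp add: D_def)
      have "(\<integral>\<^sup>+ x \<in> B n. ennreal (F (cis x)) \<partial>lborel) \<le> (\<integral>\<^sup>+ x. ennreal (F (l n) + e) * indicator (B n) x \<partial>lborel)"
        using near[OF n] n by (intro nn_integral_mono) (auto simp: B_def indicator_def intro!: ennreal_leI)
      also have "\<dots> = ennreal (F (l n) + e) * emeasure lborel (B n)"
        by (rule nn_integral_cmult_indicator) simp
      also have "emeasure lborel (B n) = ennreal (2 * L n)"
        using n L0[OF n] by (simp add: B_def ball_eq_greaterThanLessThan)
      also have "ennreal (F (l n) + e) * ennreal (2 * L n) = ennreal ((F (l n) + e) * (2 * L n))"
        using F0 e L0[OF n] by (intro ennreal_mult[symmetric]) auto
      finally show "(\<integral>\<^sup>+ x \<in> B n. ennreal (F (cis x)) \<partial>lborel) \<le> ennreal ((F (l n) + e) * (2 * L n))" .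
    qed
    also have "\<dots> = ennreal (\<Sum>n\<in>D. (F (l n) + e) * (2 * L n))"
      using F0 e by (intro sum_ennreal mult_nonneg_nonneg add_nonneg_nonneg) (auto simp: L_def)
    also have "\<dots> \<le> ennreal (2 * (K * arc_row_bound \<alpha>) + e0)"
      by (intro ennreal_leI fin_sum) (auto simp: D_def)
    finally show "(\<Sum>n<m. \<integral>\<^sup>+ x \<in> B n. ennreal (F (cis x)) \<partial>lborel) \<le> ennreal (2 * (K * arc_row_bound \<alpha>) + e0)" .
  qed simp
  also have "\<dots> = ennreal (2 * (K * arc_row_bound \<alpha>)) + ennreal e0"
    using K[of 0] arc_row_bound_nonneg[OF \<alpha>(1)] e0 by (intro ennreal_plus) auto
  finally show "(\<integral>\<^sup>+ x \<in> {a<..<b}. ennreal ((cmod (\<Sum>k<N. taylor_coeff f k * cis (real k * x)))\<^sup>2) \<partial>lborel)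
    \<le> ennreal (2 * (K * arc_row_bound \<alpha>)) + ennreal e0"
    by (simp add: F_def P_def Complex.DeMoivre)
qed

text \<open>Three intervals of length \<open>2 * pi / 3\<close> make up the circle, so \<open>arcs_interval_bound\<close> bounds the sum of the
first \<open>N\<close> squared coefficients by a multiple of the tail \<open>T N\<close> of a convergent series.\<close>

lemma dirichlet_vanishes_if_arcs_cover:
  fixes \<theta> \<rho> :: "nat \<Rightarrow> real"
  assumes \<alpha>: "0 < \<alpha>" "\<alpha> < 1" and f: "f \<in> dirichlet_space \<alpha>"
    and \<rho>: "\<And>n. n \<in> J \<Longrightarrow> 0 \<le> \<rho> n \<and> \<rho> n < 1"
    and fin: "\<And>e. 0 < e \<Longrightarrow> finite {n \<in> J. e \<le> 1 - \<rho> n}"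
    and zero: "\<And>n. n \<in> J \<Longrightarrow> f (rcis (\<rho> n) (\<theta> n)) = 0"
    and cov: "AE x in lborel. x \<in> {0<..<2*pi} \<longrightarrow> infinite {n \<in> J. \<bar>\<theta> n - x\<bar> < (1 - \<rho> n) powr (1 - \<alpha>)}"
    and z: "cmod z < 1"
  shows "f z = 0"
proof -
  have hol: "f holomorphic_on unit_disc" using f by (simp add: dirichlet_space_def)
  obtain K0 where K0: "dirichlet_norm_sq \<alpha> f \<le> ennreal K0" "K0 \<ge> 0"
    using f by (cases "dirichlet_norm_sq \<alpha> f" rule: ennreal_cases) (auto simp: dirichlet_space_def)
  define E where "E k = (cmod (taylor_coeff f k))\<^sup>2 / ker_coeff (1 - \<alpha>) k" for k
  have kp: "0 < ker_coeff (1 - \<alpha>) k" for k using \<alpha> by (intro ker_coeff_pos) simp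
  have E0: "0 \<le> E k" for k using kp[of k] by (simp add: E_def)
  have "(\<Sum>k<n. E k) \<le> 2 / (1 - \<alpha>) * K0" for n
  proof -
    have "(\<Sum>k<n. E k) = (\<Sum>k<n. 1 / ker_coeff (1 - \<alpha>) k * (cmod (taylor_coeff f k))\<^sup>2)"
      by (simp add: E_def)
    also have "\<dots> \<le> (\<Sum>k<n. 2 / (1 - \<alpha>) * dir_weight \<alpha> k * (cmod (taylor_coeff f k))\<^sup>2)"
      using \<alpha> by (intro sum_mono mult_right_mono dir_weight_ge) auto
    also have "\<dots> = 2 / (1 - \<alpha>) * (\<Sum>k<n. dir_weight \<alpha> k * (cmod (taylor_coeff f k))\<^sup>2)"
      by (simp add: sum_distrib_left mult.assoc)
    also have "\<dots> \<le> 2 / (1 - \<alpha>) * K0"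
      using \<alpha> by (intro mult_left_mono sum_dir_weight_le[OF hol _ K0]) auto
    finally show ?thesis .
  qed
  then have sE: "summable E" by (rule summableI_nonneg_bounded[OF E0])
  define T where "T N = suminf E - (\<Sum>k<N. E k)" for N
  have T: "(\<Sum>k<n. (cmod (if k < N then 0 else taylor_coeff f k))\<^sup>2 / ker_coeff (1 - \<alpha>) k) \<le> T N" for n N
  proof -
    have "(\<Sum>k<n. (cmod (if k < N then 0 else taylor_coeff f k))\<^sup>2 / ker_coeff (1 - \<alpha>) k) = (\<Sum>k\<in>{..<n} - {..<N}. E k)"
      by (rule sum.mono_neutral_cong_right) (auto simp: E_def)
    also have "\<dots> + (\<Sum>k<N. E k) = (\<Sum>k\<in>({..<n} - {..<N}) \<union> {..<N}. E k)"
      by (subst sum.union_disjoint) auto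
    also have "\<dots> \<le> suminf E" by (intro sum_le_suminf sE) (auto simp: E0)
    finally show ?thesis by (simp add: T_def)
  qed
  have bound: "2 * pi * (\<Sum>k<N. (cmod (taylor_coeff f k))\<^sup>2) \<le> 6 * (T N * arc_row_bound \<alpha>)" for N
  proof -
    let ?P = "\<lambda>x. ennreal ((cmod (\<Sum>k<N. taylor_coeff f k * cis (real k * x)))\<^sup>2)"
    have [measurable]: "(\<lambda>x. (cmod (\<Sum>k<N. taylor_coeff f k * cis (real k * x)))\<^sup>2) \<in> borel_measurable borel"
      by (intro borel_measurable_continuous_onI continuous_intros)
    let ?I = "\<lambda>m::nat. {2 * pi / 3 * real m<..<2 * pi / 3 * real (Suc m)}"
    have "ennreal (2 * pi * (\<Sum>k<N. (cmod (taylor_coeff f k))\<^sup>2)) = (\<integral>\<^sup>+ x \<in> {0..2*pi}. ?P x \<partial>lborel)"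
      by (rule nn_integral_has_integral_lebesgue'[symmetric, OF _ has_integral_norm_sq_trig_poly]) simp
    also have "\<dots> \<le> (\<integral>\<^sup>+ x. (\<Sum>m<3. ?P x * indicator (?I m) x) \<partial>lborel)"
    proof (rule nn_integral_mono_AE)
      \<comment> \<open>The open intervals miss only their end points.\<close>
      have "AE x in lborel. x \<notin> (\<lambda>m. 2 * pi / 3 * real m) ` {..3}"
        by (intro AE_not_in finite_imp_null_set_lborel) simp
      then show "AE x in lborel. ?P x * indicator {0..2*pi} x \<le> (\<Sum>m<3. ?P x * indicator (?I m) x)"
      proof eventually_elim
        case (elim x)
        show ?case
        proof (cases "x \<in> {0..2*pi}")
          case True
          have ne: "x \<noteq> 2 * pi / 3 * real m" if "m \<le> 3" for m using elim that by auto
          have "x \<noteq> 0" "x \<noteq> 2 * pi / 3" "x \<noteq> 4 * pi / 3" "x \<noteq> 2 * pi"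
            using ne[of 0] ne[of 1] ne[of 2] ne[of 3] by auto
          then have "\<exists>m<3. x \<in> ?I m"
            using True by (cases "x < 2 * pi / 3"; cases "x < 4 * pi / 3")
              (auto simp: numeral_3_eq_3 less_Suc_eq)
          then obtain m where m: "m < 3" "x \<in> ?I m" by blast
          have "?P x * indicator {0..2*pi} x = ?P x * indicator (?I m) x" using True m by simp
          also have "\<dots> \<le> (\<Sum>m<3. ?P x * indicator (?I m) x)"
            using m by (intro member_le_sum) auto
          finally show ?thesis .
        qed simp
      qed
    qed
    also have "\<dots> = (\<Sum>m<3. \<integral>\<^sup>+ x \<in> ?I m. ?P x \<partial>lborel)"
      by (rule nn_integral_sum) simp
    also have "\<dots> \<le> (\<Sum>m<(3::nat). ennreal (2 * (T N * arc_row_bound \<alpha>)))"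
    proof (rule sum_mono)
      fix m :: nat assume m: "m \<in> {..<3}"
      have "?I m \<subseteq> {0<..<2*pi}"
      proof
        fix x assume x: "x \<in> ?I m"
        have "2 * pi / 3 * real (Suc m) \<le> 2 * pi / 3 * 3" using m by (intro mult_left_mono) auto
        moreover have "0 \<le> 2 * pi / 3 * real m" by simp
        ultimately show "x \<in> {0<..<2*pi}"
          using x unfolding greaterThanLessThan_iff by linarith
      qed
      then have "AE x in lborel. x \<in> ?I m \<longrightarrow> infinite {n \<in> J. \<bar>\<theta> n - x\<bar> < (1 - \<rho> n) powr (1 - \<alpha>)}"
        using cov by (auto elim!: eventually_mono)
      then show "(\<integral>\<^sup>+ x \<in> ?I m. ?P x \<partial>lborel) \<le> ennreal (2 * (T N * arc_row_bound \<alpha>))"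
        by (intro arcs_interval_bound[OF \<alpha> hol \<rho> fin zero _ _ _ T]) (auto simp: algebra_simps)
    qed
    also have "\<dots> = ennreal (\<Sum>m<(3::nat). 2 * (T N * arc_row_bound \<alpha>))"
      using T[of N 0] arc_row_bound_nonneg[OF \<alpha>(1)] by (intro sum_ennreal) auto
    also have "(\<Sum>m<(3::nat). 2 * (T N * arc_row_bound \<alpha>)) = 6 * (T N * arc_row_bound \<alpha>)" by simp
    finally show ?thesis
      using T[of N 0] arc_row_bound_nonneg[OF \<alpha>(1)] by (subst (asm) ennreal_le_iff) auto
  qed
  have T0: "(\<lambda>N. 6 * (T N * arc_row_bound \<alpha>)) \<longlonglongrightarrow> 6 * ((suminf E - suminf E) * arc_row_bound \<alpha>)"
    unfolding T_def using summable_LIMSEQ[OF sE] by (intro tendsto_intros)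
  have "taylor_coeff f k = 0" for k
  proof -
    have "\<forall>N\<ge>Suc k. 2 * pi * (cmod (taylor_coeff f k))\<^sup>2 \<le> 6 * (T N * arc_row_bound \<alpha>)"
    proof (intro allI impI)
      fix N assume "Suc k \<le> N"
      then have "(cmod (taylor_coeff f k))\<^sup>2 \<le> (\<Sum>k<N. (cmod (taylor_coeff f k))\<^sup>2)"
        by (intro member_le_sum) auto
      then show "2 * pi * (cmod (taylor_coeff f k))\<^sup>2 \<le> 6 * (T N * arc_row_bound \<alpha>)"
        using bound[of N] by (meson mult_left_mono order.trans pi_ge_zero mult_nonneg_nonneg zero_le_numeral)
    qed
    then have "2 * pi * (cmod (taylor_coeff f k))\<^sup>2 \<le> 6 * ((suminf E - suminf E) * arc_row_bound \<alpha>)"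
      by (intro LIMSEQ_le_const[OF T0]) blast
    then show ?thesis using pi_gt_zero by (simp add: mult_le_0_iff not_le[symmetric])
  qed
  then show ?thesis using taylor_coeff_sums[OF hol z] by (simp add: sums_iff)
qed

section \<open>Measurability of the zero-set event\<close>

lemma reciprocal_in_disc: "complex_of_real (inverse (real (Suc (Suc m)))) \<in> unit_disc"
proof -
  have "inverse (real (Suc (Suc m))) < 1" unfolding inverse_less_1_iff by simp
  then show ?thesis unfolding mem_ball_0 norm_of_real by simp
qed

lemma nonzero_at_reciprocal:
  assumes f: "f holomorphic_on unit_disc" and z: "z \<in> unit_disc" "f z \<noteq> 0"
  shows "\<exists>m. f (of_real (inverse (real (Suc (Suc m))))) \<noteq> 0"
proof (rule ccontr)
  assume *: "\<not> ?thesis"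
  define u where "u m = complex_of_real (inverse (real (Suc (Suc m))))" for m
  have lim: "u \<longlonglongrightarrow> 0"
  proof -
    have "(\<lambda>m. inverse (real (Suc (Suc m)))) \<longlonglongrightarrow> 0"
      using LIMSEQ_inverse_real_of_nat LIMSEQ_Suc by blast
    then have "u \<longlonglongrightarrow> complex_of_real 0" unfolding u_def by (rule tendsto_of_real)
    then show ?thesis by simp
  qed
  have islim: "0 islimpt range u"
    unfolding islimpt_sequential
    by (rule exI[of _ u]) (use lim in \<open>auto simp: u_def simp del: of_nat_Suc\<close>)
  have sub: "range u \<subseteq> unit_disc"
    using reciprocal_in_disc by (auto simp only: u_def)
  have "f z = 0"
    by (rule analytic_continuation[OF f _ _ sub _ islim]) (use * z in \<open>auto simp: u_def\<close>)
  with z show False by simp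
qed

text \<open>The angles for which some function of norm at most \<open>sqrt K\<close> vanishes at all points and is at least
\<open>1 / (K + 1)\<close> in modulus at \<open>1 / (m + 2)\<close>.  Quantitative conditions make the set closed, and one of the
countably many test points works because they accumulate at \<open>0\<close>.\<close>

definition zero_angles :: "real \<Rightarrow> (nat \<Rightarrow> real) \<Rightarrow> nat \<Rightarrow> nat \<Rightarrow> (nat \<Rightarrow> real) set" where
  "zero_angles \<alpha> \<rho> m K = {t. \<exists>f. f holomorphic_on unit_disc \<and> dirichlet_norm_sq \<alpha> f \<le> ennreal (real K) \<and>
     inverse (real (Suc K)) \<le> cmod (f (of_real (inverse (real (Suc (Suc m)))))) \<and>
     (\<forall>n. f (rcis (\<rho> n) (t n)) = 0)}"

lemma is_zero_set_iff_zero_angles: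
  assumes \<rho>: "\<And>n. 0 \<le> \<rho> n \<and> \<rho> n < 1"
  shows "is_zero_set \<alpha> (random_points \<rho> \<theta> \<omega>) \<longleftrightarrow> (\<lambda>n. \<theta> n \<omega>) \<in> (\<Union>m K. zero_angles \<alpha> \<rho> m K)"
proof
  assume "is_zero_set \<alpha> (random_points \<rho> \<theta> \<omega>)"
  then obtain f z where f: "f \<in> dirichlet_space \<alpha>" "z \<in> unit_disc" "f z \<noteq> 0"
    "\<forall>n. f (rcis (\<rho> n) (\<theta> n \<omega>)) = 0"
    by (auto simp: is_zero_set_def random_points_def)
  have hol: "f holomorphic_on unit_disc" using f by (simp add: dirichlet_space_def)
  obtain m where m: "f (of_real (inverse (real (Suc (Suc m))))) \<noteq> 0"
    using nonzero_at_reciprocal[OF hol f(2,3)] by blast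
  obtain K1 where K1: "dirichlet_norm_sq \<alpha> f = ennreal K1"
    using f by (cases "dirichlet_norm_sq \<alpha> f" rule: ennreal_cases) (auto simp: dirichlet_space_def)
  let ?v = "cmod (f (of_real (inverse (real (Suc (Suc m))))))"
  obtain K :: nat where K: "max K1 (inverse ?v) \<le> real K" using real_arch_simple by blast
  have "dirichlet_norm_sq \<alpha> f \<le> ennreal (real K)" unfolding K1 using K by (intro ennreal_leI) simp
  moreover have "inverse (real (Suc K)) \<le> ?v"
  proof -
    have "inverse ?v \<le> real (Suc K)" using K by simp
    then have "inverse (real (Suc K)) \<le> inverse (inverse ?v)" using m by (intro le_imp_inverse_le) auto
    then show ?thesis by simp
  qed
  ultimately show "(\<lambda>n. \<theta> n \<omega>) \<in> (\<Union>m K. zero_angles \<alpha> \<rho> m K)"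
    unfolding zero_angles_def using hol f(4) by blast
next
  assume "(\<lambda>n. \<theta> n \<omega>) \<in> (\<Union>m K. zero_angles \<alpha> \<rho> m K)"
  then obtain m K f where f: "f holomorphic_on unit_disc" "dirichlet_norm_sq \<alpha> f \<le> ennreal (real K)"
     "inverse (real (Suc K)) \<le> cmod (f (of_real (inverse (real (Suc (Suc m))))))"
     "\<forall>n. f (rcis (\<rho> n) (\<theta> n \<omega>)) = 0"
    unfolding zero_angles_def by blast
  have "cmod (f (of_real (inverse (real (Suc (Suc m)))))) > 0"
    using f(3) by (rule less_le_trans[rotated]) simp
  moreover have "of_real (inverse (real (Suc (Suc m)))) \<in> unit_disc"
    by (rule reciprocal_in_disc)
  moreover have "f \<in> dirichlet_space \<alpha>"
    using f(1,2) by (auto simp: dirichlet_space_def intro: le_less_trans)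
  ultimately show "is_zero_set \<alpha> (random_points \<rho> \<theta> \<omega>)"
    unfolding is_zero_set_def random_points_def using f(4) \<rho>
    by (auto intro!: bexI[of _ f] bexI[of _ "of_real (inverse (real (Suc (Suc m))))"] simp del: of_real_inverse)
qed

lemma closed_zero_angles:
  assumes \<alpha>: "0 \<le> \<alpha>" "\<alpha> < 1" and \<rho>: "\<And>n. 0 \<le> \<rho> n \<and> \<rho> n < 1"
  shows "closed (zero_angles \<alpha> \<rho> m K)"
  unfolding closed_sequential_limits
proof (intro allI impI, elim conjE)
  fix x l assume x: "\<forall>n. x n \<in> zero_angles \<alpha> \<rho> m K" and lim: "x \<longlonglongrightarrow> l"
  let ?w = "complex_of_real (inverse (real (Suc (Suc m))))"
  have "\<forall>n. \<exists>f. f holomorphic_on unit_disc \<and> dirichlet_norm_sq \<alpha> f \<le> ennreal (real K) \<and>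
     inverse (real (Suc K)) \<le> cmod (f ?w) \<and> (\<forall>i. f (rcis (\<rho> i) (x n i)) = 0)"
    using x by (simp add: zero_angles_def)
  then obtain f where f: "\<And>n. f n holomorphic_on unit_disc" "\<And>n. dirichlet_norm_sq \<alpha> (f n) \<le> ennreal (real K)"
     "\<And>n. inverse (real (Suc K)) \<le> cmod (f n ?w)" "\<And>n i. f n (rcis (\<rho> i) (x n i)) = 0"
    by metis
  have coord: "(\<lambda>n. x n i) \<longlonglongrightarrow> l i" for i
  proof -
    have "continuous_on UNIV (\<lambda>t::nat \<Rightarrow> real. t i)"
      by (rule continuous_on_product_coordinates)
    then have "isCont (\<lambda>t::nat \<Rightarrow> real. t i) l"
      unfolding continuous_on_eq_continuous_at[OF open_UNIV] by blast
    from isCont_tendsto_compose[OF this lim] show ?thesis .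
  qed
  have w: "?w \<in> unit_disc" by (rule reciprocal_in_disc)
  obtain g where "g holomorphic_on unit_disc" "dirichlet_norm_sq \<alpha> g \<le> ennreal (real K)"
    "inverse (real (Suc K)) \<le> cmod (g ?w)" "\<And>i. g (rcis (\<rho> i) (l i)) = 0"
  proof (rule dirichlet_zero_limit[of \<alpha> "real K" f ?w "inverse (real (Suc K))"
        "\<lambda>n i. rcis (\<rho> i) (x n i)" "\<lambda>i. rcis (\<rho> i) (l i)"])
    show "(\<lambda>n. rcis (\<rho> i) (x n i)) \<longlonglongrightarrow> rcis (\<rho> i) (l i)" for i
      unfolding rcis_def by (intro tendsto_intros coord)
    show "rcis (\<rho> i) (l i) \<in> unit_disc" for i using \<rho>[of i] by simp
    show "\<forall>\<^sub>F n in sequentially. f n (rcis (\<rho> i) (x n i)) = 0" for i by (simp add: f(4))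
    show "f n holomorphic_on unit_disc" "dirichlet_norm_sq \<alpha> (f n) \<le> ennreal (real K)"
      "inverse (real (Suc K)) \<le> cmod (f n ?w)" for n
      by (rule f)+
  next
    fix g assume "g holomorphic_on unit_disc" "dirichlet_norm_sq \<alpha> g \<le> ennreal (real K)"
      "inverse (real (Suc K)) \<le> cmod (g ?w)" "\<And>i. g (rcis (\<rho> i) (l i)) = 0"
    then show thesis by (rule that)
  qed (rule \<alpha> w of_nat_0_le_iff)+
  then show "l \<in> zero_angles \<alpha> \<rho> m K" unfolding zero_angles_def by blast
qed

text \<open>The product \<open>\<sigma>\<close>-algebra on sequences of reals is the Borel \<open>\<sigma>\<close>-algebra of the product topology, in which
each \<open>zero_angles \<alpha> \<rho> m K\<close> is closed by the compactness lemma.\<close>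

lemma sets_zero_set_event:
  assumes \<alpha>: "0 \<le> \<alpha>" "\<alpha> < 1" and \<rho>: "\<And>n. 0 \<le> \<rho> n \<and> \<rho> n < 1"
    and \<theta>: "\<And>n. \<theta> n \<in> borel_measurable M"
  shows "{\<omega> \<in> space M. is_zero_set \<alpha> (random_points \<rho> \<theta> \<omega>)} \<in> sets M"
proof -
  have "(\<lambda>\<omega> n. \<theta> n \<omega>) \<in> measurable M (PiM UNIV (\<lambda>_. borel))"
    by (rule measurable_PiM_single') (use \<theta> in \<open>auto simp: space_PiM\<close>)
  then have m: "(\<lambda>\<omega> n. \<theta> n \<omega>) \<in> measurable M borel"
    using measurable_cong_sets[OF refl sets_PiM_equal_borel] by blast
  have "(\<Union>m K. zero_angles \<alpha> \<rho> m K) \<in> sets borel"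
  proof (rule sets.countable_UN, safe)
    show "(\<Union>K. zero_angles \<alpha> \<rho> m K) \<in> sets borel" for m
      by (rule sets.countable_UN) (auto intro!: borel_closed closed_zero_angles \<alpha> \<rho>)
  qed
  from measurable_sets[OF m this] show ?thesis
    unfolding is_zero_set_iff_zero_angles[OF \<rho>] by (simp add: vimage_def Int_def conj_commute)
qed

section \<open>Weighted counts and sums over radii\<close>

text \<open>A sum over points rather than indices, like the weighted count.\<close>

definition boundary_sum :: "real \<Rightarrow> complex set \<Rightarrow> ennreal" where
  "boundary_sum \<alpha> L = (\<integral>\<^sup>+ z \<in> L. ennreal ((1 - cmod z) powr (1 - \<alpha>)) \<partial>count_space UNIV)"

lemma weighted_count_sum_eq_nn_integral:
  "weighted_count_sum \<alpha> L = (\<integral>\<^sup>+ z. (\<Sum>n. ennreal (2 powr (- (1 - \<alpha>) * real n)) *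
     indicator {z \<in> L. 1 - 1 / 2 ^ n \<le> cmod z \<and> cmod z < 1 - 1 / 2 ^ (n + 1)} z) \<partial>count_space UNIV)"
  unfolding weighted_count_sum_def annulus_count_def
  by (subst nn_integral_suminf) (auto intro!: suminf_cong simp: nn_integral_cmult)

lemma dyadic_annulus:
  assumes "0 \<le> r" "r < (1::real)"
  shows "\<exists>!n. 1 - 1 / 2 ^ n \<le> r \<and> r < 1 - 1 / 2 ^ (n + 1)"
proof -
  let ?P = "\<lambda>n. r < 1 - 1 / 2 ^ (n + 1)"
  obtain k where "(1/2::real) ^ k < 1 - r" using real_arch_pow_inv[of "1 - r" "1/2"] assms by auto
  moreover have "(1/2::real) ^ (k + 1) \<le> (1/2) ^ k" by simp
  ultimately have ex: "?P k" by (simp add: power_one_over)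
  define n where "n = (LEAST n. ?P n)"
  have n: "?P n" unfolding n_def by (rule LeastI[of ?P, OF ex])
  have lower: "1 - 1 / 2 ^ n \<le> r"
  proof (cases n)
    case (Suc j)
    then have "j < n" by simp
    then have "\<not> ?P j" unfolding n_def by (rule not_less_Least)
    then show ?thesis by (simp add: Suc)
  qed (use assms in simp)
  have mono: "1 - 1 / 2 ^ i \<le> (1 - 1 / 2 ^ j :: real)" if "i \<le> j" for i j :: nat
    using power_increasing[OF that, of "2::real"] by (simp add: frac_le)
  have uniq: "k = n" if "1 - 1 / 2 ^ k \<le> r" "?P k" for k
    using mono[of "k + 1" n] mono[of "n + 1" k] that n lower by (cases k n rule: linorder_cases) auto
  show ?thesis by (rule ex1I[of _ n]) (blast intro: lower n, elim conjE, rule uniq)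
qed

lemma annulus_weight_bounds:
  assumes "\<alpha> < 1" "0 \<le> r" "r < 1" "1 - 1 / 2 ^ n \<le> r" "r < 1 - 1 / 2 ^ (n + 1)"
  shows "(1 - r) powr (1 - \<alpha>) \<le> 2 powr (- (1 - \<alpha>) * real n)"
    and "2 powr (- (1 - \<alpha>) * real n) \<le> 2 powr (1 - \<alpha>) * (1 - r) powr (1 - \<alpha>)"
proof -
  have w: "2 powr (- (1 - \<alpha>) * real n) = (1 / 2 ^ n) powr (1 - \<alpha>)"
  proof -
    have "(1 / 2 ^ n :: real) = 2 powr (- real n)" by (simp add: powr_minus powr_realpow divide_inverse)
    then show ?thesis unfolding powr_powr by (simp only: powr_powr mult_minus_left mult_minus_right mult.commute)
  qed
  show "(1 - r) powr (1 - \<alpha>) \<le> 2 powr (- (1 - \<alpha>) * real n)"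
    unfolding w using assms by (intro powr_mono2) auto
  have "1 / 2 ^ n \<le> 2 * (1 - r)" using assms by simp
  then have "(1 / 2 ^ n) powr (1 - \<alpha>) \<le> (2 * (1 - r)) powr (1 - \<alpha>)"
    using assms by (intro powr_mono2) auto
  also have "\<dots> = 2 powr (1 - \<alpha>) * (1 - r) powr (1 - \<alpha>)" by (rule powr_mult)
  finally show "2 powr (- (1 - \<alpha>) * real n) \<le> 2 powr (1 - \<alpha>) * (1 - r) powr (1 - \<alpha>)" unfolding w .
qed

text \<open>A point in the \<open>n\<close>-th annulus has \<open>1 - \<bar>z\<bar>\<close> between \<open>2 powr (- n - 1)\<close> and \<open>2 powr (- n)\<close>, so the two sums
agree termwise up to a factor \<open>2 powr (1 - \<alpha>)\<close>.\<close>

lemma weighted_count_sum_finite_iff: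
  assumes \<alpha>: "\<alpha> < 1" and L: "L \<subseteq> unit_disc"
  shows "weighted_count_sum \<alpha> L < \<infinity> \<longleftrightarrow> boundary_sum \<alpha> L < \<infinity>"
proof -
  let ?A = "\<lambda>n. {z \<in> L. 1 - 1 / 2 ^ n \<le> cmod z \<and> cmod z < 1 - 1 / 2 ^ (n + 1)}"
  let ?w = "\<lambda>n. ennreal (2 powr (- (1 - \<alpha>) * real n))"
  let ?h = "\<lambda>z. ennreal ((1 - cmod z) powr (1 - \<alpha>))"
  have pt: "?h z * indicator L z \<le> (\<Sum>n. ?w n * indicator (?A n) z) \<and>
      (\<Sum>n. ?w n * indicator (?A n) z) \<le> ennreal (2 powr (1 - \<alpha>)) * (?h z * indicator L z)" for z
  proof (cases "z \<in> L")
    case True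
    then have z: "0 \<le> cmod z" "cmod z < 1" using L by auto
    define P where "P k \<longleftrightarrow> 1 - 1 / 2 ^ k \<le> cmod z \<and> cmod z < 1 - 1 / 2 ^ (k + 1)" for k :: nat
    have "\<exists>!n. P n" unfolding P_def by (rule dyadic_annulus[OF z])
    then obtain n where Pn: "P n" and uniq: "\<And>k. P k \<Longrightarrow> k = n" by blast
    have n: "1 - 1 / 2 ^ n \<le> cmod z" "cmod z < 1 - 1 / 2 ^ (n + 1)" using Pn by (simp_all add: P_def)
    have "(\<Sum>k. ?w k * indicator (?A k) z) = (\<Sum>k\<in>{n}. ?w k * indicator (?A k) z)"
    proof (rule suminf_finite)
      fix k assume "k \<notin> {n}"
      then have "\<not> P k" using uniq[of k] by blast
      then have "z \<notin> ?A k" by (simp add: P_def)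
      then show "?w k * indicator (?A k) z = 0" by simp
    qed simp
    also have "\<dots> = ?w n" using True n by (simp add: indicator_def)
    finally have eq: "(\<Sum>k. ?w k * indicator (?A k) z) = ?w n" .
    show ?thesis
      unfolding eq using annulus_weight_bounds[OF \<alpha> z n(1,2)] True
      by (auto simp: ennreal_leI simp flip: ennreal_mult)
  qed simp
  have 1: "boundary_sum \<alpha> L \<le> weighted_count_sum \<alpha> L"
    unfolding weighted_count_sum_eq_nn_integral boundary_sum_def using pt by (intro nn_integral_mono) blast
  have "weighted_count_sum \<alpha> L \<le> (\<integral>\<^sup>+ z. ennreal (2 powr (1 - \<alpha>)) * (?h z * indicator L z) \<partial>count_space UNIV)"
    unfolding weighted_count_sum_eq_nn_integral using pt by (intro nn_integral_mono) blast
  also have "\<dots> = ennreal (2 powr (1 - \<alpha>)) * boundary_sum \<alpha> L"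
    unfolding boundary_sum_def by (rule nn_integral_cmult) simp
  finally have 2: "weighted_count_sum \<alpha> L \<le> ennreal (2 powr (1 - \<alpha>)) * boundary_sum \<alpha> L" .
  show ?thesis
  proof
    assume "boundary_sum \<alpha> L < \<infinity>"
    then have "ennreal (2 powr (1 - \<alpha>)) * boundary_sum \<alpha> L < \<infinity>" by (simp add: ennreal_mult_less_top)
    with 2 show "weighted_count_sum \<alpha> L < \<infinity>" by (rule le_less_trans)
  next
    assume "weighted_count_sum \<alpha> L < \<infinity>"
    with 1 show "boundary_sum \<alpha> L < \<infinity>" by (rule le_less_trans)
  qed
qed

lemma sum_le_boundary_sum:
  assumes "finite F" "F \<subseteq> L"
  shows "ennreal (\<Sum>a\<in>F. (1 - cmod a) powr (1 - \<alpha>)) \<le> boundary_sum \<alpha> L"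
proof -
  let ?h = "\<lambda>z. ennreal ((1 - cmod z) powr (1 - \<alpha>))"
  have "ennreal (\<Sum>a\<in>F. (1 - cmod a) powr (1 - \<alpha>)) = (\<Sum>a\<in>F. ?h a)"
    by (rule sum_ennreal[symmetric]) simp
  also have "\<dots> = (\<integral>\<^sup>+ z. ?h z \<partial>count_space F)"
    using assms by (simp add: nn_integral_count_space_finite)
  also have "\<dots> = (\<integral>\<^sup>+ z. ?h z * indicator F z \<partial>count_space UNIV)"
    by (rule nn_integral_count_space_indicator) simp
  also have "\<dots> \<le> boundary_sum \<alpha> L"
    unfolding boundary_sum_def using assms by (intro nn_integral_mono) (auto simp: indicator_def)
  finally show ?thesis .
qed

text \<open>Indices of radius \<open>0\<close> are left out: they all give the same point, whereas points of positive radius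
are almost surely distinct.\<close>

definition radius_sum :: "real \<Rightarrow> (nat \<Rightarrow> real) \<Rightarrow> ennreal" where
  "radius_sum \<alpha> \<rho> = (\<Sum>n. if 0 < \<rho> n then ennreal ((1 - \<rho> n) powr (1 - \<alpha>)) else 0)"

text \<open>The summand \<open>1\<close> accounts for the origin.\<close>

lemma boundary_sum_le_radius_sum:
  assumes \<rho>: "\<And>n. 0 \<le> \<rho> n \<and> \<rho> n < 1"
  shows "boundary_sum \<alpha> (random_points \<rho> \<theta> \<omega>) \<le> 1 + radius_sum \<alpha> \<rho>"
proof -
  let ?h = "\<lambda>z. ennreal ((1 - cmod z) powr (1 - \<alpha>))"
  let ?p = "\<lambda>n. rcis (\<rho> n) (\<theta> n \<omega>)"
  let ?c = "\<lambda>n. if 0 < \<rho> n then ennreal ((1 - \<rho> n) powr (1 - \<alpha>)) else 0"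
  have pt: "?h z * indicator (random_points \<rho> \<theta> \<omega>) z \<le> indicator {0} z + (\<Sum>n. ?c n * indicator {?p n} z)" for z
  proof (cases "z \<in> random_points \<rho> \<theta> \<omega>")
    case True
    then obtain n where n: "z = ?p n" by (auto simp: random_points_def)
    show ?thesis
    proof (cases "\<rho> n = 0")
      case True
      then have "z = 0" using n by simp
      then show ?thesis using \<open>z \<in> _\<close> by simp
    next
      case False
      then have r: "0 < \<rho> n" using \<rho>[of n] by simp
      have "?h z * indicator (random_points \<rho> \<theta> \<omega>) z = (\<Sum>k\<in>{n}. ?c k * indicator {?p k} z)"
        using True r by (simp add: n)
      also have "\<dots> \<le> (\<Sum>k. ?c k * indicator {?p k} z)" by (intro sum_le_suminf) auto
      also have "\<dots> \<le> indicator {0} z + (\<Sum>k. ?c k * indicator {?p k} z)" by simp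
      finally show ?thesis .
    qed
  qed simp
  have "boundary_sum \<alpha> (random_points \<rho> \<theta> \<omega>) \<le> (\<integral>\<^sup>+ z. indicator {0} z + (\<Sum>n. ?c n * indicator {?p n} z) \<partial>count_space UNIV)"
    unfolding boundary_sum_def by (intro nn_integral_mono pt)
  also have "\<dots> = (\<integral>\<^sup>+ z. indicator {0::complex} z \<partial>count_space UNIV) + (\<integral>\<^sup>+ z. (\<Sum>n. ?c n * indicator {?p n} z) \<partial>count_space UNIV)"
    by (rule nn_integral_add) auto
  also have "(\<integral>\<^sup>+ z. indicator {0::complex} z \<partial>count_space UNIV) = 1" by simp
  also have "(\<integral>\<^sup>+ z. (\<Sum>n. ?c n * indicator {?p n} z) \<partial>count_space UNIV) = (\<Sum>n. \<integral>\<^sup>+ z. ?c n * indicator {?p n} z \<partial>count_space UNIV)"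
    by (rule nn_integral_suminf) simp
  also have "\<dots> = radius_sum \<alpha> \<rho>"
    unfolding radius_sum_def by (intro suminf_cong) (subst nn_integral_cmult_indicator; simp)
  finally show ?thesis .
qed

lemma radius_sum_le:
  assumes "\<And>N. (\<Sum>n\<in>{n\<in>{..<N}. 0 < \<rho> n}. ennreal ((1 - \<rho> n) powr (1 - \<alpha>))) \<le> C"
  shows "radius_sum \<alpha> \<rho> \<le> C"
  unfolding radius_sum_def
proof (rule suminf_le_const)
  fix N
  have "(\<Sum>n<N. if 0 < \<rho> n then ennreal ((1 - \<rho> n) powr (1 - \<alpha>)) else 0)
     = (\<Sum>n\<in>{n\<in>{..<N}. 0 < \<rho> n}. ennreal ((1 - \<rho> n) powr (1 - \<alpha>)))"
    by (rule sum.inter_filter[symmetric]) simp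
  then show "(\<Sum>n<N. if 0 < \<rho> n then ennreal ((1 - \<rho> n) powr (1 - \<alpha>)) else 0) \<le> C"
    using assms[of N] by simp
qed simp

lemma radius_sum_le_boundary_sum:
  assumes \<rho>: "\<And>n. 0 \<le> \<rho> n \<and> \<rho> n < 1"
    and inj: "inj_on (\<lambda>n. rcis (\<rho> n) (\<theta> n \<omega>)) {n. 0 < \<rho> n}"
  shows "radius_sum \<alpha> \<rho> \<le> boundary_sum \<alpha> (random_points \<rho> \<theta> \<omega>)"
proof (rule radius_sum_le)
  fix N
  let ?J = "{n\<in>{..<N}. 0 < \<rho> n}" and ?p = "\<lambda>n. rcis (\<rho> n) (\<theta> n \<omega>)"
  have inj': "inj_on ?p ?J" by (rule inj_on_subset[OF inj]) auto
  have "(\<Sum>n\<in>?J. ennreal ((1 - \<rho> n) powr (1 - \<alpha>))) = ennreal (\<Sum>n\<in>?J. (1 - \<rho> n) powr (1 - \<alpha>))"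
    by (rule sum_ennreal) simp
  also have "(\<Sum>n\<in>?J. (1 - \<rho> n) powr (1 - \<alpha>)) = (\<Sum>a\<in>?p ` ?J. (1 - cmod a) powr (1 - \<alpha>))"
    by (subst sum.reindex[OF inj']) (auto intro!: sum.cong)
  also have "ennreal \<dots> \<le> boundary_sum \<alpha> (random_points \<rho> \<theta> \<omega>)"
    by (rule sum_le_boundary_sum) (auto simp: random_points_def)
  finally show "(\<Sum>n\<in>?J. ennreal ((1 - \<rho> n) powr (1 - \<alpha>))) \<le> boundary_sum \<alpha> (random_points \<rho> \<theta> \<omega>)" .
qed

lemma random_points_subset: "(\<And>n. 0 \<le> \<rho> n \<and> \<rho> n < 1) \<Longrightarrow> random_points \<rho> \<theta> \<omega> \<subseteq> unit_disc"
  by (auto simp: random_points_def)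

lemma is_zero_set_if_radius_sum_finite:
  assumes \<alpha>: "0 \<le> \<alpha>" "\<alpha> < 1" and \<rho>: "\<And>n. 0 \<le> \<rho> n \<and> \<rho> n < 1" and S: "radius_sum \<alpha> \<rho> < \<infinity>"
  shows "is_zero_set \<alpha> (random_points \<rho> \<theta> \<omega>)"
proof -
  let ?p = "\<lambda>n. rcis (\<rho> n) (\<theta> n \<omega>)"
  have b: "boundary_sum \<alpha> (range ?p) < \<infinity>"
  proof (rule le_less_trans)
    show "boundary_sum \<alpha> (range ?p) \<le> 1 + radius_sum \<alpha> \<rho>"
      using boundary_sum_le_radius_sum[OF \<rho>] by (simp add: random_points_def)
  qed (use S in simp)
  have "is_zero_set \<alpha> (range ?p)"
  proof (rule is_zero_set_if_summable[OF \<alpha>])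
    show "range ?p \<subseteq> unit_disc" using random_points_subset[OF \<rho>] by (simp add: random_points_def)
    fix F assume "finite F" "F \<subseteq> range ?p"
    from sum_le_boundary_sum[OF this, of \<alpha>] b
    show "(\<Sum>a\<in>F. (1 - cmod a) powr (1 - \<alpha>)) \<le> enn2real (boundary_sum \<alpha> (range ?p))"
      by (cases "boundary_sum \<alpha> (range ?p)" rule: ennreal_cases) auto
  qed
  then show ?thesis by (simp add: random_points_def)
qed

section \<open>Random angles\<close>

lemma ennreal_eq_top_if_not_less: "\<not> x < \<infinity> \<Longrightarrow> x = (\<infinity>::ennreal)"
  by (simp flip: less_top)

lemma rcis_inj:
  assumes "0 < r" "0 < r'" "x \<in> {0<..<2*pi}" "y \<in> {0<..<2*pi}" "rcis r x = rcis r' y"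
  shows "x = y"
proof -
  have "r = r'" using assms(1,2,5) by (metis abs_of_pos complex_mod_rcis)
  then have "cis x = cis y" using assms(1,5) by (simp add: rcis_def)
  then have "sin y = sin x \<and> cos y = cos x" by (simp add: complex_eq_iff)
  then obtain n :: int where n: "y = x + 2 * pi * n" unfolding sin_cos_eq_iff by blast
  have "2 * pi * of_int n = y - x" using n by simp
  then have "\<bar>2 * pi * of_int n\<bar> < 2 * pi * 1"
    using assms(3,4) unfolding greaterThanLessThan_iff abs_less_iff by linarith
  then have "\<bar>of_int n :: real\<bar> < 1" by (simp add: abs_mult)
  then have "n = 0" by linarith
  then show ?thesis using n by simp
qed

lemma zeros_finite_in_cball:
  assumes f: "f holomorphic_on unit_disc" and z: "z \<in> unit_disc" "f z \<noteq> 0"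
    and r: "r < 1" and A: "A \<subseteq> cball 0 r" "\<And>a. a \<in> A \<Longrightarrow> f a = 0"
  shows "finite A"
proof (rule ccontr)
  assume inf: "infinite A"
  obtain x where x: "x \<in> cball 0 r" "x islimpt A"
    using compact_cball[of "0::complex" r] inf A(1) unfolding compact_eq_Bolzano_Weierstrass by blast
  have sub: "cball 0 r \<subseteq> unit_disc" using r by auto
  have "f z = 0"
    by (rule analytic_continuation[OF f _ _ _ _ x(2) A(2) z(1)]) (use sub A x(1) in auto)
  with z(2) show False by simp
qed

context prob_space
begin

lemma prob_uniform_angle:
  assumes "distr M borel X = uniform_measure lborel {0..2 * pi}" "random_variable borel (X :: _ \<Rightarrow> real)" "A \<in> sets borel"
  shows "prob (X -` A \<inter> space M) = measure lborel ({0..2*pi} \<inter> A) / (2 * pi)"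
proof -
  have "prob (X -` A \<inter> space M) = measure (distr M borel X) A"
    by (rule measure_distr[symmetric]) (use assms in auto)
  also have "\<dots> = measure lborel ({0..2*pi} \<inter> A) / measure lborel {0..2*pi}"
    unfolding assms(1) by (rule measure_uniform_measure) (use assms in auto)
  finally show ?thesis by simp
qed

lemma prob_uniform_angle_near_ge:
  assumes X: "distr M borel X = uniform_measure lborel {0..2 * pi}" "random_variable borel X"
    and x: "x \<in> {0<..<2*pi}" and L: "0 < L" "L \<le> 1"
  shows "L / (2 * pi) \<le> prob (X -` ball x L \<inter> space M)"
proof -
  have pi1: "1 < pi" using pi_gt3 by simp
  have fin: "{0..2*pi} \<inter> ball x L \<in> fmeasurable lborel"
    by (rule fmeasurableI2[of "{0..2*pi}"]) (auto intro: fmeasurableI)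
  have "L \<le> measure lborel ({0..2*pi} \<inter> ball x L)"
  proof (cases "x \<le> pi")
    case True
    have "{x<..<x + L} \<subseteq> {0..2*pi} \<inter> ball x L"
      using x True L pi1 by (auto simp: dist_real_def)
    then have "measure lborel {x<..<x + L} \<le> measure lborel ({0..2*pi} \<inter> ball x L)"
      by (intro measure_mono_fmeasurable fin) auto
    then show ?thesis using L by simp
  next
    case False
    have "{x - L<..<x} \<subseteq> {0..2*pi} \<inter> ball x L"
      using x False L pi1 by (auto simp: dist_real_def)
    then have "measure lborel {x - L<..<x} \<le> measure lborel ({0..2*pi} \<inter> ball x L)"
      by (intro measure_mono_fmeasurable fin) auto
    then show ?thesis using L by simp
  qed
  then show ?thesis
    by (subst prob_uniform_angle[OF X]) (auto intro: divide_right_mono)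
qed

text \<open>The second Borel-Cantelli lemma: the probability that no angle with index in \<open>D\<close> is near \<open>x\<close> is a product of factors
\<open>1 - p \<le> exp (- p)\<close>, so it is small as soon as the sum of the \<open>L n\<close> over \<open>D\<close> is large.\<close>

lemma AE_infinitely_many_near:
  fixes \<theta> :: "nat \<Rightarrow> 'a \<Rightarrow> real"
  assumes ind: "indep_vars (\<lambda>_. borel) \<theta> UNIV"
    and unif: "\<And>n. distr M borel (\<theta> n) = uniform_measure lborel {0..2 * pi}"
    and L: "\<And>n. n \<in> J \<Longrightarrow> 0 < L n \<and> L n \<le> 1"
    and div: "\<And>C. \<exists>m. C < (\<Sum>n\<in>J \<inter> {..<m}. L n)"
    and x: "x \<in> {0<..<2*pi}"
  shows "AE \<omega> in M. infinite {n \<in> J. \<bar>\<theta> n \<omega> - x\<bar> < L n}"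
proof -
  have rv: "random_variable borel (\<theta> n)" for n using ind by (auto simp: indep_vars_def)
  have "AE \<omega> in M. \<exists>n\<ge>N. n \<in> J \<and> \<bar>\<theta> n \<omega> - x\<bar> < L n" for N
  proof -
    let ?E = "{\<omega> \<in> space M. \<not> (\<exists>n\<ge>N. n \<in> J \<and> \<bar>\<theta> n \<omega> - x\<bar> < L n)}"
    have E: "?E \<in> sets M"
      using rv by (intro sets.sets_Collect_neg sets.sets_Collect_countable_Ex sets.sets_Collect_conj
          sets.sets_Collect_const) measurable
    have "prob ?E \<le> e" if e: "0 < e" for e
    proof -
      \<comment> \<open>The indices below \<open>N\<close> contribute at most \<open>N\<close> to the sum.\<close>
      obtain m where m: "2 * pi * ln (1 / e) + real N < (\<Sum>n\<in>J \<inter> {..<m}. L n)" using div by blast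
      define D where "D = J \<inter> {N..<m}"
      have sD: "2 * pi * ln (1 / e) < (\<Sum>n\<in>D. L n)"
      proof -
        have "(\<Sum>n\<in>J \<inter> {..<m}. L n) \<le> (\<Sum>n\<in>D \<union> (J \<inter> {..<N}). L n)"
          using L by (intro sum_mono2) (auto simp: D_def less_imp_le)
        also have "\<dots> = (\<Sum>n\<in>D. L n) + (\<Sum>n\<in>J \<inter> {..<N}. L n)"
          by (rule sum.union_disjoint) (auto simp: D_def)
        also have "(\<Sum>n\<in>J \<inter> {..<N}. L n) \<le> (\<Sum>n\<in>J \<inter> {..<N}. 1)" using L by (intro sum_mono) auto
        also have "\<dots> \<le> real N"
          using card_mono[of "{..<N}" "J \<inter> {..<N}"] by simp
        finally show ?thesis using m by simp
      qed
      show ?thesis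
      proof (cases "D = {}")
        case True
        then have "ln (1 / e) < 0" using sD by (simp add: mult_less_0_iff)
        then have "1 < e" using e by (simp add: ln_div)
        then show ?thesis using prob_le_1[of ?E] by linarith
      next
        case False
        have "prob ?E \<le> prob (\<Inter>n\<in>D. \<theta> n -` (- ball x (L n)) \<inter> space M)"
        proof (rule finite_measure_mono)
          show "?E \<subseteq> (\<Inter>n\<in>D. \<theta> n -` (- ball x (L n)) \<inter> space M)"
            by (auto simp: D_def dist_real_def abs_minus_commute)
          show "(\<Inter>n\<in>D. \<theta> n -` (- ball x (L n)) \<inter> space M) \<in> sets M"
            using False by (intro sets.finite_INT measurable_sets[OF rv]) (auto simp: D_def)
        qed
        also have "\<dots> = (\<Prod>n\<in>D. prob (\<theta> n -` (- ball x (L n)) \<inter> space M))"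
          by (rule indep_varsD[OF ind False]) (auto simp: D_def)
        also have "\<dots> \<le> (\<Prod>n\<in>D. exp (- (L n / (2 * pi))))"
        proof (intro prod_mono conjI measure_nonneg)
          fix n assume "n \<in> D"
          then have n: "0 < L n" "L n \<le> 1" using L by (auto simp: D_def)
          have "prob (\<theta> n -` (- ball x (L n)) \<inter> space M) = 1 - prob (\<theta> n -` ball x (L n) \<inter> space M)"
          proof -
            have "\<theta> n -` (- ball x (L n)) \<inter> space M = space M - (\<theta> n -` ball x (L n) \<inter> space M)" by blast
            moreover have "\<theta> n -` ball x (L n) \<inter> space M \<in> sets M" by (rule measurable_sets[OF rv]) simp
            ultimately show ?thesis by (simp only: prob_compl)
          qed
          also have "\<dots> \<le> 1 - L n / (2 * pi)"
            using prob_uniform_angle_near_ge[OF unif rv x n] by simp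
          also have "\<dots> \<le> exp (- (L n / (2 * pi)))"
            using exp_ge_add_one_self[of "- (L n / (2 * pi))"] by simp
          finally show "prob (\<theta> n -` (- ball x (L n)) \<inter> space M) \<le> exp (- (L n / (2 * pi)))" .
        qed
        also have "\<dots> = exp (- ((\<Sum>n\<in>D. L n) / (2 * pi)))"
          by (subst exp_sum[symmetric]) (auto simp: D_def sum_negf sum_divide_distrib)
        also have "\<dots> \<le> exp (- ln (1 / e))"
          using sD by (simp add: pos_le_divide_eq mult.commute)
        also have "\<dots> = e" using e by (simp add: ln_div)
        finally show ?thesis .
      qed
    qed
    then have "prob ?E \<le> 0" by (rule dense_ge)
    then have "prob ?E = 0" using measure_nonneg[of M ?E] by linarith
    then have "emeasure M ?E = 0" by (simp add: emeasure_eq_measure)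
    then show ?thesis by (rule AE_I[OF subset_refl _ E])
  qed
  then have "AE \<omega> in M. \<forall>N. \<exists>n\<ge>N. n \<in> J \<and> \<bar>\<theta> n \<omega> - x\<bar> < L n"
    by (simp add: AE_all_countable)
  then show ?thesis by (simp add: infinite_nat_iff_unbounded_le)
qed

lemma AE_arcs_cover:
  fixes \<theta> :: "nat \<Rightarrow> 'a \<Rightarrow> real"
  assumes ind: "indep_vars (\<lambda>_. borel) \<theta> UNIV"
    and unif: "\<And>n. distr M borel (\<theta> n) = uniform_measure lborel {0..2 * pi}"
    and L: "\<And>n. n \<in> J \<Longrightarrow> 0 < L n \<and> L n \<le> 1"
    and div: "\<And>C. \<exists>m. C < (\<Sum>n\<in>J \<inter> {..<m}. L n)"
  shows "AE \<omega> in M. AE x in lborel. x \<in> {0<..<2*pi} \<longrightarrow> infinite {n \<in> J. \<bar>\<theta> n \<omega> - x\<bar> < L n}"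
proof -
  have [measurable]: "random_variable borel (\<theta> n)" for n using ind by (auto simp: indep_vars_def)
  interpret P: pair_sigma_finite M "lborel :: real measure"
    by (simp add: pair_sigma_finite_def sigma_finite_measure_axioms sigma_finite_lborel)
  have m: "{p \<in> space (M \<Otimes>\<^sub>M lborel). snd p \<in> {0<..<2*pi} \<longrightarrow> infinite {n \<in> J. \<bar>\<theta> n (fst p) - snd p\<bar> < L n}}
      \<in> sets (M \<Otimes>\<^sub>M lborel)"
  proof -
    have "{p \<in> space (M \<Otimes>\<^sub>M lborel). \<bar>\<theta> n (fst p) - snd p\<bar> < L n} \<in> sets (M \<Otimes>\<^sub>M lborel)" for n
      by measurable
    moreover have "{p \<in> space (M \<Otimes>\<^sub>M lborel). snd p \<in> {0<..<2*pi}} \<in> sets (M \<Otimes>\<^sub>M lborel)"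
      by measurable
    ultimately show ?thesis
      unfolding infinite_nat_iff_unbounded_le mem_Collect_eq
      by (intro sets.sets_Collect_imp sets.sets_Collect_countable_All sets.sets_Collect_countable_Ex
          sets.sets_Collect_conj sets.sets_Collect_const)
  qed
  have "AE x in lborel. AE \<omega> in M. x \<in> {0<..<2*pi} \<longrightarrow> infinite {n \<in> J. \<bar>\<theta> n \<omega> - x\<bar> < L n}"
  proof (rule AE_I2)
    fix x :: real
    show "AE \<omega> in M. x \<in> {0<..<2*pi} \<longrightarrow> infinite {n \<in> J. \<bar>\<theta> n \<omega> - x\<bar> < L n}"
    proof (cases "x \<in> {0<..<2*pi}")
      case True
      have "AE \<omega> in M. infinite {n \<in> J. \<bar>\<theta> n \<omega> - x\<bar> < L n}"
        by (rule AE_infinitely_many_near[OF ind unif L div True])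
      then show ?thesis by eventually_elim simp
    next
      case False
      then show ?thesis by (intro AE_I2) blast
    qed
  qed
  then show ?thesis using P.AE_commute[OF m] by simp
qed

text \<open>The joint law of two of the angles is a product of diffuse measures, which gives the diagonal measure \<open>0\<close>.\<close>

lemma AE_angles_distinct:
  fixes \<theta> :: "nat \<Rightarrow> 'a \<Rightarrow> real"
  assumes ind: "indep_vars (\<lambda>_. borel) \<theta> UNIV"
    and unif: "\<And>n. distr M borel (\<theta> n) = uniform_measure lborel {0..2 * pi}"
  shows "AE \<omega> in M. (\<forall>n. \<theta> n \<omega> \<in> {0<..<2*pi}) \<and> inj (\<lambda>n. \<theta> n \<omega>)"
proof -
  let ?U = "uniform_measure lborel {0..2 * pi}"
  have rv[measurable]: "random_variable borel (\<theta> n)" for n using ind by (auto simp: indep_vars_def)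
  have U: "prob_space ?U" using prob_space_distr[OF rv, of 0] by (simp add: unif)
  interpret U: prob_space ?U by (rule U)
  interpret UU: pair_sigma_finite ?U ?U by (simp add: pair_sigma_finite_def U.sigma_finite_measure_axioms)
  have in_iv: "AE \<omega> in M. \<theta> n \<omega> \<in> {0<..<2*pi}" for n
  proof -
    have "AE x in ?U. x \<in> {0<..<2*pi}"
    proof (rule AE_uniform_measureI)
      have "AE x in lborel. x \<noteq> (0::real)" "AE x in lborel. x \<noteq> 2 * pi" by (rule AE_lborel_singleton)+
      then show "AE x in lborel. x \<in> {0..2*pi} \<longrightarrow> x \<in> {0<..<2*pi}" by eventually_elim auto
    qed simp
    then have "AE x in distr M borel (\<theta> n). x \<in> {0<..<2*pi}" by (simp only: unif)
    then show ?thesis by (subst (asm) AE_distr_iff) auto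
  qed
  have ne: "AE \<omega> in M. \<theta> n \<omega> \<noteq> \<theta> m \<omega>" if nm: "n \<noteq> m" for n m
  proof -
    have joint: "?U \<Otimes>\<^sub>M ?U = distr M (borel \<Otimes>\<^sub>M borel) (\<lambda>\<omega>. (\<theta> n \<omega>, \<theta> m \<omega>))"
    proof (rule pair_measure_eqI)
      show "sigma_finite_measure ?U" by (rule U.sigma_finite_measure_axioms)
      show "sigma_finite_measure ?U" by (rule U.sigma_finite_measure_axioms)
      show "sets (?U \<Otimes>\<^sub>M ?U) = sets (distr M (borel \<Otimes>\<^sub>M borel) (\<lambda>\<omega>. (\<theta> n \<omega>, \<theta> m \<omega>)))"
        by (simp cong: sets_pair_measure_cong)
      fix A B assume "A \<in> sets ?U" "B \<in> sets ?U"
      then have [measurable]: "A \<in> sets borel" "B \<in> sets borel" by auto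
      have "emeasure ?U A * emeasure ?U B = emeasure (distr M borel (\<theta> n)) A * emeasure (distr M borel (\<theta> m)) B"
        by (simp add: unif)
      also have "\<dots> = ennreal (prob (\<theta> n -` A \<inter> space M) * prob (\<theta> m -` B \<inter> space M))"
        by (simp add: emeasure_distr emeasure_eq_measure ennreal_mult)
      also have "prob (\<theta> n -` A \<inter> space M) * prob (\<theta> m -` B \<inter> space M)
         = (\<Prod>i\<in>{n, m}. prob (\<theta> i -` (if i = n then A else B) \<inter> space M))"
        using nm by simp
      also have "\<dots> = prob (\<Inter>i\<in>{n, m}. \<theta> i -` (if i = n then A else B) \<inter> space M)"
        by (rule indep_varsD[OF ind, symmetric]) auto
      also have "(\<Inter>i\<in>{n, m}. \<theta> i -` (if i = n then A else B) \<inter> space M)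
         = (\<lambda>\<omega>. (\<theta> n \<omega>, \<theta> m \<omega>)) -` (A \<times> B) \<inter> space M"
        using nm by auto
      finally show "emeasure ?U A * emeasure ?U B = emeasure (distr M (borel \<Otimes>\<^sub>M borel) (\<lambda>\<omega>. (\<theta> n \<omega>, \<theta> m \<omega>))) (A \<times> B)"
        by (simp add: emeasure_distr emeasure_eq_measure)
    qed
    have "AE p in ?U \<Otimes>\<^sub>M ?U. fst p \<noteq> snd p"
    proof (rule UU.AE_pair_measure)
      have "{p \<in> space (borel \<Otimes>\<^sub>M borel). fst p \<noteq> (snd p :: real)} \<in> sets (borel \<Otimes>\<^sub>M borel)"
        by measurable
      then show "{p \<in> space (?U \<Otimes>\<^sub>M ?U). fst p \<noteq> snd p} \<in> sets (?U \<Otimes>\<^sub>M ?U)"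
        by (simp add: space_pair_measure cong: sets_pair_measure_cong)
      show "AE x in ?U. AE y in ?U. fst (x, y) \<noteq> snd (x, y)"
      proof (rule AE_I2, rule AE_uniform_measureI)
        fix x :: real
        have "AE y in lborel. y \<noteq> x" by (rule AE_lborel_singleton)
        then show "AE y in lborel. y \<in> {0..2*pi} \<longrightarrow> fst (x, y) \<noteq> snd (x, y)" by eventually_elim auto
      qed simp
    qed
    then show ?thesis unfolding joint by (subst (asm) AE_distr_iff) auto
  qed
  have "AE \<omega> in M. \<forall>n m. n \<noteq> m \<longrightarrow> \<theta> n \<omega> \<noteq> \<theta> m \<omega>"
    unfolding AE_all_countable using ne by auto
  moreover have "AE \<omega> in M. \<forall>n. \<theta> n \<omega> \<in> {0<..<2*pi}"
    unfolding AE_all_countable using in_iv by auto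
  ultimately show ?thesis by eventually_elim (auto simp: inj_on_def)
qed

text \<open>If the positive radii do not tend to \<open>1\<close>, the points accumulate inside the disc and the identity theorem applies.
Otherwise \<open>\<alpha> = 0\<close> is settled by the Blaschke condition and \<open>\<alpha> > 0\<close> by the arcs.\<close>

lemma AE_not_zero_set:
  fixes \<theta> :: "nat \<Rightarrow> 'a \<Rightarrow> real"
  assumes ind: "indep_vars (\<lambda>_. borel) \<theta> UNIV"
    and unif: "\<And>n. distr M borel (\<theta> n) = uniform_measure lborel {0..2 * pi}"
    and \<rho>: "\<And>n. 0 \<le> \<rho> n \<and> \<rho> n < 1" and \<alpha>: "0 \<le> \<alpha>" "\<alpha> < 1"
    and S: "radius_sum \<alpha> \<rho> = \<infinity>"
  shows "AE \<omega> in M. \<not> is_zero_set \<alpha> (random_points \<rho> \<theta> \<omega>) \<and> weighted_count_sum \<alpha> (random_points \<rho> \<theta> \<omega>) = \<infinity>"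
proof -
  let ?J = "{n. 0 < \<rho> n}"
  let ?p = "\<lambda>\<omega> n. rcis (\<rho> n) (\<theta> n \<omega>)"
  have div: "\<exists>m. C < (\<Sum>n\<in>?J \<inter> {..<m}. (1 - \<rho> n) powr (1 - \<alpha>))" for C
  proof (rule ccontr)
    assume *: "\<not> ?thesis"
    have "radius_sum \<alpha> \<rho> \<le> ennreal C"
    proof (rule radius_sum_le)
      fix N
      have eq: "{n\<in>{..<N}. 0 < \<rho> n} = ?J \<inter> {..<N}" by auto
      have "(\<Sum>n\<in>?J \<inter> {..<N}. ennreal ((1 - \<rho> n) powr (1 - \<alpha>)))
          = ennreal (\<Sum>n\<in>?J \<inter> {..<N}. (1 - \<rho> n) powr (1 - \<alpha>))"
        by (rule sum_ennreal) simp
      also have "\<dots> \<le> ennreal C"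
        using * by (intro ennreal_leI) (meson not_less)
      finally show "(\<Sum>n\<in>{n\<in>{..<N}. 0 < \<rho> n}. ennreal ((1 - \<rho> n) powr (1 - \<alpha>))) \<le> ennreal C"
        unfolding eq .
    qed
    with S show False by (simp add: top_unique)
  qed
  have inj: "AE \<omega> in M. inj_on (?p \<omega>) ?J"
    using AE_angles_distinct[OF ind unif]
  proof eventually_elim
    case (elim \<omega>)
    show ?case
    proof (rule inj_onI)
      fix n m assume "n \<in> ?J" "m \<in> ?J" "?p \<omega> n = ?p \<omega> m"
      then have "\<theta> n \<omega> = \<theta> m \<omega>" using elim by (intro rcis_inj[of "\<rho> n" "\<rho> m"]) auto
      with elim show "n = m" by (auto simp: inj_on_def)
    qed
  qed
  have W: "AE \<omega> in M. weighted_count_sum \<alpha> (random_points \<rho> \<theta> \<omega>) = \<infinity>"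
    using inj
  proof eventually_elim
    case (elim \<omega>)
    have "radius_sum \<alpha> \<rho> \<le> boundary_sum \<alpha> (random_points \<rho> \<theta> \<omega>)"
      by (rule radius_sum_le_boundary_sum[OF \<rho>]) (rule elim)
    then have "\<not> boundary_sum \<alpha> (random_points \<rho> \<theta> \<omega>) < \<infinity>"
      using S by (simp add: top_unique)
    then have "\<not> weighted_count_sum \<alpha> (random_points \<rho> \<theta> \<omega>) < \<infinity>"
      by (subst weighted_count_sum_finite_iff[OF \<alpha>(2) random_points_subset[OF \<rho>]])
    then show ?case by (rule ennreal_eq_top_if_not_less)
  qed
  have Z: "AE \<omega> in M. \<not> is_zero_set \<alpha> (random_points \<rho> \<theta> \<omega>)"
  proof (cases "\<forall>e>0. finite {n \<in> ?J. e \<le> 1 - \<rho> n}")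
    case False
    then obtain e where e: "0 < e" "infinite {n \<in> ?J. e \<le> 1 - \<rho> n}" by blast
    show ?thesis using inj
    proof eventually_elim
      case (elim \<omega>)
      show ?case
      proof
        assume "is_zero_set \<alpha> (random_points \<rho> \<theta> \<omega>)"
        then obtain f z where f: "f \<in> dirichlet_space \<alpha>" "z \<in> unit_disc" "f z \<noteq> 0"
          "\<forall>n. f (?p \<omega> n) = 0"
          by (auto simp: is_zero_set_def random_points_def)
        let ?A = "?p \<omega> ` {n \<in> ?J. e \<le> 1 - \<rho> n}"
        have "finite ?A"
        proof (rule zeros_finite_in_cball[of f z "1 - e"])
          show "f holomorphic_on unit_disc" using f by (simp add: dirichlet_space_def)
        qed (use f e \<rho> in auto)
        moreover have "inj_on (?p \<omega>) {n \<in> ?J. e \<le> 1 - \<rho> n}" by (rule inj_on_subset[OF elim]) auto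
        ultimately show False using e(2) by (simp add: finite_image_iff)
      qed
    qed
  next
    case True
    show ?thesis
    proof (cases "\<alpha> = 0")
      case \<alpha>0: True
      show ?thesis using inj
      proof eventually_elim
        case (elim \<omega>)
        show ?case
        proof
          assume "is_zero_set \<alpha> (random_points \<rho> \<theta> \<omega>)"
          then obtain f z where f: "f \<in> dirichlet_space 0" "z \<in> unit_disc" "f z \<noteq> 0"
            "\<forall>a \<in> random_points \<rho> \<theta> \<omega>. f a = 0"
            by (auto simp: is_zero_set_def \<alpha>0)
          have z1: "cmod z < 1" using f(2) by simp
          have "\<exists>C. \<forall>F. finite F \<longrightarrow> F \<subseteq> random_points \<rho> \<theta> \<omega> \<longrightarrow> (\<Sum>a\<in>F. 1 - cmod a) \<le> C"
            by (rule hardy_zeros_summable[OF f(1) z1 f(3) random_points_subset[OF \<rho>]]) (rule f(4)[rule_format])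
          then obtain C where C: "\<And>F. finite F \<Longrightarrow> F \<subseteq> random_points \<rho> \<theta> \<omega> \<Longrightarrow> (\<Sum>a\<in>F. 1 - cmod a) \<le> C"
            by auto
          obtain m where m: "C < (\<Sum>n\<in>?J \<inter> {..<m}. (1 - \<rho> n) powr (1 - \<alpha>))" using div by blast
          have inj': "inj_on (?p \<omega>) (?J \<inter> {..<m})" by (rule inj_on_subset[OF elim]) auto
          have "(\<Sum>n\<in>?J \<inter> {..<m}. (1 - \<rho> n) powr (1 - \<alpha>)) = (\<Sum>a\<in>?p \<omega> ` (?J \<inter> {..<m}). 1 - cmod a)"
            using \<rho> by (subst sum.reindex[OF inj']) (auto simp: \<alpha>0 less_imp_le intro!: sum.cong)
          also have "\<dots> \<le> C" by (rule C) (auto simp: random_points_def)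
          finally show False using m by simp
        qed
      qed
    next
      case False
      then have \<alpha>0: "0 < \<alpha>" using \<alpha> by simp
      have L: "0 < (1 - \<rho> n) powr (1 - \<alpha>) \<and> (1 - \<rho> n) powr (1 - \<alpha>) \<le> 1" for n
        using \<rho>[of n] \<alpha> by (auto intro!: powr_le1)
      show ?thesis using AE_arcs_cover[OF ind unif L div]
      proof eventually_elim
        case (elim \<omega>)
        show ?case
        proof
          assume "is_zero_set \<alpha> (random_points \<rho> \<theta> \<omega>)"
          then obtain f z where f: "f \<in> dirichlet_space \<alpha>" "z \<in> unit_disc" "f z \<noteq> 0"
            "\<forall>n. f (?p \<omega> n) = 0"
            by (auto simp: is_zero_set_def random_points_def)
          have "f z = 0"
            by (rule dirichlet_vanishes_if_arcs_cover[OF \<alpha>0 \<alpha>(2) f(1) _ _ _ elim])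
               (use \<rho> True f(2,4) in \<open>simp_all del: mem_Collect_eq\<close>)
          with f(3) show False by simp
        qed
      qed
    qed
  qed
  show ?thesis using Z W by eventually_elim simp
qed

end

section \<open>The dichotomy\<close>

theorem theorem1p2:
  fixes M :: "'w measure" and \<rho> :: "nat \<Rightarrow> real" and \<theta> :: "nat \<Rightarrow> 'w \<Rightarrow> real" and \<alpha> :: real
  assumes "prob_space M"
    and "\<And>n. 0 \<le> \<rho> n \<and> \<rho> n < 1"
    and "prob_space.indep_vars M (\<lambda>_. borel) \<theta> UNIV"
    and "\<And>n. distr M borel (\<theta> n) = uniform_measure lborel {0..2 * pi}"
    and "0 \<le> \<alpha>" and "\<alpha> < 1"
  shows "{\<omega> \<in> space M. is_zero_set \<alpha> (random_points \<rho> \<theta> \<omega>)} \<in> sets M \<and>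
    (AE \<omega>' in M.
      (measure M {\<omega> \<in> space M. is_zero_set \<alpha> (random_points \<rho> \<theta> \<omega>)} = 1 \<longleftrightarrow>
         weighted_count_sum \<alpha> (random_points \<rho> \<theta> \<omega>') < \<infinity>) \<and>
      (measure M {\<omega> \<in> space M. is_zero_set \<alpha> (random_points \<rho> \<theta> \<omega>)} = 0 \<longleftrightarrow>
         weighted_count_sum \<alpha> (random_points \<rho> \<theta> \<omega>') = \<infinity>))"
proof -
  interpret prob_space M by fact
  note \<rho> = assms(2) and ind = assms(3) and unif = assms(4) and \<alpha> = assms(5,6)
  let ?E = "{\<omega> \<in> space M. is_zero_set \<alpha> (random_points \<rho> \<theta> \<omega>)}"
  have E: "?E \<in> sets M"
    by (rule sets_zero_set_event[OF \<alpha> \<rho>]) (use ind in \<open>auto simp: indep_vars_def\<close>)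
  show ?thesis
  proof (intro conjI E, cases "radius_sum \<alpha> \<rho> < \<infinity>")
    case True
    have "is_zero_set \<alpha> (random_points \<rho> \<theta> \<omega>)" for \<omega>
      by (rule is_zero_set_if_radius_sum_finite[OF \<alpha> \<rho> True])
    then have "?E = space M" by simp
    then have "measure M ?E = 1" by (simp add: prob_space)
    moreover have W: "weighted_count_sum \<alpha> (random_points \<rho> \<theta> \<omega>') < \<infinity>" for \<omega>'
    proof -
      have "boundary_sum \<alpha> (random_points \<rho> \<theta> \<omega>') < \<infinity>"
        by (rule le_less_trans[OF boundary_sum_le_radius_sum[OF \<rho>]]) (use True in simp)
      then show ?thesis
        unfolding weighted_count_sum_finite_iff[OF \<alpha>(2) random_points_subset[OF \<rho>]] .
    qed
    moreover have "weighted_count_sum \<alpha> (random_points \<rho> \<theta> \<omega>') \<noteq> \<infinity>" for \<omega>'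
      using W by (rule less_imp_neq)
    ultimately show "AE \<omega>' in M.
      (measure M ?E = 1 \<longleftrightarrow> weighted_count_sum \<alpha> (random_points \<rho> \<theta> \<omega>') < \<infinity>) \<and>
      (measure M ?E = 0 \<longleftrightarrow> weighted_count_sum \<alpha> (random_points \<rho> \<theta> \<omega>') = \<infinity>)"
      by (intro AE_I2) simp
  next
    case False
    then have S: "radius_sum \<alpha> \<rho> = \<infinity>" by (rule ennreal_eq_top_if_not_less)
    have AE: "AE \<omega> in M. \<not> is_zero_set \<alpha> (random_points \<rho> \<theta> \<omega>) \<and>
        weighted_count_sum \<alpha> (random_points \<rho> \<theta> \<omega>) = \<infinity>"
      by (rule AE_not_zero_set[OF ind unif \<rho> \<alpha> S])
    then have "AE \<omega> in M. \<omega> \<notin> ?E" by eventually_elim simp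
    then have m0: "measure M ?E = 0" using E by (simp add: prob_eq_0)
    show "AE \<omega>' in M.
      (measure M ?E = 1 \<longleftrightarrow> weighted_count_sum \<alpha> (random_points \<rho> \<theta> \<omega>') < \<infinity>) \<and>
      (measure M ?E = 0 \<longleftrightarrow> weighted_count_sum \<alpha> (random_points \<rho> \<theta> \<omega>') = \<infinity>)"
      using AE by eventually_elim (simp add: m0)
  qed
qed

end
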